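(* Let $\mathcal{A}$ be a finite set, let $h$ be a penalty function on $\mathcal{X}=\Delta(\mathcal{A})$ with induced choice map $Q$, and let $X(t)$ be generated by the unilateral stochastically perturbed reinforcement learning process $$dY_\alpha(t)=v_\alpha(t)\,dt+\sigma_\alpha(t)\,dW_\alpha(t)\quad(\alpha\in\mathcal{A}),\qquad X(t)=Q(\eta(t)Y(t)),$$ run with a learning parameter satisfying $\eta(t)\sim t^{-\gamma}$ as $t\to\infty$ for some $\gamma\in(0,1)$. Then $$\operatorname{Reg}(t)=\begin{cases}\mathcal{O}(t^{1-\gamma})&\text{if }0<\gamma<\tfrac12,\\ \mathcal{O}(\sqrt{t\log\log t})&\text{if }\gamma=\tfrac12,\\ \mathcal{O}(t^{\gamma})&\text{if }\tfrac12<\gamma<1.\end{cases}$$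
   Context: $\mathcal{X}=\Delta(\mathcal{A})$ is the simplex of probability measures on $\mathcal{A}$, viewed in $\mathbb{R}^{\mathcal{A}}$. A penalty function $h:\mathcal{X}\to\mathbb{R}$ is a function that is continuous on $\mathcal{X}$, smooth on the relative interior of every face of $\mathcal{X}$, and strongly convex: there is $K>0$ with $h(tx+(1-t)x')\le t h(x)+(1-t)h(x')-\tfrac12 K t(1-t)\|x'-x\|^2$ for all $x,x'\in\mathcal{X}$, $t\in[0,1]$. The induced choice map is $Q(y)=\arg\max_{x\in\mathcal{X}}\{\langle y,x\rangle-h(x)\}$, $y\in\mathbb{R}^{\mathcal{A}}$. $v(t)=(v_\alpha(t))_{\alpha\in\mathcal{A}}$ is an arbitrary locally integrable stream of payoff vectors, $W(t)=(W_\alpha(t))_{\alpha\in\mathcal{A}}$ is a Wiener process in $\mathbb{R}^{\mathcal{A}}$ (independent components), and the noise coefficients $\sigma_\alpha(t)$ are continuous and bounded. Standing assumption on the learning parameter: $\eta:[0,\infty)\to(0,\infty)$ is $C^1$-smooth, nonincreasing and $\lim_{t\to\infty}t\eta(t)=+\infty$. The cumulative regret is $\operatorname{Reg}(t)=\max_{\alpha\in\mathcal{A}}\int_0^t v_\alpha(s)\,ds-\int_0^t\langle v(s),X(s)\rangle\,ds$. A statement $f(t)=\mathcal{O}(g(t))$ (as $t\to\infty$) for a stochastic process $f$ is meant in the almost sure sense: a.s. there exist a constant $C$ and a (random) $t_0$ with $|f(t)|\le C|g(t)|$ for all $t\ge t_0$. *)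

theory Defs
  imports "HOL-Probability.Probability" "HOL-Library.Landau_Symbols"
begin

section \<open>Penalty functions and choice maps\<close>

definition simplex_of_measures :: "(real ^ 'a) set" where
  "simplex_of_measures = {x. (\<forall>\<alpha>. 0 \<le> x $ \<alpha>) \<and> (\<Sum>\<alpha>\<in>UNIV. x $ \<alpha>) = 1}"

text \<open>
  The next two definitions are meant for sets \<open>S\<close> that are relatively open in their affine hull.
  For such \<open>S\<close> the derivative within \<open>S\<close> is determined exactly on the directions parallel to
  \<open>S\<close>; on transversal directions the witness \<open>f'\<close> is free (it can be taken to be \<open>0\<close> there), so
  this is the usual notion of a \<open>C\<^sup>k\<close> function on the manifold \<open>S\<close>.
\<close>

primrec C_k_on :: "nat \<Rightarrow> 'b::euclidean_space set \<Rightarrow> ('b \<Rightarrow> real) \<Rightarrow> bool" where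
  "C_k_on 0 S f \<longleftrightarrow> continuous_on S f"
| "C_k_on (Suc k) S f \<longleftrightarrow>
     (\<exists>f'. (\<forall>x\<in>S. (f has_derivative f' x) (at x within S)) \<and> (\<forall>u. C_k_on k S (\<lambda>x. f' x u)))"

definition smooth_on :: "'b::euclidean_space set \<Rightarrow> ('b \<Rightarrow> real) \<Rightarrow> bool" where
  "smooth_on S f \<longleftrightarrow> (\<forall>k. C_k_on k S f)"

definition strongly_convex_on :: "'b::euclidean_space set \<Rightarrow> ('b \<Rightarrow> real) \<Rightarrow> bool" where
  "strongly_convex_on S f \<longleftrightarrow>
     (\<exists>K>0. \<forall>x\<in>S. \<forall>x'\<in>S. \<forall>t\<in>{0..1}.
        f (t *\<^sub>R x + (1 - t) *\<^sub>R x')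
          \<le> t * f x + (1 - t) * f x' - 1/2 * K * t * (1 - t) * (norm (x' - x))\<^sup>2)"

definition penalty_function :: "(real ^ 'a \<Rightarrow> real) \<Rightarrow> bool" where
  "penalty_function h \<longleftrightarrow>
     continuous_on simplex_of_measures h \<and>
     (\<forall>F. F face_of simplex_of_measures \<longrightarrow> smooth_on (rel_interior F) h) \<and>
     strongly_convex_on simplex_of_measures h"

definition choice_map :: "(real ^ 'a \<Rightarrow> real) \<Rightarrow> real ^ 'a \<Rightarrow> real ^ 'a" where
  "choice_map h y = arg_max_on (\<lambda>x. y \<bullet> x - h x) simplex_of_measures"

definition learning_parameter :: "(real \<Rightarrow> real) \<Rightarrow> bool" where
  "learning_parameter \<eta> \<longleftrightarrow>
     (\<forall>t\<ge>0. 0 < \<eta> t) \<and>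
     (\<exists>\<eta>'. continuous_on {0..} \<eta>' \<and>
        (\<forall>t\<ge>0. (\<eta> has_real_derivative \<eta>' t) (at t within {0..}))) \<and>
     (\<forall>s t. 0 \<le> s \<longrightarrow> s \<le> t \<longrightarrow> \<eta> t \<le> \<eta> s) \<and>
     filterlim (\<lambda>t. t * \<eta> t) at_top at_top"


section \<open>Wiener processes and stochastic integrals\<close>

text \<open>
  Time is real-valued, and only times \<open>t \<ge> 0\<close> matter.  The locale \<open>filtration\<close> quantifies over all
  indices; a filtration indexed by \<open>t \<ge> 0\<close> is extended by \<open>F t = F 0\<close> for \<open>t < 0\<close>.
\<close>

definition filtered_prob_space :: "'w measure \<Rightarrow> (real \<Rightarrow> 'w measure) \<Rightarrow> bool" where
  "filtered_prob_space M F \<longleftrightarrow>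
     prob_space M \<and> filtration (space M) F \<and> (\<forall>t. subalgebra M (F t))"

definition adapted :: "(real \<Rightarrow> 'w measure) \<Rightarrow> (real \<Rightarrow> 'w \<Rightarrow> 'b::topological_space) \<Rightarrow> bool" where
  "adapted F Z \<longleftrightarrow> (\<forall>t\<ge>0. Z t \<in> borel_measurable (F t))"

definition wiener_process ::
    "'w measure \<Rightarrow> (real \<Rightarrow> 'w measure) \<Rightarrow> (real \<Rightarrow> 'w \<Rightarrow> real ^ 'a) \<Rightarrow> bool" where
  "wiener_process M F W \<longleftrightarrow>
     adapted F W \<and>
     (AE \<omega> in M. W 0 \<omega> = 0) \<and>
     (AE \<omega> in M. continuous_on {0..} (\<lambda>t. W t \<omega>)) \<and>
     (\<forall>s t. 0 \<le> s \<longrightarrow> s < t \<longrightarrow>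
        prob_space.indep_set M (sets (F s))
          {(\<lambda>\<omega>. W t \<omega> - W s \<omega>) -` B \<inter> space M |B. B \<in> sets borel} \<and>
        prob_space.indep_vars M (\<lambda>_. borel) (\<lambda>\<alpha> \<omega>. W t \<omega> $ \<alpha> - W s \<omega> $ \<alpha>) UNIV \<and>
        (\<forall>\<alpha>. distributed M lborel (\<lambda>\<omega>. W t \<omega> $ \<alpha> - W s \<omega> $ \<alpha>)
               (\<lambda>x. ennreal (normal_density 0 (sqrt (t - s)) x))))"

text \<open>
  The triple \<open>n\<close>, \<open>\<tau>\<close>, \<open>\<phi>\<close> encodes the elementary process on \<open>[0, T]\<close> that takes the value \<open>\<phi> k\<close>
  on \<open>[\<tau> k, \<tau> (k + 1))\<close> for \<open>k < n\<close>.
\<close>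

definition elementary_data ::
    "(real \<Rightarrow> 'w measure) \<Rightarrow> real \<Rightarrow> nat \<Rightarrow> (nat \<Rightarrow> real) \<Rightarrow> (nat \<Rightarrow> 'w \<Rightarrow> real) \<Rightarrow> bool" where
  "elementary_data F T n \<tau> \<phi> \<longleftrightarrow>
     0 \<le> \<tau> 0 \<and> \<tau> n \<le> T \<and>
     (\<forall>k<n. \<tau> k \<le> \<tau> (Suc k) \<and> \<phi> k \<in> borel_measurable (F (\<tau> k)) \<and>
        (\<exists>c. \<forall>\<omega>\<in>space (F (\<tau> k)). \<bar>\<phi> k \<omega>\<bar> \<le> c))"

definition elementary_process ::
    "nat \<Rightarrow> (nat \<Rightarrow> real) \<Rightarrow> (nat \<Rightarrow> 'w \<Rightarrow> real) \<Rightarrow> real \<Rightarrow> 'w \<Rightarrow> real" where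
  "elementary_process n \<tau> \<phi> s \<omega> = (\<Sum>k<n. \<phi> k \<omega> * indicator {\<tau> k..<\<tau> (Suc k)} s)"

definition elementary_integral ::
    "(real \<Rightarrow> 'w \<Rightarrow> real) \<Rightarrow> nat \<Rightarrow> (nat \<Rightarrow> real) \<Rightarrow> (nat \<Rightarrow> 'w \<Rightarrow> real) \<Rightarrow> 'w \<Rightarrow> real" where
  "elementary_integral B n \<tau> \<phi> \<omega> = (\<Sum>k<n. \<phi> k \<omega> * (B (\<tau> (Suc k)) \<omega> - B (\<tau> k) \<omega>))"

text \<open>
  \<open>I\<close> is (a continuous version of) the Ito integral process \<open>I t = \<integral>\<^sub>0\<^sup>t H dB\<close>: at each time it is the
  \<open>L\<^sup>2\<close>-limit of the integrals of elementary processes that converge to \<open>H\<close> in \<open>L\<^sup>2\<close>.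
\<close>

definition has_ito_integral ::
    "'w measure \<Rightarrow> (real \<Rightarrow> 'w measure) \<Rightarrow> (real \<Rightarrow> 'w \<Rightarrow> real) \<Rightarrow> (real \<Rightarrow> 'w \<Rightarrow> real) \<Rightarrow>
       (real \<Rightarrow> 'w \<Rightarrow> real) \<Rightarrow> bool" where
  "has_ito_integral M F B H I \<longleftrightarrow>
     (AE \<omega> in M. continuous_on {0..} (\<lambda>t. I t \<omega>)) \<and>
     (\<forall>T\<ge>0. I T \<in> borel_measurable M \<and>
        (\<exists>n \<tau> \<phi>. (\<forall>j::nat. elementary_data F T (n j) (\<tau> j) (\<phi> j)) \<and>
           (\<lambda>j. \<integral>\<^sup>+\<omega>. (\<integral>\<^sup>+s\<in>{0..T}.
                    ennreal ((elementary_process (n j) (\<tau> j) (\<phi> j) s \<omega> - H s \<omega>)\<^sup>2) \<partial>lborel) \<partial>M)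
             \<longlonglongrightarrow> 0 \<and>
           (\<lambda>j. \<integral>\<^sup>+\<omega>. ennreal ((elementary_integral B (n j) (\<tau> j) (\<phi> j) \<omega> - I T \<omega>)\<^sup>2) \<partial>M)
             \<longlonglongrightarrow> 0))"


section \<open>Stochastically perturbed reinforcement learning\<close>

definition payoff_stream :: "'w measure \<Rightarrow> (real \<Rightarrow> 'w \<Rightarrow> real ^ 'a) \<Rightarrow> bool" where
  "payoff_stream M v \<longleftrightarrow> (AE \<omega> in M. \<forall>T\<ge>0. (\<lambda>s. v s \<omega>) absolutely_integrable_on {0..T})"

definition noise_coefficients ::
    "'w measure \<Rightarrow> (real \<Rightarrow> 'w measure) \<Rightarrow> (real \<Rightarrow> 'w \<Rightarrow> real ^ 'a) \<Rightarrow> bool" where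
  "noise_coefficients M F \<sigma> \<longleftrightarrow>
     adapted F \<sigma> \<and>
     (\<forall>\<omega>\<in>space M. continuous_on {0..} (\<lambda>t. \<sigma> t \<omega>)) \<and>
     (\<exists>C. \<forall>t\<ge>0. \<forall>\<omega>\<in>space M. norm (\<sigma> t \<omega>) \<le> C)"

text \<open>
  \<open>Y\<close> is an adapted solution of \<open>dY\<^sub>\<alpha> = v\<^sub>\<alpha> dt + \<sigma>\<^sub>\<alpha> dW\<^sub>\<alpha>\<close> with arbitrary initial value \<open>Y 0\<close>.
  The payoffs \<open>v\<close> and the coefficients \<open>\<sigma>\<close> may depend on the outcome; adaptedness of \<open>Y\<close> is what
  keeps \<open>v\<close> from anticipating the noise.  If \<open>v\<close>, \<open>\<sigma>\<close> and \<open>Y 0\<close> are deterministic, any Wiener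
  process \<open>W\<close> is covered by taking for \<open>F\<close> the filtration generated by \<open>W\<close> and \<open>Y\<close>.
\<close>

definition perturbed_score_process ::
    "'w measure \<Rightarrow> (real \<Rightarrow> 'w measure) \<Rightarrow> (real \<Rightarrow> 'w \<Rightarrow> real ^ 'a) \<Rightarrow>
       (real \<Rightarrow> 'w \<Rightarrow> real ^ 'a) \<Rightarrow> (real \<Rightarrow> 'w \<Rightarrow> real ^ 'a) \<Rightarrow>
       (real \<Rightarrow> 'w \<Rightarrow> real ^ 'a) \<Rightarrow> bool" where
  "perturbed_score_process M F v \<sigma> W Y \<longleftrightarrow>
     adapted F Y \<and>
     (\<exists>I. (\<forall>\<alpha>. has_ito_integral M F (\<lambda>t \<omega>. W t \<omega> $ \<alpha>) (\<lambda>t \<omega>. \<sigma> t \<omega> $ \<alpha>) (I \<alpha>)) \<and>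
          (AE \<omega> in M. \<forall>t\<ge>0. \<forall>\<alpha>.
             Y t \<omega> $ \<alpha> = Y 0 \<omega> $ \<alpha> + integral {0..t} (\<lambda>s. v s \<omega> $ \<alpha>) + I \<alpha> t \<omega>))"

definition regret ::
    "(real \<Rightarrow> 'w \<Rightarrow> real ^ 'a) \<Rightarrow> (real \<Rightarrow> 'w \<Rightarrow> real ^ 'a) \<Rightarrow> real \<Rightarrow> 'w \<Rightarrow> real" where
  "regret v X t \<omega> =
     Max (range (\<lambda>\<alpha>. integral {0..t} (\<lambda>s. v s \<omega> $ \<alpha>))) - integral {0..t} (\<lambda>s. v s \<omega> \<bullet> X s \<omega>)"

end

theory Submission
  imports Defs "HOL-Real_Asymp.Real_Asymp"
begin

text \<open>
  Put \<open>h\<^sup>* y = max\<^sub>x (\<langle>y, x\<rangle> - h x)\<close> and \<open>\<Phi> t = h\<^sup>* (\<eta> t Y t) / \<eta> t\<close>.  Strong convexity of \<open>h\<close> makes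
  \<open>h\<^sup>*\<close> smooth with gradient \<open>Q\<close>, so along a time grid the increments of \<open>\<Phi>\<close> are \<open>\<langle>X, \<Delta>Y\<rangle>\<close> up to
  \<open>O(\<eta> \<bar>\<Delta>Y\<bar>\<^sup>2)\<close> and up to a drift from \<open>\<eta>\<close> that telescopes to \<open>O(1 / \<eta> t)\<close>; no Ito formula, and
  hence no second derivative of \<open>h\<^sup>*\<close>, is needed.  As \<open>\<Phi> t\<close> is the maximal score up to
  \<open>O(1 / \<eta> t)\<close>, the regret is, on both sides, bounded by \<open>1 / \<eta> t\<close>, the quadratic sums
  \<open>\<Sum> \<eta> \<bar>\<Delta>I\<bar>\<^sup>2\<close>, the noise \<open>I\<close> and the martingale sums \<open>\<Sum> \<langle>X, \<Delta>I\<rangle>\<close>.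

  Increments of \<open>I\<close> are conditionally sub-Gaussian.  The maximal inequality for exponential
  supermartingales bounds the martingale sums on \<open>[0, 2\<^sup>m]\<close> by \<open>C sqrt (2\<^sup>m ln m)\<close> with summable
  exceptional probabilities, which is the upper half of the law of the iterated logarithm.  The
  product \<open>\<Prod> (1 + \<mu> \<eta> \<bar>\<Delta>I\<bar>\<^sup>2)\<close> plays the same role for the quadratic sums, which are
  \<open>O(\<integral> \<eta>)\<close>.  All bounds are uniform in the grid and survive the passage to mesh zero.
\<close>

section \<open>The choice map and the score potential\<close>

text \<open>The notion of integral shapes the probability part: \<open>has_ito_integral\<close>
  gives, separately for each time, elementary processes that converge in L2, with no relation
  between different times, no adapted version and no uniform bound on the coefficients. The bound C
  on the integrand therefore has to be carried back to the approximants, by clipping their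
  coefficients to [-C, C] and cutting off what happens before s; the isometry shows that this costs
  nothing in the limit. Conditional expectations are replaced by estimates weighted with an
  arbitrary nonnegative function that is known at the initial time. The payoffs are merely
  integrable in time, so drift errors are measured against the integral of their norm. On the
  horizon 2^m the index m is of order log t, so ln m is the iterated logarithm. The regimes come
  from comparing 1 / eta = t^gamma, the integral of eta, which is t^(1 - gamma), and the noise sqrt
  (t log log t): the larger of gamma and 1 - gamma exceeds 1/2 unless gamma = 1/2, so only there is
  the noise visible.\<close>

definition convex_conjugate :: "(real ^ 'a::finite \<Rightarrow> real) \<Rightarrow> real ^ 'a \<Rightarrow> real" where
  "convex_conjugate h y = y \<bullet> choice_map h y - h (choice_map h y)"

lemma convex_simplex_of_measures: "convex (simplex_of_measures :: (real ^ 'a::finite) set)"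
  unfolding convex_def simplex_of_measures_def
  by (auto simp: sum.distrib simp flip: sum_distrib_left)

lemma simplex_of_measures_le_1:
  assumes "x \<in> simplex_of_measures"
  shows "x $ \<alpha> \<le> 1"
proof -
  have "x $ \<alpha> \<le> (\<Sum>\<beta>\<in>UNIV. x $ \<beta>)"
    using assms by (intro member_le_sum) (auto simp: simplex_of_measures_def)
  then show ?thesis using assms by (simp add: simplex_of_measures_def)
qed

lemma norm_simplex_of_measures_le_1:
  assumes "x \<in> simplex_of_measures"
  shows "norm x \<le> 1"
proof -
  have "norm x \<le> (\<Sum>\<alpha>\<in>UNIV. \<bar>x $ \<alpha>\<bar>)"
    by (rule norm_le_l1_cart)
  also have "\<dots> = 1"
    using assms by (simp add: simplex_of_measures_def)
  finally show ?thesis .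
qed

lemma compact_simplex_of_measures: "compact (simplex_of_measures :: (real ^ 'a::finite) set)"
proof -
  have "simplex_of_measures = (\<Inter>\<alpha>. {x::real^'a. 0 \<le> x $ \<alpha>}) \<inter> {x. (\<Sum>\<alpha>\<in>UNIV. x $ \<alpha>) = 1}"
    by (auto simp: simplex_of_measures_def)
  moreover have "closed \<dots>"
    by (intro closed_Int closed_INT ballI closed_Collect_le closed_Collect_eq continuous_intros)
  ultimately show ?thesis
    using norm_simplex_of_measures_le_1 by (auto simp: compact_eq_bounded_closed intro!: boundedI)
qed

lemma axis_in_simplex_of_measures: "axis \<alpha> 1 \<in> simplex_of_measures"
  by (auto simp: simplex_of_measures_def axis_def)

lemma inner_simplex_of_measures_le_Max:
  fixes y :: "real ^ 'a::finite"
  assumes "x \<in> simplex_of_measures"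
  shows "y \<bullet> x \<le> Max (range (($) y))"
proof -
  have "y \<bullet> x = (\<Sum>\<alpha>\<in>UNIV. y $ \<alpha> * x $ \<alpha>)"
    by (simp add: inner_vec_def)
  also have "\<dots> \<le> (\<Sum>\<alpha>\<in>UNIV. Max (range (($) y)) * x $ \<alpha>)"
    using assms by (intro sum_mono mult_right_mono) (auto simp: simplex_of_measures_def)
  also have "\<dots> = Max (range (($) y))"
    using assms by (simp add: simplex_of_measures_def flip: sum_distrib_left)
  finally show ?thesis .
qed

lemma penalty_function_bounded:
  assumes "penalty_function h"
  obtains H where "0 \<le> H" "\<And>x. x \<in> simplex_of_measures \<Longrightarrow> \<bar>h x\<bar> \<le> H"
proof -
  have "bounded (h ` simplex_of_measures)"
    using assms compact_simplex_of_measures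
    by (auto simp: penalty_function_def intro!: compact_imp_bounded compact_continuous_image)
  then obtain H where "\<And>x. x \<in> simplex_of_measures \<Longrightarrow> \<bar>h x\<bar> \<le> H"
    by (auto simp: bounded_iff)
  then show ?thesis
    by (intro that[of "max 0 H"]) force+
qed

lemma choice_map_is_max:
  assumes "penalty_function h"
  shows "choice_map h y \<in> simplex_of_measures"
    and "x \<in> simplex_of_measures \<Longrightarrow> y \<bullet> x - h x \<le> convex_conjugate h y"
proof -
  have "continuous_on simplex_of_measures (\<lambda>x. y \<bullet> x - h x)"
    using assms by (auto simp: penalty_function_def intro!: continuous_intros)
  then obtain m where "m \<in> simplex_of_measures"
      "\<forall>x\<in>simplex_of_measures. y \<bullet> x - h x \<le> y \<bullet> m - h m"
    using continuous_attains_sup[OF compact_simplex_of_measures, of "\<lambda>x. y \<bullet> x - h x"]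
      axis_in_simplex_of_measures[of undefined] by auto
  then have "is_arg_max (\<lambda>x. y \<bullet> x - h x) (\<lambda>x. x \<in> simplex_of_measures) m"
    by (auto simp: is_arg_max_linorder)
  \<comment> \<open>\<open>choice_map\<close> selects by Hilbert choice, so it has the maximum
    property only because compactness has produced the witness \<open>m\<close>.\<close>
  then have "is_arg_max (\<lambda>x. y \<bullet> x - h x) (\<lambda>x. x \<in> simplex_of_measures) (choice_map h y)"
    unfolding choice_map_def arg_max_on_def arg_max_def by (rule someI)
  then show "choice_map h y \<in> simplex_of_measures"
    and "x \<in> simplex_of_measures \<Longrightarrow> y \<bullet> x - h x \<le> convex_conjugate h y"
    by (auto simp: is_arg_max_linorder convex_conjugate_def)
qed

text \<open>The maximiser beats every point of the segment from itself to \<open>x\<close>. Strong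
  convexity gains a term of order t along this segment, which survives division by t as t tends to
  0. This curvature of the maximum is what makes the conjugate smooth.\<close>

lemma choice_map_quadratic_growth:
  assumes "penalty_function h"
  obtains K where "0 < K"
    "\<And>x y. x \<in> simplex_of_measures \<Longrightarrow>
       y \<bullet> x - h x \<le> convex_conjugate h y - K/2 * (norm (x - choice_map h y))\<^sup>2"
proof -
  obtain K where K: "0 < K" "\<And>x x' t. x \<in> simplex_of_measures \<Longrightarrow> x' \<in> simplex_of_measures \<Longrightarrow>
      t \<in> {0..1} \<Longrightarrow> h (t *\<^sub>R x + (1 - t) *\<^sub>R x')
        \<le> t * h x + (1 - t) * h x' - 1/2 * K * t * (1 - t) * (norm (x' - x))\<^sup>2"
    using assms unfolding penalty_function_def strongly_convex_on_def by blast
  show ?thesis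
  proof (rule that[OF K(1)])
    fix x y :: "real ^ 'a" assume x: "x \<in> simplex_of_measures"
    define q where "q = choice_map h y"
    have q: "q \<in> simplex_of_measures"
      using choice_map_is_max[OF assms] by (simp add: q_def)
    have *: "y \<bullet> x - h x + K/2 * (1 - t) * (norm (x - q))\<^sup>2 \<le> convex_conjugate h y"
      if t: "0 < t" "t < 1" for t
    proof -
      let ?z = "t *\<^sub>R x + (1 - t) *\<^sub>R q"
      have "?z \<in> simplex_of_measures"
        using convexD[OF convex_simplex_of_measures x q, of t "1 - t"] t by simp
      then have "y \<bullet> ?z - h ?z \<le> convex_conjugate h y"
        by (rule choice_map_is_max[OF assms])
      moreover have "h ?z \<le> t * h x + (1 - t) * h q - 1/2 * K * t * (1 - t) * (norm (q - x))\<^sup>2"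
        using t by (intro K x q) auto
      ultimately have "t * (y \<bullet> x - h x) + (1 - t) * convex_conjugate h y
          + 1/2 * K * t * (1 - t) * (norm (x - q))\<^sup>2 \<le> convex_conjugate h y"
        by (simp add: convex_conjugate_def q_def inner_add_right norm_minus_commute algebra_simps)
      then have "t * (y \<bullet> x - h x + K/2 * (1 - t) * (norm (x - q))\<^sup>2) \<le> t * convex_conjugate h y"
        by (simp add: algebra_simps)
      then show ?thesis
        using t by simp
    qed
    have "((\<lambda>t. y \<bullet> x - h x + K/2 * (1 - t) * (norm (x - q))\<^sup>2) \<longlongrightarrow>
            y \<bullet> x - h x + K/2 * (1 - 0) * (norm (x - q))\<^sup>2) (at_right 0)"
      by (intro tendsto_intros)
    moreover have "eventually (\<lambda>t. y \<bullet> x - h x + K/2 * (1 - t) * (norm (x - q))\<^sup>2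
        \<le> convex_conjugate h y) (at_right (0::real))"
      unfolding eventually_at_right_field using * by (intro exI[of _ 1]) auto
    ultimately have "y \<bullet> x - h x + K/2 * (1 - 0) * (norm (x - q))\<^sup>2 \<le> convex_conjugate h y"
      by (intro tendsto_upperbound[where F="at_right (0::real)"]) auto
    then show "y \<bullet> x - h x \<le> convex_conjugate h y - K/2 * (norm (x - choice_map h y))\<^sup>2"
      by (simp add: q_def)
  qed
qed

text \<open>The lower bound tests the old maximiser at the new point. The upper bound plays the
  quadratic growth against the linear gain \<open>norm d * r\<close> and completes the square, so
  the constant here is 1 / (2 K) for a growth constant K. Adding the growth inequalities at
  \<open>y\<close> and \<open>y'\<close> gives the Lipschitz bound.\<close>

lemma convex_conjugate_smooth:
  assumes "penalty_function h"
  obtains K where "0 < K"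
    "\<And>y d. convex_conjugate h y + choice_map h y \<bullet> d \<le> convex_conjugate h (y + d)"
    "\<And>y d. convex_conjugate h (y + d)
       \<le> convex_conjugate h y + choice_map h y \<bullet> d + K * (norm d)\<^sup>2"
    "\<And>y y'. norm (choice_map h y - choice_map h y') \<le> 2 * K * norm (y - y')"
proof -
  obtain K where K: "0 < K" "\<And>x y. x \<in> simplex_of_measures \<Longrightarrow>
       y \<bullet> x - h x \<le> convex_conjugate h y - K/2 * (norm (x - choice_map h y))\<^sup>2"
    using choice_map_quadratic_growth[OF assms] by blast
  note Q = choice_map_is_max[OF assms]
  show ?thesis
  proof (rule that[of "1 / (2 * K)"])
    show "0 < 1 / (2 * K)" using K by simp
  next
    fix y d
    show "convex_conjugate h y + choice_map h y \<bullet> d \<le> convex_conjugate h (y + d)"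
      using Q(2)[OF Q(1)[of y], of "y + d"]
      by (simp add: convex_conjugate_def inner_commute[of _ d] inner_commute[of "choice_map h y" y]
          inner_add_left)
  next
    fix y d
    let ?x = "choice_map h y" and ?x' = "choice_map h (y + d)"
    define r where "r = norm (?x' - ?x)"
    have "convex_conjugate h (y + d) = y \<bullet> ?x' - h ?x' + d \<bullet> ?x + d \<bullet> (?x' - ?x)"
      by (simp add: convex_conjugate_def inner_add_left inner_diff_right)
    also have "\<dots> \<le> convex_conjugate h y - K/2 * r\<^sup>2 + d \<bullet> ?x + norm d * r"
      using K(2)[OF Q(1)[of "y + d"], of y] norm_cauchy_schwarz[of d "?x' - ?x"]
      unfolding r_def by linarith
    moreover have "norm d * r - K/2 * r\<^sup>2 \<le> 1 / (2 * K) * (norm d)\<^sup>2"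
    proof -
      have "0 \<le> (norm d - K * r)\<^sup>2" by simp
      then show ?thesis
        using K(1) by (simp add: field_simps power2_eq_square)
    qed
    ultimately show "convex_conjugate h (y + d)
       \<le> convex_conjugate h y + choice_map h y \<bullet> d + 1 / (2 * K) * (norm d)\<^sup>2"
      by (simp add: inner_commute)
  next
    fix y y'
    let ?x = "choice_map h y" and ?x' = "choice_map h y'"
    have "y \<bullet> ?x' - h ?x' \<le> y \<bullet> ?x - h ?x - K/2 * (norm (?x' - ?x))\<^sup>2"
      using K(2)[OF Q(1)[of y'], of y] by (simp add: convex_conjugate_def)
    moreover have "y' \<bullet> ?x - h ?x \<le> y' \<bullet> ?x' - h ?x' - K/2 * (norm (?x - ?x'))\<^sup>2"
      using K(2)[OF Q(1)[of y], of y'] by (simp add: convex_conjugate_def)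
    ultimately have "K * (norm (?x - ?x'))\<^sup>2 \<le> (y - y') \<bullet> (?x - ?x')"
      by (simp add: inner_diff_left inner_diff_right norm_minus_commute)
    also have "\<dots> \<le> norm (y - y') * norm (?x - ?x')"
      by (rule norm_cauchy_schwarz)
    finally have "K * norm (?x - ?x') \<le> norm (y - y') \<or> norm (?x - ?x') = 0"
      by (auto simp: power2_eq_square mult.assoc[symmetric])
    then show "norm (?x - ?x') \<le> 2 * (1 / (2 * K)) * norm (y - y')"
      using K(1) by (auto simp: field_simps)
  qed
qed

lemma continuous_choice_map:
  assumes "penalty_function h"
  shows "continuous_on UNIV (choice_map h)"
proof -
  obtain K where K: "0 < K" "\<And>y y'. norm (choice_map h y - choice_map h y') \<le> 2 * K * norm (y - y')"
    using convex_conjugate_smooth[OF assms] by metis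
  then have "(2 * K)-lipschitz_on UNIV (choice_map h)"
    by (intro lipschitz_onI) (auto simp: dist_norm)
  then show ?thesis
    by (rule lipschitz_on_continuous_on)
qed

text \<open>A linear form attains its maximum over the simplex at a vertex, and \<open>h\<close>
  shifts values by at most \<open>H\<close>.\<close>

lemma convex_conjugate_near_Max:
  assumes "penalty_function h" and H: "\<And>x. x \<in> simplex_of_measures \<Longrightarrow> \<bar>h x\<bar> \<le> H"
  shows "\<bar>convex_conjugate h y - Max (range (($) y))\<bar> \<le> H"
proof -
  note Q = choice_map_is_max[OF assms(1)]
  have "convex_conjugate h y \<le> Max (range (($) y)) + H"
    using inner_simplex_of_measures_le_Max[OF Q(1), of y y] H[OF Q(1)[of y]]
    by (auto simp: convex_conjugate_def)
  moreover have "Max (range (($) y)) \<in> range (($) y)"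
    by (intro Max_in) auto
  then obtain \<alpha> where "Max (range (($) y)) = y $ \<alpha>"
    by blast
  then have "Max (range (($) y)) - H \<le> convex_conjugate h y"
    using Q(2)[OF axis_in_simplex_of_measures[of \<alpha>], of y] H[OF axis_in_simplex_of_measures[of \<alpha>]]
    by (auto simp: inner_axis)
  ultimately show ?thesis by linarith
qed

text \<open>This is the maximum of \<open>\<langle>y, x\<rangle> - h x / e\<close> over the simplex, so lowering \<open>e\<close> to \<open>e'\<close> changes it by
  at most \<open>(1 / e' - 1 / e) sup \<bar>h\<bar>\<close>, which telescopes along decreasing rates.\<close>

definition score_potential :: "(real ^ 'a::finite \<Rightarrow> real) \<Rightarrow> real \<Rightarrow> real ^ 'a \<Rightarrow> real" where
  "score_potential h e y = convex_conjugate h (e *\<^sub>R y) / e"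

lemma score_potential_rate_mono:
  assumes "penalty_function h" and H: "\<And>x. x \<in> simplex_of_measures \<Longrightarrow> \<bar>h x\<bar> \<le> H"
    and e: "0 < e'" "e' \<le> e"
  shows "\<bar>score_potential h e' y - score_potential h e y\<bar> \<le> H * (1 / e' - 1 / e)"
proof -
  \<comment> \<open>The maximiser for rate \<open>b\<close> is tested at rate \<open>a\<close>. The
    two rates are not ordered here, so exchanging them gives the other side of the estimate.\<close>
  have *: "score_potential h a y \<ge> score_potential h b y - h (choice_map h (b *\<^sub>R y)) * (1 / a - 1 / b)"
    if "0 < a" "0 < b" for a b
  proof -
    let ?x = "choice_map h (b *\<^sub>R y)"
    have "(a *\<^sub>R y) \<bullet> ?x - h ?x \<le> convex_conjugate h (a *\<^sub>R y)"
      by (intro choice_map_is_max assms)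
    then have "((a *\<^sub>R y) \<bullet> ?x - h ?x) / a \<le> score_potential h a y"
      using that unfolding score_potential_def by (intro divide_right_mono) auto
    then have "y \<bullet> ?x - h ?x / a \<le> score_potential h a y"
      using that by (simp add: diff_divide_distrib)
    moreover have "score_potential h b y = y \<bullet> ?x - h ?x / b"
      using that by (simp add: score_potential_def convex_conjugate_def diff_divide_distrib)
    ultimately show ?thesis
      by (simp add: algebra_simps)
  qed
  have d: "1 / e' - 1 / e \<ge> 0"
    using e by (simp add: frac_le)
  have b: "\<bar>h (choice_map h z) * (1 / e' - 1 / e)\<bar> \<le> H * (1 / e' - 1 / e)" for z
    using H[OF choice_map_is_max(1)[OF assms(1)]] d by (simp add: abs_mult mult_right_mono)
  have "h z * (1 / e - 1 / e') = - (h z * (1 / e' - 1 / e))" for z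
    by (simp add: algebra_simps)
  then show ?thesis
    using *[of e' e] *[of e e'] b[of "e *\<^sub>R y"] b[of "e' *\<^sub>R y"] e by (auto simp: abs_le_iff)
qed

text \<open>Rescaling turns an increment d into e d, whose square contributes e^2; dividing by e
  leaves one factor. This is why the quadratic sums carry the learning rate as weight.\<close>

lemma score_potential_increment:
  assumes "0 < e"
    and "\<And>y d. convex_conjugate h y + choice_map h y \<bullet> d \<le> convex_conjugate h (y + d)"
    and "\<And>y d. convex_conjugate h (y + d)
           \<le> convex_conjugate h y + choice_map h y \<bullet> d + K * (norm d)\<^sup>2"
  shows "choice_map h (e *\<^sub>R y) \<bullet> (y' - y) \<le> score_potential h e y' - score_potential h e y"
    and "score_potential h e y' - score_potential h e y
           \<le> choice_map h (e *\<^sub>R y) \<bullet> (y' - y) + K * e * (norm (y' - y))\<^sup>2"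
proof -
  have y': "e *\<^sub>R y' = e *\<^sub>R y + e *\<^sub>R (y' - y)"
    by (simp add: algebra_simps)
  have "e * (choice_map h (e *\<^sub>R y) \<bullet> (y' - y)) \<le> convex_conjugate h (e *\<^sub>R y') - convex_conjugate h (e *\<^sub>R y)"
    using assms(2)[of "e *\<^sub>R y" "e *\<^sub>R (y' - y)"] unfolding y'[symmetric] by simp
  then show "choice_map h (e *\<^sub>R y) \<bullet> (y' - y) \<le> score_potential h e y' - score_potential h e y"
    using assms(1) by (simp add: score_potential_def field_simps)
  have "convex_conjugate h (e *\<^sub>R y') - convex_conjugate h (e *\<^sub>R y)
      \<le> e * (choice_map h (e *\<^sub>R y) \<bullet> (y' - y) + K * e * (norm (y' - y))\<^sup>2)"
    using assms(3)[of "e *\<^sub>R y" "e *\<^sub>R (y' - y)"] assms(1) unfolding y'[symmetric]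
    by (simp add: power_mult_distrib distrib_left power2_eq_square mult_ac del: scaleR_diff_right)
  then show "score_potential h e y' - score_potential h e y
           \<le> choice_map h (e *\<^sub>R y) \<bullet> (y' - y) + K * e * (norm (y' - y))\<^sup>2"
    using assms(1) by (simp add: score_potential_def field_simps)
qed

section \<open>The Ito isometry for step functions\<close>

text \<open>Independence of random variables is phrased with generated sigma-algebras, independence
  of increments with bare preimages; the preimages already form a sigma-algebra, so the two
  meet.\<close>

lemma sigma_sets_vimage_eq:
  assumes "f \<in> X \<rightarrow> space N"
  shows "sigma_sets X {f -` A \<inter> X |A. A \<in> sets N} = {f -` A \<inter> X |A. A \<in> sets N}"
  using sigma_sets_vimage_commute[OF assms, of "sets N"] by (simp add: sets.sigma_sets_eq)

lemma (in prob_space) indep_var_nn_integral: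
  fixes X Y :: "'a \<Rightarrow> ennreal"
  assumes "indep_var borel X borel Y"
  shows "(\<integral>\<^sup>+\<omega>. X \<omega> * Y \<omega> \<partial>M) = (\<integral>\<^sup>+\<omega>. X \<omega> \<partial>M) * (\<integral>\<^sup>+\<omega>. Y \<omega> \<partial>M)"
proof -
  have "case_bool borel borel = (\<lambda>_. borel :: ennreal measure)"
    by (auto split: bool.split)
  then have "(\<integral>\<^sup>+\<omega>. (\<Prod>i\<in>UNIV. case_bool X Y i \<omega>) \<partial>M) = (\<Prod>i\<in>UNIV. \<integral>\<^sup>+\<omega>. case_bool X Y i \<omega> \<partial>M)"
    using assms unfolding indep_var_def by (intro indep_vars_nn_integral) auto
  then show ?thesis
    by (simp add: UNIV_bool mult.commute)
qed

lemma (in prob_space) indep_set_mono: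
  "indep_set A B \<Longrightarrow> A' \<subseteq> A \<Longrightarrow> B' \<subseteq> B \<Longrightarrow> indep_set A' B'"
  unfolding indep_sets2_eq by (meson subset_eq)

locale brownian_motion = prob_space M for M :: "'w measure" +
  fixes F :: "real \<Rightarrow> 'w measure" and B :: "real \<Rightarrow> 'w \<Rightarrow> real"
  assumes filtered: "filtered_prob_space M F"
    and adapted: "adapted F B"
    and indep_increments: "\<And>s t. 0 \<le> s \<Longrightarrow> s < t \<Longrightarrow>
          indep_set (sets (F s)) {(\<lambda>\<omega>. B t \<omega> - B s \<omega>) -` A \<inter> space M |A. A \<in> sets borel}"
    and normal_increments: "\<And>s t. 0 \<le> s \<Longrightarrow> s < t \<Longrightarrow>
          distributed M lborel (\<lambda>\<omega>. B t \<omega> - B s \<omega>) (\<lambda>x. ennreal (normal_density 0 (sqrt (t - s)) x))"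
begin

lemma space_F [simp]: "space (F t) = space M"
  using filtered by (simp add: filtered_prob_space_def subalgebra_def)

lemma measurable_F_mono: "s \<le> t \<Longrightarrow> f \<in> measurable (F s) N \<Longrightarrow> f \<in> measurable (F t) N"
  using filtered measurable_mono[of N N "F s" "F t"]
  by (auto simp: filtered_prob_space_def filtration_def)

lemma measurable_F_M: "f \<in> measurable (F s) N \<Longrightarrow> f \<in> measurable M N"
  using filtered by (auto simp: filtered_prob_space_def intro: measurable_from_subalg)

lemma measurable_B_F: "0 \<le> s \<Longrightarrow> s \<le> t \<Longrightarrow> B s \<in> borel_measurable (F t)"
  using adapted measurable_F_mono[of s t "B s" borel] by (simp add: adapted_def)

lemma measurable_B: "0 \<le> s \<Longrightarrow> B s \<in> borel_measurable M"
  using measurable_F_M measurable_B_F by blast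

lemma indep_var_increment:
  assumes "0 \<le> s" "s < t" and g: "g \<in> measurable (F s) N" and k: "k \<in> measurable borel N'"
  shows "indep_var N g N' (\<lambda>\<omega>. k (B t \<omega> - B s \<omega>))"
proof -
  have [measurable]: "B s \<in> borel_measurable M" "B t \<in> borel_measurable M"
    using assms by (auto intro: measurable_B)
  note [measurable] = k
  have [measurable]: "g \<in> measurable M N"
    using g by (rule measurable_F_M)
  have kB: "(\<lambda>\<omega>. k (B t \<omega> - B s \<omega>)) \<in> measurable M N'"
    using assms by measurable
  have "{g -` A \<inter> space M |A. A \<in> sets N} \<subseteq> sets (F s)"
    using measurable_sets[OF g] by auto
  moreover have "{(\<lambda>\<omega>. k (B t \<omega> - B s \<omega>)) -` A \<inter> space M |A. A \<in> sets N'}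
      \<subseteq> {(\<lambda>\<omega>. B t \<omega> - B s \<omega>) -` A \<inter> space M |A. A \<in> sets borel}"
  proof clarify
    fix A assume "A \<in> sets N'"
    then have "k -` A \<inter> space borel \<in> sets borel"
      using k by (rule measurable_sets[rotated])
    then show "\<exists>A'. (\<lambda>\<omega>. k (B t \<omega> - B s \<omega>)) -` A \<inter> space M
        = (\<lambda>\<omega>. B t \<omega> - B s \<omega>) -` A' \<inter> space M \<and> A' \<in> sets borel"
      by (intro exI[of _ "k -` A \<inter> space borel"]) auto
  qed
  ultimately have "indep_set {g -` A \<inter> space M |A. A \<in> sets N}
      {(\<lambda>\<omega>. k (B t \<omega> - B s \<omega>)) -` A \<inter> space M |A. A \<in> sets N'}"
    by (rule indep_set_mono[OF indep_increments[OF assms(1,2)]])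
  then show ?thesis
    unfolding indep_var_eq using kB measurable_space[OF kB] measurable_space[OF g]
    by (subst (1 2) sigma_sets_vimage_eq) auto
qed

text \<open>Stating the moment against every nonnegative weight \<open>g\<close> known at time
  \<open>s\<close> expresses the conditional moment given \<open>F s\<close>. All later exponential
  bounds take this form.\<close>

lemma nn_integral_exp_increment:
  assumes "0 \<le> s" "s \<le> t" and g: "g \<in> borel_measurable (F s)"
  shows "(\<integral>\<^sup>+\<omega>. g \<omega> * ennreal (exp (u * (B t \<omega> - B s \<omega>))) \<partial>M)
    = ennreal (exp (u\<^sup>2 * (t - s) / 2)) * (\<integral>\<^sup>+\<omega>. g \<omega> \<partial>M)"
\<comment> \<open>Degenerate increments are treated apart because the Gaussian law is only given for
  s < t.\<close>
proof (cases "s = t")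
  case False
  then have st: "s < t" using assms by simp
  define d where "d = sqrt (t - s)"
  have d: "0 < d" "d\<^sup>2 = t - s" using st by (auto simp: d_def)
  have "(\<integral>\<^sup>+\<omega>. ennreal (exp (u * (B t \<omega> - B s \<omega>))) \<partial>M)
      = (\<integral>\<^sup>+x. ennreal (normal_density 0 d x) * ennreal (exp (u * x)) \<partial>lborel)"
    using distributed_nn_integral[OF normal_increments[OF assms(1) st], of "\<lambda>x. ennreal (exp (u * x))"]
    by (simp add: d_def)
  also have "\<dots> = (\<integral>\<^sup>+x. ennreal (exp (u\<^sup>2 * d\<^sup>2 / 2)) * ennreal (normal_density (u * d\<^sup>2) d x) \<partial>lborel)"
  proof (intro nn_integral_cong)
    fix x
    \<comment> \<open>Completing the square: the exponential tilt moves the mean from 0 to u d^2 and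
      leaves a constant factor.\<close>
    have "- x\<^sup>2 / (2 * d\<^sup>2) + u * x = u\<^sup>2 * d\<^sup>2 / 2 + - (x - u * d\<^sup>2)\<^sup>2 / (2 * d\<^sup>2)"
      using d(1) by (simp add: field_simps power2_eq_square)
    then show "ennreal (normal_density 0 d x) * ennreal (exp (u * x))
        = ennreal (exp (u\<^sup>2 * d\<^sup>2 / 2)) * ennreal (normal_density (u * d\<^sup>2) d x)"
      by (simp add: normal_density_def flip: ennreal_mult exp_add)
  qed
  also have "\<dots> = ennreal (exp (u\<^sup>2 * (t - s) / 2)) * (\<integral>\<^sup>+x. ennreal (normal_density (u * d\<^sup>2) d x) \<partial>lborel)"
    using d by (subst nn_integral_cmult) auto
  also have "(\<integral>\<^sup>+x. ennreal (normal_density (u * d\<^sup>2) d x) \<partial>lborel) = 1"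
    using d by (subst nn_integral_eq_integral) auto
  finally have "(\<integral>\<^sup>+\<omega>. ennreal (exp (u * (B t \<omega> - B s \<omega>))) \<partial>M) = ennreal (exp (u\<^sup>2 * (t - s) / 2))"
    by simp
  moreover have "indep_var borel g borel (\<lambda>\<omega>. ennreal (exp (u * (B t \<omega> - B s \<omega>))))"
    by (rule indep_var_increment[OF assms(1) st g]) simp
  ultimately show ?thesis
    by (subst indep_var_nn_integral) (auto simp: mult.commute)
qed (simp add: nn_integral_cmult)

lemma has_bochner_integral_increment:
  assumes "0 \<le> s" "s \<le> t" and g: "g \<in> borel_measurable (F s)" "integrable M g"
  shows "has_bochner_integral M (\<lambda>\<omega>. g \<omega> * (B t \<omega> - B s \<omega>)) 0"
    and "has_bochner_integral M (\<lambda>\<omega>. g \<omega> * (B t \<omega> - B s \<omega>)\<^sup>2) ((t - s) * (\<integral>\<omega>. g \<omega> \<partial>M))"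
proof -
  have "has_bochner_integral M (\<lambda>\<omega>. g \<omega> * (B t \<omega> - B s \<omega>)) 0 \<and>
    has_bochner_integral M (\<lambda>\<omega>. g \<omega> * (B t \<omega> - B s \<omega>)\<^sup>2) ((t - s) * (\<integral>\<omega>. g \<omega> \<partial>M))"
  proof (cases "s = t")
    case True
    then show ?thesis by (simp add: has_bochner_integral_zero)
  next
    case False
    then have st: "s < t" using assms by simp
    define d where "d = sqrt (t - s)"
    have d: "0 < d" "d\<^sup>2 = t - s" using st by (auto simp: d_def)
    note D = normal_increments[OF assms(1) st, folded d_def]
    have 1: "integrable M (\<lambda>\<omega>. B t \<omega> - B s \<omega>)" "(\<integral>\<omega>. (B t \<omega> - B s \<omega>) \<partial>M) = 0"
      using distributed_integrable[OF D, of "\<lambda>x. x"] distributed_integral[OF D, of "\<lambda>x. x"]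
        integrable_normal_moment_nz_1[OF d(1), of 0] integral_normal_moment_nz_1[OF d(1), of 0]
      by auto
    have 2: "integrable M (\<lambda>\<omega>. (B t \<omega> - B s \<omega>)\<^sup>2)" "(\<integral>\<omega>. (B t \<omega> - B s \<omega>)\<^sup>2 \<partial>M) = t - s"
    proof -
      have "integrable lborel (\<lambda>x. normal_density 0 d x * x\<^sup>2)"
        using integrable_normal_moment[OF d(1), of 0 2] by simp
      then show "integrable M (\<lambda>\<omega>. (B t \<omega> - B s \<omega>)\<^sup>2)"
        by (subst distributed_integrable[OF D, symmetric, of "\<lambda>x. x\<^sup>2"]) auto
      have "(\<integral>\<omega>. (B t \<omega> - B s \<omega>)\<^sup>2 \<partial>M) = (\<integral>x. normal_density 0 d x * x\<^sup>2 \<partial>lborel)"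
        by (subst distributed_integral[OF D, symmetric, of "\<lambda>x. x\<^sup>2"]) auto
      also have "\<dots> = d\<^sup>2"
        using integral_normal_moment_even[OF d(1), of 0 1] by simp
      finally show "(\<integral>\<omega>. (B t \<omega> - B s \<omega>)\<^sup>2 \<partial>M) = t - s"
        unfolding d(2) .
    qed
    have i1: "indep_var borel g borel (\<lambda>\<omega>. B t \<omega> - B s \<omega>)"
      using indep_var_increment[OF assms(1) st g(1), of "\<lambda>x. x" borel] by simp
    have i2: "indep_var borel g borel (\<lambda>\<omega>. (B t \<omega> - B s \<omega>)\<^sup>2)"
      using indep_var_increment[OF assms(1) st g(1), of "\<lambda>x. x\<^sup>2" borel] by simp
    show ?thesis
      using indep_var_integrable[OF i1 g(2) 1(1)] indep_var_lebesgue_integral[OF i1 g(2) 1(1)]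
        indep_var_integrable[OF i2 g(2) 2(1)] indep_var_lebesgue_integral[OF i2 g(2) 2(1)] 1 2
      by (simp add: has_bochner_integral_iff)
  qed
  then show "has_bochner_integral M (\<lambda>\<omega>. g \<omega> * (B t \<omega> - B s \<omega>)) 0"
    and "has_bochner_integral M (\<lambda>\<omega>. g \<omega> * (B t \<omega> - B s \<omega>)\<^sup>2) ((t - s) * (\<integral>\<omega>. g \<omega> \<partial>M))"
    by auto
qed

lemma integrable_bounded:
  fixes g :: "'w \<Rightarrow> real"
  assumes "g \<in> borel_measurable (F s)" "\<And>\<omega>. \<omega> \<in> space M \<Longrightarrow> \<bar>g \<omega>\<bar> \<le> c"
  shows "integrable M g"
  using assms by (intro integrable_const_bound[of _ c] measurable_F_M[of g s]) auto

text \<open>Both coefficients are known at time \<open>c\<close>, so only the common part of the two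
  intervals contributes: every other product contains an increment that starts after everything else
  in it is known.\<close>

lemma covariance_increments_aux:
  assumes ab: "0 \<le> a" "a \<le> b" and cd: "c \<le> d" and ac: "a \<le> c"
    and f: "f \<in> borel_measurable (F a)" "\<And>\<omega>. \<omega> \<in> space M \<Longrightarrow> \<bar>f \<omega>\<bar> \<le> C"
    and g: "g \<in> borel_measurable (F c)" "\<And>\<omega>. \<omega> \<in> space M \<Longrightarrow> \<bar>g \<omega>\<bar> \<le> C'"
  shows "has_bochner_integral M (\<lambda>\<omega>. f \<omega> * (B b \<omega> - B a \<omega>) * (g \<omega> * (B d \<omega> - B c \<omega>)))
     (max 0 (min b d - max a c) * (\<integral>\<omega>. f \<omega> * g \<omega> \<partial>M))"
proof -
  have fc: "f \<in> borel_measurable (F c)"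
    by (rule measurable_F_mono[OF ac f(1)])
  have b: "\<bar>f \<omega> * g \<omega>\<bar> \<le> C * C'" if "\<omega> \<in> space M" for \<omega>
    using f(2)[OF that] g(2)[OF that] by (auto simp: abs_mult intro!: mult_mono)
  have fg: "(\<lambda>\<omega>. f \<omega> * g \<omega>) \<in> borel_measurable (F t)" if "c \<le> t" for t
    by (rule measurable_F_mono[OF that]) (intro borel_measurable_times fc g)
  have fg_int: "integrable M (\<lambda>\<omega>. f \<omega> * g \<omega>)"
    using b by (rule integrable_bounded[OF fg[OF order_refl]])
  have B: "(\<lambda>\<omega>. f \<omega> * g \<omega> * (B y \<omega> - B x \<omega>)) \<in> borel_measurable (F t)"
    if "0 \<le> x" "x \<le> y" "y \<le> t" "c \<le> t" for x y t
    using that by (intro borel_measurable_times borel_measurable_diff fg measurable_B_F) auto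
  have B_int: "integrable M (\<lambda>\<omega>. f \<omega> * g \<omega> * (B y \<omega> - B x \<omega>))" if "0 \<le> x" "x \<le> y" for x y
  proof (rule Bochner_Integration.integrable_bound[where f="\<lambda>\<omega>. C * C' * (B y \<omega> - B x \<omega>)"])
    have "integrable M (\<lambda>\<omega>. 1 * (B y \<omega> - B x \<omega>))"
      by (intro has_bochner_integral_increment(1)[OF that, THEN integrable.intros]) auto
    then show "integrable M (\<lambda>\<omega>. C * C' * (B y \<omega> - B x \<omega>))"
      by simp
    show "(\<lambda>\<omega>. f \<omega> * g \<omega> * (B y \<omega> - B x \<omega>)) \<in> borel_measurable M"
      using measurable_F_M[OF B[of x y "max c y"]] that by simp
    show "AE \<omega> in M. norm (f \<omega> * g \<omega> * (B y \<omega> - B x \<omega>)) \<le> norm (C * C' * (B y \<omega> - B x \<omega>))"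
    proof (rule AE_I2)
      fix \<omega> assume "\<omega> \<in> space M"
      from b[OF this] have "\<bar>f \<omega> * g \<omega>\<bar> \<le> \<bar>C * C'\<bar>" by linarith
      then show "norm (f \<omega> * g \<omega> * (B y \<omega> - B x \<omega>)) \<le> norm (C * C' * (B y \<omega> - B x \<omega>))"
        unfolding real_norm_def abs_mult[of _ "B y \<omega> - B x \<omega>"] by (rule mult_right_mono) simp
    qed
  qed
  have zero: "has_bochner_integral M (\<lambda>\<omega>. f \<omega> * g \<omega> * (B y \<omega> - B x \<omega>) * (B z' \<omega> - B z \<omega>)) 0"
    if "0 \<le> x" "x \<le> y" "y \<le> z" "z \<le> z'" "c \<le> z" for x y z z'
    using that by (intro has_bochner_integral_increment(1) B B_int) auto
  show ?thesis
  proof (cases "b \<le> c")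
    case True
    then have "max 0 (min b d - max a c) = 0"
      using ac by simp
    then show ?thesis
      using zero[of a b c d] assms True by (simp add: mult_ac)
  next
    case False
    define e where "e = min b d"
    have e: "c \<le> e" "e \<le> b" "e \<le> d" "e = b \<or> e = d"
      using False cd by (auto simp: e_def)
    have c0: "0 \<le> c" using ab ac by simp
    \<comment> \<open>Both increments are cut at \<open>c\<close> and \<open>e\<close>. Of the six
      resulting products only the square can have a nonzero mean; the sixth, over [e, b] and [e, d],
      is absent because \<open>e\<close> is \<open>b\<close> or \<open>d\<close>.\<close>
    have "has_bochner_integral M (\<lambda>\<omega>.
        f \<omega> * g \<omega> * (B c \<omega> - B a \<omega>) * (B e \<omega> - B c \<omega>)
      + (f \<omega> * g \<omega> * (B c \<omega> - B a \<omega>) * (B d \<omega> - B e \<omega>)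
      + (f \<omega> * g \<omega> * (B e \<omega> - B c \<omega>)\<^sup>2
      + (f \<omega> * g \<omega> * (B e \<omega> - B c \<omega>) * (B d \<omega> - B e \<omega>)
      + f \<omega> * g \<omega> * (B e \<omega> - B c \<omega>) * (B b \<omega> - B e \<omega>)))))
      (0 + (0 + ((e - c) * (\<integral>\<omega>. f \<omega> * g \<omega> \<partial>M) + (0 + 0))))"
      (is "has_bochner_integral M ?s _")
      using ab ac e c0
      by (intro has_bochner_integral_add zero has_bochner_integral_increment(2) fg fg_int) auto
    also have "0 + (0 + ((e - c) * (\<integral>\<omega>. f \<omega> * g \<omega> \<partial>M) + (0 + 0)))
        = max 0 (min b d - max a c) * (\<integral>\<omega>. f \<omega> * g \<omega> \<partial>M)"
      using ac e by (simp add: e_def max_def min_def)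
    also have "?s
      = (\<lambda>\<omega>. f \<omega> * (B b \<omega> - B a \<omega>) * (g \<omega> * (B d \<omega> - B c \<omega>)))"
      using e(4) by (auto simp: fun_eq_iff power2_eq_square algebra_simps)
    finally show ?thesis .
  qed
qed

lemma covariance_increments:
  assumes ab: "0 \<le> a" "a \<le> b" and cd: "0 \<le> c" "c \<le> d"
    and f: "f \<in> borel_measurable (F a)" "\<And>\<omega>. \<omega> \<in> space M \<Longrightarrow> \<bar>f \<omega>\<bar> \<le> C"
    and g: "g \<in> borel_measurable (F c)" "\<And>\<omega>. \<omega> \<in> space M \<Longrightarrow> \<bar>g \<omega>\<bar> \<le> C'"
  shows "has_bochner_integral M (\<lambda>\<omega>. f \<omega> * (B b \<omega> - B a \<omega>) * (g \<omega> * (B d \<omega> - B c \<omega>)))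
     (max 0 (min b d - max a c) * (\<integral>\<omega>. f \<omega> * g \<omega> \<partial>M))"
proof (cases "a \<le> c")
  case True
  then show ?thesis using assms by (intro covariance_increments_aux) auto
next
  case False
  then show ?thesis
    using covariance_increments_aux[of c d a b g C' f C] assms
    by (simp add: mult.commute min.commute max.commute[of a])
qed

end

text \<open>The overlap length is the same coefficient as in \<open>covariance_increments\<close>;
  this coincidence is the content of the isometry.\<close>

lemma has_bochner_integral_indicator_interval:
  fixes a b c d :: real
  assumes "a \<le> b" "c \<le> d"
  shows "has_bochner_integral lborel (\<lambda>s. indicator {a..<b} s * indicator {c..<d} s)
     (max 0 (min b d - max a c))"
proof -
  have "(\<lambda>s. indicator {a..<b} s * indicator {c..<d} s) = (indicator {max a c..<min b d} :: real \<Rightarrow> real)"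
    by (auto simp: fun_eq_iff indicator_def)
  moreover have "measure lborel {max a c..<min b d} = max 0 (min b d - max a c)"
    by (cases "max a c \<le> min b d") auto
  moreover have "emeasure lborel {max a c..<min b d} < \<infinity>"
    by (cases "max a c \<le> min b d") auto
  ultimately show ?thesis
    using has_bochner_integral_real_indicator[of "{max a c..<min b d}" lborel] by simp
qed

context brownian_motion
begin

text \<open>The intervals may overlap in any way, so differences of elementary processes with
  unrelated partitions are covered without a common refinement. Both sides expand to one double sum
  over the overlap lengths \<open>m i j\<close>.\<close>

theorem ito_isometry_step_functions:
  fixes K :: "'i set" and a b :: "'i \<Rightarrow> real" and f :: "'i \<Rightarrow> 'w \<Rightarrow> real"
  assumes K: "finite K" "\<And>i. i \<in> K \<Longrightarrow> 0 \<le> a i" "\<And>i. i \<in> K \<Longrightarrow> a i \<le> b i"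
    and f: "\<And>i. i \<in> K \<Longrightarrow> f i \<in> borel_measurable (F (a i))"
      "\<And>i. i \<in> K \<Longrightarrow> \<exists>C. \<forall>\<omega>\<in>space M. \<bar>f i \<omega>\<bar> \<le> C"
  shows "(\<integral>\<^sup>+\<omega>. ennreal ((\<Sum>i\<in>K. f i \<omega> * (B (b i) \<omega> - B (a i) \<omega>))\<^sup>2) \<partial>M)
    = (\<integral>\<^sup>+\<omega>. (\<integral>\<^sup>+s. ennreal ((\<Sum>i\<in>K. f i \<omega> * indicator {a i..<b i} s)\<^sup>2) \<partial>lborel) \<partial>M)"
proof -
  define m where "m i j = max 0 (min (b i) (b j) - max (a i) (a j))" for i j
  obtain C where C: "\<And>i \<omega>. i \<in> K \<Longrightarrow> \<omega> \<in> space M \<Longrightarrow> \<bar>f i \<omega>\<bar> \<le> C i"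
    using f(2) by metis
  have fM: "f i \<in> borel_measurable M" if "i \<in> K" for i
    using f(1)[OF that] by (rule measurable_F_M)
  have ff_int: "integrable M (\<lambda>\<omega>. f i \<omega> * f j \<omega>)" if ij: "i \<in> K" "j \<in> K" for i j
    using C[OF ij(1)] C[OF ij(2)] fM ij
    by (intro integrable_const_bound[of _ "C i * C j"])
       (auto simp: abs_mult intro!: AE_I2 mult_mono order_trans[OF abs_ge_zero C[OF ij(1)]])
  have "has_bochner_integral M (\<lambda>\<omega>. \<Sum>i\<in>K. \<Sum>j\<in>K.
      f i \<omega> * (B (b i) \<omega> - B (a i) \<omega>) * (f j \<omega> * (B (b j) \<omega> - B (a j) \<omega>)))
      (\<Sum>i\<in>K. \<Sum>j\<in>K. m i j * (\<integral>\<omega>. f i \<omega> * f j \<omega> \<partial>M))"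
    unfolding m_def using K f(1) C by (intro has_bochner_integral_sum covariance_increments)
  then have lhs: "(\<integral>\<^sup>+\<omega>. ennreal ((\<Sum>i\<in>K. f i \<omega> * (B (b i) \<omega> - B (a i) \<omega>))\<^sup>2) \<partial>M)
      = ennreal (\<Sum>i\<in>K. \<Sum>j\<in>K. m i j * (\<integral>\<omega>. f i \<omega> * f j \<omega> \<partial>M))"
    unfolding power2_eq_square sum_product
    by (subst nn_integral_eq_integral)
       (auto simp: has_bochner_integral_iff simp flip: sum_product)
  have "(\<integral>\<^sup>+s. ennreal ((\<Sum>i\<in>K. f i \<omega> * indicator {a i..<b i} s)\<^sup>2) \<partial>lborel)
      = ennreal (\<Sum>i\<in>K. \<Sum>j\<in>K. f i \<omega> * f j \<omega> * m i j) \<and> 0 \<le> (\<Sum>i\<in>K. \<Sum>j\<in>K. f i \<omega> * f j \<omega> * m i j)" for \<omega>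
  proof -
    have "has_bochner_integral lborel (\<lambda>s. \<Sum>i\<in>K. \<Sum>j\<in>K.
        f i \<omega> * f j \<omega> * (indicator {a i..<b i} s * indicator {a j..<b j} s))
        (\<Sum>i\<in>K. \<Sum>j\<in>K. f i \<omega> * f j \<omega> * m i j)"
      unfolding m_def using K
      by (intro has_bochner_integral_sum has_bochner_integral_mult_right has_bochner_integral_indicator_interval)
    also have "(\<lambda>s. \<Sum>i\<in>K. \<Sum>j\<in>K. f i \<omega> * f j \<omega> * (indicator {a i..<b i} s * indicator {a j..<b j} s))
        = (\<lambda>s. (\<Sum>i\<in>K. f i \<omega> * indicator {a i..<b i} s)\<^sup>2)"
      by (auto simp: fun_eq_iff power2_eq_square sum_product mult_ac intro!: sum.cong)
    finally have *: "has_bochner_integral lborel (\<lambda>s. (\<Sum>i\<in>K. f i \<omega> * indicator {a i..<b i} s)\<^sup>2)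
        (\<Sum>i\<in>K. \<Sum>j\<in>K. f i \<omega> * f j \<omega> * m i j)" .
    then have "0 \<le> (\<Sum>i\<in>K. \<Sum>j\<in>K. f i \<omega> * f j \<omega> * m i j)"
      using integral_nonneg_AE[of "\<lambda>s. (\<Sum>i\<in>K. f i \<omega> * indicator {a i..<b i} s)\<^sup>2" lborel]
      by (simp add: has_bochner_integral_iff)
    with * show ?thesis
      by (subst nn_integral_eq_integral) (auto simp: has_bochner_integral_iff)
  qed
  then have "(\<integral>\<^sup>+\<omega>. (\<integral>\<^sup>+s. ennreal ((\<Sum>i\<in>K. f i \<omega> * indicator {a i..<b i} s)\<^sup>2) \<partial>lborel) \<partial>M)
      = (\<integral>\<^sup>+\<omega>. ennreal (\<Sum>i\<in>K. \<Sum>j\<in>K. f i \<omega> * f j \<omega> * m i j) \<partial>M)"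
    and nonneg: "\<And>\<omega>. 0 \<le> (\<Sum>i\<in>K. \<Sum>j\<in>K. f i \<omega> * f j \<omega> * m i j)"
    by (simp_all only:)
  note rhs = this(1)
  have "(\<integral>\<^sup>+\<omega>. ennreal (\<Sum>i\<in>K. \<Sum>j\<in>K. f i \<omega> * f j \<omega> * m i j) \<partial>M) = ennreal (\<integral>\<omega>. (\<Sum>i\<in>K. \<Sum>j\<in>K. f i \<omega> * f j \<omega> * m i j) \<partial>M)"
  proof (rule nn_integral_eq_integral)
    show "integrable M (\<lambda>\<omega>. \<Sum>i\<in>K. \<Sum>j\<in>K. f i \<omega> * f j \<omega> * m i j)"
      by (intro Bochner_Integration.integrable_sum Bochner_Integration.integrable_mult_left ff_int)
  qed (use nonneg in auto)
  moreover have "(\<integral>\<omega>. (\<Sum>i\<in>K. \<Sum>j\<in>K. f i \<omega> * f j \<omega> * m i j) \<partial>M)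
      = (\<Sum>i\<in>K. \<Sum>j\<in>K. m i j * (\<integral>\<omega>. f i \<omega> * f j \<omega> \<partial>M))"
    using ff_int
    by (subst Bochner_Integration.integral_sum)
       (auto intro!: sum.cong simp: Bochner_Integration.integral_sum mult.commute)
  ultimately show ?thesis
    using lhs rhs by simp
qed

end

section \<open>Exponential moments of bounded step integrals\<close>

context brownian_motion
begin

text \<open>A coefficient in [-C, C] is a mixture of the endpoints with weights known at time
  \<open>s\<close>. Convexity of exp takes the mixture outside, and the endpoints \<open>C\<close>
  and \<open>-C\<close> lead to the same Gaussian moment.\<close>

lemma nn_integral_exp_bounded_increment:
  assumes st: "0 \<le> s" "s \<le> t" and g: "g \<in> borel_measurable (F s)"
    and p: "\<psi> \<in> borel_measurable (F s)" "\<And>\<omega>. \<omega> \<in> space M \<Longrightarrow> \<bar>\<psi> \<omega>\<bar> \<le> C" and C: "0 < C"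
  shows "(\<integral>\<^sup>+\<omega>. g \<omega> * ennreal (exp (u * (\<psi> \<omega> * (B t \<omega> - B s \<omega>)))) \<partial>M)
    \<le> ennreal (exp (u\<^sup>2 * C\<^sup>2 * (t - s) / 2)) * (\<integral>\<^sup>+\<omega>. g \<omega> \<partial>M)"
proof -
  define q where "q \<omega> = (C + \<psi> \<omega>) / (2 * C)" for \<omega>
  define q' where "q' \<omega> = (C - \<psi> \<omega>) / (2 * C)" for \<omega>
  have q: "0 \<le> q \<omega>" "0 \<le> q' \<omega>" "q \<omega> + q' \<omega> = 1" "\<psi> \<omega> = q \<omega> * C + q' \<omega> * (- C)"
    if "\<omega> \<in> space M" for \<omega>
    using p(2)[OF that] C by (auto simp: q_def q'_def field_simps)
  have gq: "(\<lambda>\<omega>. g \<omega> * ennreal (q \<omega>)) \<in> borel_measurable (F s)"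
      "(\<lambda>\<omega>. g \<omega> * ennreal (q' \<omega>)) \<in> borel_measurable (F s)"
    unfolding q_def q'_def using g p(1) by measurable
  note [measurable] = gq[THEN measurable_F_M] measurable_F_M[OF g] measurable_F_M[OF p(1)]
  have [measurable]: "B s \<in> borel_measurable M" "B t \<in> borel_measurable M"
    using st by (auto intro: measurable_B)
  let ?D = "\<lambda>\<omega>. B t \<omega> - B s \<omega>"
  have "(\<integral>\<^sup>+\<omega>. g \<omega> * ennreal (exp (u * (\<psi> \<omega> * ?D \<omega>))) \<partial>M)
      \<le> (\<integral>\<^sup>+\<omega>. g \<omega> * ennreal (q \<omega>) * ennreal (exp ((u * C) * ?D \<omega>))
          + g \<omega> * ennreal (q' \<omega>) * ennreal (exp ((- u * C) * ?D \<omega>)) \<partial>M)"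
  proof (rule nn_integral_mono)
    fix \<omega> assume w: "\<omega> \<in> space M"
    have "u * (\<psi> \<omega> * ?D \<omega>) = q \<omega> * (u * C * ?D \<omega>) + q' \<omega> * (- u * C * ?D \<omega>)"
      by (subst q(4)[OF w]) (simp add: algebra_simps)
    then have "exp (u * (\<psi> \<omega> * ?D \<omega>)) \<le> q \<omega> * exp (u * C * ?D \<omega>) + q' \<omega> * exp (- u * C * ?D \<omega>)"
      using exp_convex q[OF w] unfolding convex_on_def by (metis UNIV_I real_scaleR_def)
    then have "ennreal (exp (u * (\<psi> \<omega> * ?D \<omega>)))
        \<le> ennreal (q \<omega>) * ennreal (exp (u * C * ?D \<omega>)) + ennreal (q' \<omega>) * ennreal (exp (- u * C * ?D \<omega>))"
      using q[OF w] by (simp flip: ennreal_mult ennreal_plus add: ennreal_leI)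
    then show "g \<omega> * ennreal (exp (u * (\<psi> \<omega> * ?D \<omega>)))
        \<le> g \<omega> * ennreal (q \<omega>) * ennreal (exp ((u * C) * ?D \<omega>))
          + g \<omega> * ennreal (q' \<omega>) * ennreal (exp ((- u * C) * ?D \<omega>))"
      using mult_left_mono[of _ _ "g \<omega>"] by (simp only: distrib_left[symmetric] mult.assoc) simp
  qed
  also have "\<dots> = (\<integral>\<^sup>+\<omega>. g \<omega> * ennreal (q \<omega>) * ennreal (exp ((u * C) * ?D \<omega>)) \<partial>M)
      + (\<integral>\<^sup>+\<omega>. g \<omega> * ennreal (q' \<omega>) * ennreal (exp ((- u * C) * ?D \<omega>)) \<partial>M)"
    by (intro nn_integral_add) measurable
  also have "\<dots> = ennreal (exp (u\<^sup>2 * C\<^sup>2 * (t - s) / 2))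
      * ((\<integral>\<^sup>+\<omega>. g \<omega> * ennreal (q \<omega>) \<partial>M) + (\<integral>\<^sup>+\<omega>. g \<omega> * ennreal (q' \<omega>) \<partial>M))"
    unfolding nn_integral_exp_increment[OF st gq(1)] nn_integral_exp_increment[OF st gq(2)]
    by (simp add: distrib_left power_mult_distrib)
  also have "(\<integral>\<^sup>+\<omega>. g \<omega> * ennreal (q \<omega>) \<partial>M) + (\<integral>\<^sup>+\<omega>. g \<omega> * ennreal (q' \<omega>) \<partial>M)
      = (\<integral>\<^sup>+\<omega>. g \<omega> * ennreal (q \<omega>) + g \<omega> * ennreal (q' \<omega>) \<partial>M)"
    by (intro nn_integral_add[symmetric]) measurable
  also have "\<dots> = (\<integral>\<^sup>+\<omega>. g \<omega> \<partial>M)"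
    using q by (intro nn_integral_cong) (simp flip: distrib_left ennreal_plus)
  finally show ?thesis .
qed

text \<open>The last increment is peeled off while all earlier factors join the weight. The extra
  \<open>f\<close> carries information from before the first node, which makes the bound conditional
  on \<open>F (\<rho> 0)\<close>.\<close>

lemma nn_integral_exp_step_integral:
  assumes "0 \<le> \<rho> 0" and "\<And>k. k < n \<Longrightarrow> \<rho> k \<le> \<rho> (Suc k)"
    and "\<And>k. k < n \<Longrightarrow> \<psi> k \<in> borel_measurable (F (\<rho> k))"
    and "\<And>k \<omega>. k < n \<Longrightarrow> \<omega> \<in> space M \<Longrightarrow> \<bar>\<psi> k \<omega>\<bar> \<le> C" and C: "0 < C"
    and f: "f \<in> borel_measurable (F (\<rho> 0))"
  shows "(\<integral>\<^sup>+\<omega>. f \<omega> * ennreal (exp (u * (\<Sum>k<n. \<psi> k \<omega> * (B (\<rho> (Suc k)) \<omega> - B (\<rho> k) \<omega>)))) \<partial>M)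
    \<le> ennreal (exp (u\<^sup>2 * C\<^sup>2 * (\<rho> n - \<rho> 0) / 2)) * (\<integral>\<^sup>+\<omega>. f \<omega> \<partial>M)"
proof -
  define g where "g m \<omega> = f \<omega> * ennreal (exp (u * (\<Sum>k<m. \<psi> k \<omega> * (B (\<rho> (Suc k)) \<omega> - B (\<rho> k) \<omega>))))" for m \<omega>
  have "m \<le> n \<Longrightarrow> \<rho> 0 \<le> \<rho> m \<and> g m \<in> borel_measurable (F (\<rho> m)) \<and>
      (\<integral>\<^sup>+\<omega>. g m \<omega> \<partial>M) \<le> ennreal (exp (u\<^sup>2 * C\<^sup>2 * (\<rho> m - \<rho> 0) / 2)) * (\<integral>\<^sup>+\<omega>. f \<omega> \<partial>M)" for m
  proof (induction m)
    case 0
    then show ?case using f by (simp add: g_def[abs_def])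
  next
    case (Suc m)
    then have m: "m < n" "\<rho> 0 \<le> \<rho> m" "g m \<in> borel_measurable (F (\<rho> m))"
      and IH: "(\<integral>\<^sup>+\<omega>. g m \<omega> \<partial>M) \<le> ennreal (exp (u\<^sup>2 * C\<^sup>2 * (\<rho> m - \<rho> 0) / 2)) * (\<integral>\<^sup>+\<omega>. f \<omega> \<partial>M)"
      by auto
    have rho: "0 \<le> \<rho> m" "\<rho> m \<le> \<rho> (Suc m)"
      using m assms by auto
    have g_Suc: "g (Suc m) = (\<lambda>\<omega>. g m \<omega> * ennreal (exp (u * (\<psi> m \<omega> * (B (\<rho> (Suc m)) \<omega> - B (\<rho> m) \<omega>)))))"
      by (simp add: g_def[abs_def] distrib_left exp_add ennreal_mult mult.assoc)
    have "g (Suc m) \<in> borel_measurable (F (\<rho> (Suc m)))"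
    proof -
      have [measurable]: "B (\<rho> m) \<in> borel_measurable (F (\<rho> (Suc m)))"
          "B (\<rho> (Suc m)) \<in> borel_measurable (F (\<rho> (Suc m)))"
        using rho by (auto intro: measurable_B_F)
      note [measurable] = measurable_F_mono[OF rho(2) m(3)]
        measurable_F_mono[OF rho(2) assms(3)[OF m(1)]]
      show ?thesis unfolding g_Suc by measurable
    qed
    moreover have "(\<integral>\<^sup>+\<omega>. g (Suc m) \<omega> \<partial>M)
        \<le> ennreal (exp (u\<^sup>2 * C\<^sup>2 * (\<rho> (Suc m) - \<rho> m) / 2)) * (\<integral>\<^sup>+\<omega>. g m \<omega> \<partial>M)"
      unfolding g_Suc using rho m assms by (intro nn_integral_exp_bounded_increment) auto
    moreover have "\<dots> \<le> ennreal (exp (u\<^sup>2 * C\<^sup>2 * (\<rho> (Suc m) - \<rho> m) / 2))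
        * (ennreal (exp (u\<^sup>2 * C\<^sup>2 * (\<rho> m - \<rho> 0) / 2)) * (\<integral>\<^sup>+\<omega>. f \<omega> \<partial>M))"
      by (intro mult_left_mono IH) auto
    moreover have "\<dots> = ennreal (exp (u\<^sup>2 * C\<^sup>2 * (\<rho> (Suc m) - \<rho> 0) / 2)) * (\<integral>\<^sup>+\<omega>. f \<omega> \<partial>M)"
      by (simp add: mult.assoc[symmetric] flip: ennreal_mult exp_add)
         (simp add: algebra_simps add_divide_distrib diff_divide_distrib)
    ultimately show ?case
      using m rho by auto
  qed
  then show ?thesis
    unfolding g_def by blast
qed

end

section \<open>L2 limits, elementary processes and joint measurability\<close>

lemma tendsto_L2_AE_subseq:
  fixes u :: "nat \<Rightarrow> 'a \<Rightarrow> real"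
  assumes [measurable]: "\<And>n. u n \<in> borel_measurable M" "v \<in> borel_measurable M"
    and lim: "(\<lambda>n. \<integral>\<^sup>+x. ennreal ((u n x - v x)\<^sup>2) \<partial>M) \<longlonglongrightarrow> 0"
  obtains r :: "nat \<Rightarrow> nat" where "AE x in M. (\<lambda>n. u (r n) x) \<longlonglongrightarrow> v x"
proof -
  \<comment> \<open>Convergence to 0 in \<open>ennreal\<close> permits infinite integrals at the
    start, so the sequence is shifted to where the squares are integrable before the L1 result is
    applied to them.\<close>
  have "eventually (\<lambda>n. (\<integral>\<^sup>+x. ennreal ((u n x - v x)\<^sup>2) \<partial>M) < \<infinity>) sequentially"
    by (rule order_tendstoD(2)[OF lim]) simp
  then obtain N where N: "\<And>n. N \<le> n \<Longrightarrow> (\<integral>\<^sup>+x. ennreal ((u n x - v x)\<^sup>2) \<partial>M) < \<infinity>"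
    by (auto simp: eventually_sequentially)
  define w where "w n x = (u (n + N) x - v x)\<^sup>2" for n x
  have int: "integrable M (w n)" for n
    unfolding w_def using N[of "n + N"] by (intro integrableI_nonneg) auto
  have "ennreal (\<integral>x. norm (w n x) \<partial>M) = (\<integral>\<^sup>+x. ennreal ((u (n + N) x - v x)\<^sup>2) \<partial>M)" for n
    using int[of n] unfolding w_def by (subst nn_integral_eq_integral[symmetric]) auto
  then have "(\<lambda>n. ennreal (\<integral>x. norm (w n x) \<partial>M)) \<longlonglongrightarrow> ennreal 0"
    using LIMSEQ_ignore_initial_segment[OF lim, of N] by simp
  then have "(\<lambda>n. \<integral>x. norm (w n x) \<partial>M) \<longlonglongrightarrow> 0"
    by (subst (asm) tendsto_ennreal_iff) auto
  from tendsto_L1_AE_subseq[OF int this]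
  obtain r :: "nat \<Rightarrow> nat" where r: "AE x in M. (\<lambda>n. w (r n) x) \<longlonglongrightarrow> 0"
    by blast
  have "AE x in M. (\<lambda>n. u (r n + N) x) \<longlonglongrightarrow> v x"
    using r
  proof eventually_elim
    fix x assume "(\<lambda>n. w (r n) x) \<longlonglongrightarrow> 0"
    then have "(\<lambda>n. sqrt (w (r n) x)) \<longlonglongrightarrow> sqrt 0"
      by (rule tendsto_real_sqrt)
    then have "(\<lambda>n. \<bar>u (r n + N) x - v x\<bar>) \<longlonglongrightarrow> 0"
      by (simp add: w_def)
    then have "(\<lambda>n. u (r n + N) x - v x) \<longlonglongrightarrow> 0"
      by (simp add: tendsto_rabs_zero_iff)
    then show "(\<lambda>n. u (r n + N) x) \<longlonglongrightarrow> v x"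
      by (simp add: LIM_zero_iff)
  qed
  then show ?thesis by (rule that)
qed

lemma partition_mono:
  fixes \<tau> :: "nat \<Rightarrow> real"
  assumes "\<And>k. k < n \<Longrightarrow> \<tau> k \<le> \<tau> (Suc k)" and "i \<le> j" "j \<le> n"
  shows "\<tau> i \<le> \<tau> j"
  using assms(2,3) by (induction j rule: dec_induct) (auto intro: order_trans[OF _ assms(1)])

text \<open>The half-open cells of a partition are disjoint, so at most one summand is active. This
  lets a nonlinear operation such as clipping commute with the sum.\<close>

lemma partition_cases:
  fixes \<tau> :: "nat \<Rightarrow> real"
  assumes "\<And>k. k < n \<Longrightarrow> \<tau> k \<le> \<tau> (Suc k)"
  obtains "\<And>k. k < n \<Longrightarrow> x \<notin> {\<tau> k..<\<tau> (Suc k)}"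
        "\<And>\<phi> :: nat \<Rightarrow> real. (\<Sum>k<n. \<phi> k * indicator {\<tau> k..<\<tau> (Suc k)} x) = 0"
  | k where "k < n" "x \<in> {\<tau> k..<\<tau> (Suc k)}"
        "\<And>\<phi> :: nat \<Rightarrow> real. (\<Sum>k<n. \<phi> k * indicator {\<tau> k..<\<tau> (Suc k)} x) = \<phi> k"
proof (cases "\<exists>k<n. x \<in> {\<tau> k..<\<tau> (Suc k)}")
  case True
  then obtain k where k: "k < n" "x \<in> {\<tau> k..<\<tau> (Suc k)}" by blast
  have "x \<notin> {\<tau> l..<\<tau> (Suc l)}" if "l < n" "l \<noteq> k" for l
    using partition_mono[of n \<tau> "Suc l" k] partition_mono[of n \<tau> "Suc k" l] assms k that
    by (cases "l < k") auto
  then have "(\<Sum>l<n. \<phi> l * indicator {\<tau> l..<\<tau> (Suc l)} x) = (\<Sum>l<n. if l = k then \<phi> k else 0)"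
    for \<phi> :: "nat \<Rightarrow> real"
    using k by (intro sum.cong) (auto simp: indicator_def)
  then show ?thesis
    using k by (intro that(2)[of k]) auto
qed (auto intro: that(1))

lemma elementary_process_zero:
  assumes "\<And>k. k < n \<Longrightarrow> \<tau> k \<le> \<tau> (Suc k)" "x < \<tau> 0 \<or> \<tau> n \<le> x"
  shows "elementary_process n \<tau> \<phi> x \<omega> = 0"
proof -
  have "x \<notin> {\<tau> k..<\<tau> (Suc k)}" if "k < n" for k
    using partition_mono[of n \<tau> 0 k] partition_mono[of n \<tau> "Suc k" n] assms that by auto
  then show ?thesis
    by (auto simp: elementary_process_def)
qed

lemma elementary_process_restrict_clip:
  assumes mono: "\<And>k. k < n \<Longrightarrow> \<tau> k \<le> \<tau> (Suc k)" and "s \<le> x" and C: "0 \<le> C"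
  shows "elementary_process n (\<lambda>k. max s (\<tau> k)) (\<lambda>k \<omega>. max (-C) (min C (\<phi> k \<omega>))) x \<omega>
    = max (-C) (min C (elementary_process n \<tau> \<phi> x \<omega>))"
proof -
  \<comment> \<open>Raising all nodes to at least \<open>s\<close> leaves the cells unchanged to the
    right of \<open>s\<close>, while cells before \<open>s\<close> become empty.\<close>
  have "x \<in> {max s a..<max s b} \<longleftrightarrow> x \<in> {a..<b}" for a b :: real
    using \<open>s \<le> x\<close> by auto
  then have "elementary_process n (\<lambda>k. max s (\<tau> k)) \<psi> x \<omega> = elementary_process n \<tau> \<psi> x \<omega>" for \<psi>
    unfolding elementary_process_def by (intro sum.cong) (auto simp: indicator_def)
  \<comment> \<open>Outside all cells the process is 0, which clipping fixes because
    \<open>C\<close> is nonnegative.\<close>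
  moreover from mono have "elementary_process n \<tau> (\<lambda>k \<omega>. max (-C) (min C (\<phi> k \<omega>))) x \<omega>
      = max (-C) (min C (elementary_process n \<tau> \<phi> x \<omega>))"
    unfolding elementary_process_def
    by (rule partition_cases[of n \<tau> x]) (use C in auto)
  ultimately show ?thesis by simp
qed

lemma floor_grid_tendsto:
  fixes s :: real
  shows "(\<lambda>n. real_of_int \<lfloor>s * real (Suc n)\<rfloor> / real (Suc n)) \<longlonglongrightarrow> s"
proof (rule real_tendsto_sandwich)
  show "eventually (\<lambda>n. s - 1 / real (Suc n) \<le> real_of_int \<lfloor>s * real (Suc n)\<rfloor> / real (Suc n)) sequentially"
  proof (rule always_eventually, rule allI)
    fix n
    have "s * real (Suc n) - 1 \<le> real_of_int \<lfloor>s * real (Suc n)\<rfloor>" by linarith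
    then have "(s * real (Suc n) - 1) / real (Suc n) \<le> real_of_int \<lfloor>s * real (Suc n)\<rfloor> / real (Suc n)"
      by (rule divide_right_mono) simp
    then show "s - 1 / real (Suc n) \<le> real_of_int \<lfloor>s * real (Suc n)\<rfloor> / real (Suc n)"
      by (simp add: diff_divide_distrib)
  qed
  show "eventually (\<lambda>n. real_of_int \<lfloor>s * real (Suc n)\<rfloor> / real (Suc n) \<le> s) sequentially"
  proof (rule always_eventually, rule allI)
    fix n
    show "real_of_int \<lfloor>s * real (Suc n)\<rfloor> / real (Suc n) \<le> s"
      by (subst pos_divide_le_eq) (auto simp del: of_nat_Suc)
  qed
  show "(\<lambda>n. s - 1 / real (Suc n)) \<longlonglongrightarrow> s"
    using tendsto_diff[OF tendsto_const lim_const_over_n[of 1, THEN LIMSEQ_Suc], of s] by simp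
qed simp

text \<open>Sampling at the grid point below \<open>s\<close> uses only countably many times and is
  therefore jointly measurable; continuity of the paths makes the samples converge. The
  \<open>max 0\<close> extends the process to negative times, about which nothing is
  assumed.\<close>

lemma borel_measurable_continuous_process:
  fixes H :: "real \<Rightarrow> 'w \<Rightarrow> real"
  assumes meas: "\<And>t. 0 \<le> t \<Longrightarrow> H t \<in> borel_measurable M"
    and cont: "\<And>\<omega>. \<omega> \<in> space M \<Longrightarrow> continuous_on {0..} (\<lambda>t. H t \<omega>)"
  shows "(\<lambda>(\<omega>, s). H (max 0 s) \<omega>) \<in> borel_measurable (M \<Otimes>\<^sub>M borel)"
proof (rule borel_measurable_LIMSEQ_real)
  define r where "r n s = max 0 (real_of_int \<lfloor>s * real (Suc n)\<rfloor> / real (Suc n))" for n s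
  have r_lim: "(\<lambda>n. r n s) \<longlonglongrightarrow> max 0 s" for s
    unfolding r_def by (intro tendsto_max tendsto_const floor_grid_tendsto)
  show "(\<lambda>n. case p of (\<omega>, s) \<Rightarrow> H (r n s) \<omega>) \<longlonglongrightarrow> (case p of (\<omega>, s) \<Rightarrow> H (max 0 s) \<omega>)"
    if "p \<in> space (M \<Otimes>\<^sub>M borel)" for p
  proof -
    obtain \<omega> s where p: "p = (\<omega>, s)" "\<omega> \<in> space M"
      using \<open>p \<in> space (M \<Otimes>\<^sub>M borel)\<close> by (auto simp: space_pair_measure)
    show ?thesis
      using continuous_on_tendsto_compose[OF cont[OF p(2)] r_lim[of s]] p by (simp add: r_def)
  qed
  show "(\<lambda>p. case p of (\<omega>, s) \<Rightarrow> H (r n s) \<omega>) \<in> borel_measurable (M \<Otimes>\<^sub>M borel)" for n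
  proof -
    have "(\<lambda>p. H (max 0 (real_of_int i / real (Suc n))) (fst p)) \<in> borel_measurable (M \<Otimes>\<^sub>M borel)" for i
      by (rule measurable_compose[OF measurable_fst meas]) simp
    moreover have "(\<lambda>p. \<lfloor>snd p * real (Suc n)\<rfloor>) \<in> measurable (M \<Otimes>\<^sub>M borel) (count_space UNIV)"
      by measurable
    ultimately have "(\<lambda>p. H (max 0 (real_of_int \<lfloor>snd p * real (Suc n)\<rfloor> / real (Suc n))) (fst p))
        \<in> borel_measurable (M \<Otimes>\<^sub>M borel)"
      by (rule measurable_compose_countable)
    then show ?thesis
      by (simp add: r_def case_prod_beta')
  qed
qed

section \<open>Exponential bounds for Ito increments\<close>

context brownian_motion
begin

text \<open>The integral is only known to be measurable for \<open>M\<close>, and the filtration is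
  not assumed complete, so \<open>I t\<close> itself may fail to be adapted. The limit of a
  subsequence of elementary integrals is adapted and agrees with \<open>I t\<close> up to a null set
  that depends on \<open>t\<close>; later it is used at countably many times only.\<close>

lemma ito_integral_adapted_version:
  assumes "has_ito_integral M F B H I"
  obtains J where "\<And>t. 0 \<le> t \<Longrightarrow> J t \<in> borel_measurable (F t)" "\<And>t. 0 \<le> t \<Longrightarrow> AE \<omega> in M. J t \<omega> = I t \<omega>"
proof -
  have "\<exists>J. J \<in> borel_measurable (F t) \<and> (AE \<omega> in M. J \<omega> = I t \<omega>)" if t: "0 \<le> t" for t
  proof -
    obtain n \<tau> \<phi> where el: "\<And>j. elementary_data F t (n j) (\<tau> j) (\<phi> j)"
      and lim: "(\<lambda>j. \<integral>\<^sup>+\<omega>. ennreal ((elementary_integral B (n j) (\<tau> j) (\<phi> j) \<omega> - I t \<omega>)\<^sup>2) \<partial>M) \<longlonglongrightarrow> 0"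
      and I: "I t \<in> borel_measurable M"
      using assms t unfolding has_ito_integral_def by blast
    have E: "elementary_integral B (n j) (\<tau> j) (\<phi> j) \<in> borel_measurable (F t)" for j
      unfolding elementary_integral_def[abs_def]
    proof (intro borel_measurable_sum borel_measurable_times borel_measurable_diff)
      fix k assume "k \<in> {..<n j}"
      then have k: "k < n j" by simp
      have mono: "\<And>k. k < n j \<Longrightarrow> \<tau> j k \<le> \<tau> j (Suc k)"
        and bnd: "0 \<le> \<tau> j 0" "\<tau> j (n j) \<le> t" and phi: "\<phi> j k \<in> borel_measurable (F (\<tau> j k))"
        using el[of j] k by (auto simp: elementary_data_def)
      have "\<tau> j 0 \<le> \<tau> j k" "\<tau> j k \<le> \<tau> j (Suc k)" "\<tau> j (Suc k) \<le> \<tau> j (n j)"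
        using k by (auto intro!: partition_mono[of "n j" "\<tau> j"] mono)
      then have "0 \<le> \<tau> j k" "\<tau> j k \<le> t" "0 \<le> \<tau> j (Suc k)" "\<tau> j (Suc k) \<le> t"
        using bnd by auto
      then show "\<phi> j k \<in> borel_measurable (F t)" "B (\<tau> j (Suc k)) \<in> borel_measurable (F t)"
          "B (\<tau> j k) \<in> borel_measurable (F t)"
        using phi by (auto intro: measurable_F_mono measurable_B_F)
    qed
    obtain r where r: "AE \<omega> in M. (\<lambda>j. elementary_integral B (n (r j)) (\<tau> (r j)) (\<phi> (r j)) \<omega>) \<longlonglongrightarrow> I t \<omega>"
      by (rule tendsto_L2_AE_subseq[OF measurable_F_M[OF E] I lim])
    show ?thesis
    proof (intro exI conjI)
      show "(\<lambda>\<omega>. lim (\<lambda>j. elementary_integral B (n (r j)) (\<tau> (r j)) (\<phi> (r j)) \<omega>)) \<in> borel_measurable (F t)"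
        by (intro borel_measurable_lim_metric E)
      show "AE \<omega> in M. lim (\<lambda>j. elementary_integral B (n (r j)) (\<tau> (r j)) (\<phi> (r j)) \<omega>) = I t \<omega>"
        using r by eventually_elim (rule limI)
    qed
  qed
  then show ?thesis
    using that by metis
qed

lemma elementary_data_mono:
  assumes "elementary_data F T n \<tau> \<phi>"
  shows "0 \<le> \<tau> 0" "\<tau> n \<le> T" "\<And>k. k < n \<Longrightarrow> \<tau> k \<le> \<tau> (Suc k)" "\<And>k. k \<le> n \<Longrightarrow> 0 \<le> \<tau> k"
    "\<And>k. k \<le> n \<Longrightarrow> \<tau> k \<le> T"
proof -
  show *: "0 \<le> \<tau> 0" "\<tau> n \<le> T" "\<And>k. k < n \<Longrightarrow> \<tau> k \<le> \<tau> (Suc k)"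
    using assms by (auto simp: elementary_data_def)
  then show "\<And>k. k \<le> n \<Longrightarrow> 0 \<le> \<tau> k" "\<And>k. k \<le> n \<Longrightarrow> \<tau> k \<le> T"
    using partition_mono[of n \<tau> 0] partition_mono[of n \<tau> _ n] by (force intro: order_trans)+
qed

text \<open>The three elementary integrals become one family of steps, indexed by pairs with tags 0,
  1, 2, the last two with negated coefficients; the isometry for overlapping intervals then applies
  once.\<close>

lemma elementary_increment_isometry:
  fixes C :: real
  assumes el: "elementary_data F t n \<tau> \<phi>" and el': "elementary_data F s n' \<tau>' \<phi>'" and st: "0 \<le> s" "s \<le> t"
  defines "\<rho> \<equiv> \<lambda>k. max s (\<tau> k)" and "\<psi> \<equiv> \<lambda>k \<omega>. max (-C) (min C (\<phi> k \<omega>))"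
  shows "(\<integral>\<^sup>+\<omega>. ennreal ((elementary_integral B n \<tau> \<phi> \<omega> - elementary_integral B n' \<tau>' \<phi>' \<omega>
            - elementary_integral B n \<rho> \<psi> \<omega>)\<^sup>2) \<partial>M)
    = (\<integral>\<^sup>+\<omega>. (\<integral>\<^sup>+x. ennreal ((elementary_process n \<tau> \<phi> x \<omega> - elementary_process n' \<tau>' \<phi>' x \<omega>
            - elementary_process n \<rho> \<psi> x \<omega>)\<^sup>2) \<partial>lborel) \<partial>M)"
proof -
  define K where "K = (SIGMA i:{..<3::nat}. {..<if i = 1 then n' else n})"
  define a where "a = (\<lambda>(i::nat, k). if i = 0 then \<tau> k else if i = 1 then \<tau>' k else \<rho> k)"
  define b where "b = (\<lambda>(i::nat, k). if i = 0 then \<tau> (Suc k) else if i = 1 then \<tau>' (Suc k) else \<rho> (Suc k))"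
  define f where "f = (\<lambda>(i::nat, k) \<omega>. if i = 0 then \<phi> k \<omega> else if i = 1 then - \<phi>' k \<omega> else - \<psi> k \<omega>)"
  \<comment> \<open>\<open>G\<close> is left open: increments of \<open>B\<close> give the
    integrals, indicators give the processes.\<close>
  have sum_K: "(\<Sum>p\<in>K. f p \<omega> * G (a p) (b p)) = (\<Sum>k<n. \<phi> k \<omega> * G (\<tau> k) (\<tau> (Suc k)))
      - (\<Sum>k<n'. \<phi>' k \<omega> * G (\<tau>' k) (\<tau>' (Suc k))) - (\<Sum>k<n. \<psi> k \<omega> * G (\<rho> k) (\<rho> (Suc k)))"
    for G :: "real \<Rightarrow> real \<Rightarrow> real" and \<omega>
  proof -
    have "(\<Sum>p\<in>K. f p \<omega> * G (a p) (b p))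
        = (\<Sum>i<3. \<Sum>k<(if i = 1 then n' else n). f (i, k) \<omega> * G (a (i, k)) (b (i, k)))"
      unfolding K_def by (subst sum.Sigma) (auto intro!: sum.cong)
    also have "\<dots> = (\<Sum>k<n. \<phi> k \<omega> * G (\<tau> k) (\<tau> (Suc k)))
      - (\<Sum>k<n'. \<phi>' k \<omega> * G (\<tau>' k) (\<tau>' (Suc k))) - (\<Sum>k<n. \<psi> k \<omega> * G (\<rho> k) (\<rho> (Suc k)))"
      by (simp add: a_def b_def f_def eval_nat_numeral lessThan_Suc sum_negf)
    finally show ?thesis .
  qed
  note m = elementary_data_mono[OF el] elementary_data_mono[OF el']
  have \<psi>: "\<psi> k \<in> borel_measurable (F (\<rho> k))" if "k < n" for k
  proof -
    have "\<phi> k \<in> borel_measurable (F (\<tau> k))"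
      using el that by (simp add: elementary_data_def)
    from measurable_F_mono[OF _ this, of "\<rho> k"] have [measurable]: "\<phi> k \<in> borel_measurable (F (\<rho> k))"
      by (simp add: \<rho>_def)
    show ?thesis unfolding \<psi>_def by measurable
  qed
  have "(\<integral>\<^sup>+\<omega>. ennreal ((\<Sum>p\<in>K. f p \<omega> * (B (b p) \<omega> - B (a p) \<omega>))\<^sup>2) \<partial>M)
    = (\<integral>\<^sup>+\<omega>. (\<integral>\<^sup>+x. ennreal ((\<Sum>p\<in>K. f p \<omega> * indicator {a p..<b p} x)\<^sup>2) \<partial>lborel) \<partial>M)"
  proof (rule ito_isometry_step_functions)
    show "finite K" by (simp add: K_def)
    fix p assume "p \<in> K"
    then obtain i k where p: "p = (i, k)" "i < 3" "k < (if i = 1 then n' else n)"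
      by (auto simp: K_def)
    have "\<rho> k \<le> \<rho> (Suc k)" if "k < n"
      unfolding \<rho>_def by (rule max.mono[OF order_refl m(3)[OF that]])
    moreover have "0 \<le> \<rho> k"
      using st by (simp add: \<rho>_def le_max_iff_disj)
    ultimately show "0 \<le> a p" "a p \<le> b p"
      using p m by (auto simp: a_def b_def split: if_splits)
    have "\<phi> k \<in> borel_measurable (F (\<tau> k))" if "i = 0" using p el that by (auto simp: elementary_data_def)
    moreover have "\<phi>' k \<in> borel_measurable (F (\<tau>' k))" if "i = 1" using p el' that by (auto simp: elementary_data_def)
    moreover have "\<psi> k \<in> borel_measurable (F (\<rho> k))" if "i \<noteq> 1" using p \<psi> that by auto
    ultimately show "f p \<in> borel_measurable (F (a p))"
      unfolding f_def a_def p(1) by (cases "i = 0"; cases "i = 1") auto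
    have "\<exists>c. \<forall>\<omega>\<in>space M. \<bar>\<phi> k \<omega>\<bar> \<le> c" if "i = 0" using p el that by (auto simp: elementary_data_def)
    moreover have "\<exists>c. \<forall>\<omega>\<in>space M. \<bar>\<phi>' k \<omega>\<bar> \<le> c" if "i = 1" using p el' that by (auto simp: elementary_data_def)
    moreover have "\<exists>c. \<forall>\<omega>\<in>space M. \<bar>\<psi> k \<omega>\<bar> \<le> c"
      unfolding \<psi>_def by (intro exI[of _ "\<bar>C\<bar>"]) auto
    ultimately show "\<exists>c. \<forall>\<omega>\<in>space M. \<bar>f p \<omega>\<bar> \<le> c"
      unfolding f_def p(1) by (cases "i = 0"; cases "i = 1") auto
  qed
  then show ?thesis
    unfolding sum_K[of _ "\<lambda>a b. B b _ - B a _"] sum_K[of _ "\<lambda>a b. indicator {a..<b} _"]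
    by (simp only: elementary_integral_def elementary_process_def)
qed

end

locale ito_integral = brownian_motion +
  fixes H :: "real \<Rightarrow> 'a \<Rightarrow> real" and I :: "real \<Rightarrow> 'a \<Rightarrow> real" and C :: real
  assumes C_pos: "0 < C"
    and H_bounded: "\<And>t \<omega>. 0 \<le> t \<Longrightarrow> \<omega> \<in> space M \<Longrightarrow> \<bar>H t \<omega>\<bar> \<le> C"
    and H_measurable: "\<And>t. 0 \<le> t \<Longrightarrow> H t \<in> borel_measurable M"
    and H_continuous: "\<And>\<omega>. \<omega> \<in> space M \<Longrightarrow> continuous_on {0..} (\<lambda>t. H t \<omega>)"
    and ito: "has_ito_integral M F B H I"
begin

lemma measurable_I: "0 \<le> t \<Longrightarrow> I t \<in> borel_measurable M"
  using ito by (auto simp: has_ito_integral_def)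

abbreviation "squared_error T n \<tau> \<phi> \<omega> \<equiv>
  \<integral>\<^sup>+x\<in>{0..T}. ennreal ((elementary_process n \<tau> \<phi> x \<omega> - H x \<omega>)\<^sup>2) \<partial>lborel"

text \<open>Needed to separate the errors of two approximations under the integral over
  \<open>M\<close>. On [0, T] the extension by \<open>max 0\<close> changes nothing.\<close>

lemma borel_measurable_elementary_error:
  assumes el: "elementary_data F T n \<tau> \<phi>"
  shows "squared_error T n \<tau> \<phi> \<in> borel_measurable M"
proof -
  have 1: "(\<lambda>(\<omega>, x). H (max 0 x) \<omega>) \<in> borel_measurable (M \<Otimes>\<^sub>M lborel)"
    using borel_measurable_continuous_process[OF H_measurable H_continuous]
    by (simp cong: measurable_cong_sets sets_pair_measure_cong)
  have "(\<lambda>(\<omega>, x). elementary_process n \<tau> \<phi> x \<omega>) \<in> borel_measurable (M \<Otimes>\<^sub>M lborel)"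
  proof -
    have phi: "(\<lambda>p. \<phi> k (fst p)) \<in> borel_measurable (M \<Otimes>\<^sub>M lborel)" if "k < n" for k
      using el that by (intro measurable_compose[OF measurable_fst] measurable_F_M[of _ "\<tau> k"])
        (auto simp: elementary_data_def)
    show ?thesis
      unfolding elementary_process_def case_prod_beta'
      by (intro borel_measurable_sum borel_measurable_times phi) (auto, measurable)
  qed
  with 1 have "(\<lambda>(\<omega>, x). ennreal ((elementary_process n \<tau> \<phi> x \<omega> - H (max 0 x) \<omega>)\<^sup>2) * indicator {0..T} x)
      \<in> borel_measurable (M \<Otimes>\<^sub>M lborel)"
    by measurable
  then have "(\<lambda>\<omega>. \<integral>\<^sup>+x. ennreal ((elementary_process n \<tau> \<phi> x \<omega> - H (max 0 x) \<omega>)\<^sup>2) * indicator {0..T} x \<partial>lborel)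
      \<in> borel_measurable M"
    by (rule lborel.borel_measurable_nn_integral)
  also have "(\<lambda>\<omega>. \<integral>\<^sup>+x. ennreal ((elementary_process n \<tau> \<phi> x \<omega> - H (max 0 x) \<omega>)\<^sup>2) * indicator {0..T} x \<partial>lborel)
      = squared_error T n \<tau> \<phi>"
    by (intro ext nn_integral_cong) (auto simp: indicator_def)
  finally show ?thesis .
qed

text \<open>By the isometry it suffices to compare integrands. Before \<open>s\<close> both
  elementary processes approximate \<open>H\<close>, and the clipped one vanishes. After
  \<open>s\<close> the second process vanishes, and clipping moves the first by no more than its
  distance to \<open>H\<close>, because \<open>H\<close> has values in [-C, C].\<close>

lemma clipped_elementary_integral_error:
  assumes el: "elementary_data F t n \<tau> \<phi>" and el': "elementary_data F s n' \<tau>' \<phi>'" and st: "0 \<le> s" "s \<le> t"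
  defines "\<rho> \<equiv> \<lambda>k. max s (\<tau> k)" and "\<psi> \<equiv> \<lambda>k \<omega>. max (-C) (min C (\<phi> k \<omega>))"
  shows "(\<integral>\<^sup>+\<omega>. ennreal ((elementary_integral B n \<tau> \<phi> \<omega> - elementary_integral B n' \<tau>' \<phi>' \<omega>
            - elementary_integral B n \<rho> \<psi> \<omega>)\<^sup>2) \<partial>M)
    \<le> 2 * (\<integral>\<^sup>+\<omega>. squared_error t n \<tau> \<phi> \<omega> \<partial>M)
      + 2 * (\<integral>\<^sup>+\<omega>. squared_error s n' \<tau>' \<phi>' \<omega> \<partial>M)"
proof -
  note m = elementary_data_mono[OF el] and m' = elementary_data_mono[OF el']
  let ?E = "elementary_process n \<tau> \<phi>" and ?E' = "elementary_process n' \<tau>' \<phi>'" and ?P = "elementary_process n \<rho> \<psi>"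
  have meas_H: "(\<lambda>x. H x \<omega>) \<in> borel_measurable (restrict_space lborel {0..T})" if "\<omega> \<in> space M" for \<omega> T
  proof -
    have "continuous_on {0..T} (\<lambda>x. H x \<omega>)"
      by (rule continuous_on_subset[OF H_continuous[OF that]]) auto
    from borel_measurable_continuous_on_restrict[OF this] show ?thesis
      by (simp cong: measurable_cong_sets add: sets_restrict_space)
  qed
  have meas_E: "(\<lambda>x. elementary_process n \<tau> \<phi> x \<omega>) \<in> borel_measurable borel" for n \<tau> \<phi> \<omega>
    unfolding elementary_process_def by measurable
  have meas_sq: "(\<lambda>x. ennreal ((elementary_process n \<tau> \<phi> x \<omega> - H x \<omega>)\<^sup>2) * indicator {0..T} x) \<in> borel_measurable lborel"
    if "\<omega> \<in> space M" for n \<tau> \<phi> \<omega> T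
  proof -
    have "(\<lambda>x. ennreal ((elementary_process n \<tau> \<phi> x \<omega> - H x \<omega>)\<^sup>2)) \<in> borel_measurable (restrict_space lborel {0..T})"
      using meas_H[OF that, of T] meas_E[of n \<tau> \<phi> \<omega>, THEN measurable_restrict_space1, of "{0..T}"]
      by (auto cong: measurable_cong_sets)
    then show ?thesis
      by (subst (asm) borel_measurable_restrict_space_iff_ennreal) (auto simp: mult.commute)
  qed
  have pt: "(?E x \<omega> - ?E' x \<omega> - ?P x \<omega>)\<^sup>2
      \<le> 2 * ((?E x \<omega> - H x \<omega>)\<^sup>2 * indicator {0..t} x) + 2 * ((?E' x \<omega> - H x \<omega>)\<^sup>2 * indicator {0..s} x)"
    if w: "\<omega> \<in> space M" for x \<omega>
  proof -
    have rho: "\<And>k. k < n \<Longrightarrow> \<rho> k \<le> \<rho> (Suc k)" "s \<le> \<rho> 0" "\<rho> n \<le> t"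
      unfolding \<rho>_def by (rule max.mono[OF order_refl m(3)]) (use m(1,2) st in auto)
    have sq: "(p - q)\<^sup>2 \<le> 2 * (p - r)\<^sup>2 + 2 * (q - r)\<^sup>2" for p q r :: real
    proof -
      have "0 \<le> ((p - r) + (q - r))\<^sup>2" by simp
      then show ?thesis by (simp add: power2_eq_square algebra_simps)
    qed
    have E_zero: "?E x \<omega> = 0" if "x < 0 \<or> t \<le> x"
      using that m(1,2) by (intro elementary_process_zero m(3)) linarith+
    have E'_zero: "?E' x \<omega> = 0" if "x < 0 \<or> s \<le> x"
      using that m'(1,2) by (intro elementary_process_zero m'(3)) linarith+
    have P_zero: "?P x \<omega> = 0" if "x < s \<or> t \<le> x"
      using that rho(2,3) by (intro elementary_process_zero rho(1)) linarith+
    consider "x < 0" | "t \<le> x" | "0 \<le> x" "x < s" | "0 \<le> x" "s \<le> x" "x < t" by linarith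
    then show ?thesis
    proof cases
      case 1
      then have "?E x \<omega> = 0" "?E' x \<omega> = 0" "?P x \<omega> = 0"
        using E_zero E'_zero P_zero st by linarith+
      then show ?thesis by simp
    next
      case 2
      then have "?E x \<omega> = 0" "?E' x \<omega> = 0" "?P x \<omega> = 0"
        using E_zero E'_zero P_zero st by linarith+
      then show ?thesis by simp
    next
      case 3
      then have "?P x \<omega> = 0"
        using P_zero by simp
      then show ?thesis
        using sq[of "?E x \<omega>" "?E' x \<omega>" "H x \<omega>"] 3 st by simp
    next
      case 4
      then have E': "?E' x \<omega> = 0"
        using E'_zero by simp
      have P: "?P x \<omega> = max (-C) (min C (?E x \<omega>))"
        unfolding \<rho>_def \<psi>_def using m(3) 4(2) C_pos by (intro elementary_process_restrict_clip) auto
      \<comment> \<open>The clipped value is the point of [-C, C] nearest to the unclipped one, and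
        \<open>H x \<omega>\<close> is another point of that interval.\<close>
      have "\<bar>?E x \<omega> - ?P x \<omega>\<bar> \<le> \<bar>?E x \<omega> - H x \<omega>\<bar>"
        using H_bounded[OF 4(1) w] unfolding P by (auto simp: max_def min_def)
      then have "(?E x \<omega> - ?P x \<omega>)\<^sup>2 \<le> (?E x \<omega> - H x \<omega>)\<^sup>2"
        by (simp add: abs_le_square_iff)
      moreover have "(0::real) \<le> 2 * ((?E' x \<omega> - H x \<omega>)\<^sup>2 * indicator {0..s} x)"
        by simp
      moreover have "0 \<le> (?E x \<omega> - H x \<omega>)\<^sup>2" by simp
      ultimately have "(?E x \<omega> - ?P x \<omega>)\<^sup>2
          \<le> 2 * (?E x \<omega> - H x \<omega>)\<^sup>2 + 2 * ((?E' x \<omega> - H x \<omega>)\<^sup>2 * indicator {0..s} x)"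
        by linarith
      then show ?thesis
        using 4 E' by simp
    qed
  qed
  have "(\<integral>\<^sup>+\<omega>. ennreal ((elementary_integral B n \<tau> \<phi> \<omega> - elementary_integral B n' \<tau>' \<phi>' \<omega>
            - elementary_integral B n \<rho> \<psi> \<omega>)\<^sup>2) \<partial>M)
      = (\<integral>\<^sup>+\<omega>. (\<integral>\<^sup>+x. ennreal ((?E x \<omega> - ?E' x \<omega> - ?P x \<omega>)\<^sup>2) \<partial>lborel) \<partial>M)"
    unfolding \<rho>_def \<psi>_def by (rule elementary_increment_isometry[OF el el' st])
  also have "\<dots> \<le> (\<integral>\<^sup>+\<omega>. 2 * squared_error t n \<tau> \<phi> \<omega>
      + 2 * squared_error s n' \<tau>' \<phi>' \<omega> \<partial>M)"
  proof (rule nn_integral_mono)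
    fix \<omega> assume w: "\<omega> \<in> space M"
    have "(\<integral>\<^sup>+x. ennreal ((?E x \<omega> - ?E' x \<omega> - ?P x \<omega>)\<^sup>2) \<partial>lborel)
        \<le> (\<integral>\<^sup>+x. 2 * (ennreal ((?E x \<omega> - H x \<omega>)\<^sup>2) * indicator {0..t} x)
            + 2 * (ennreal ((?E' x \<omega> - H x \<omega>)\<^sup>2) * indicator {0..s} x) \<partial>lborel)"
    proof (rule nn_integral_mono)
      fix x
      have "ennreal ((?E x \<omega> - ?E' x \<omega> - ?P x \<omega>)\<^sup>2)
          \<le> ennreal (2 * ((?E x \<omega> - H x \<omega>)\<^sup>2 * indicator {0..t} x) + 2 * ((?E' x \<omega> - H x \<omega>)\<^sup>2 * indicator {0..s} x))"
        by (rule ennreal_leI[OF pt[OF w]])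
      also have "\<dots> = 2 * (ennreal ((?E x \<omega> - H x \<omega>)\<^sup>2) * indicator {0..t} x)
            + 2 * (ennreal ((?E' x \<omega> - H x \<omega>)\<^sup>2) * indicator {0..s} x)"
        by (auto simp: indicator_def ennreal_mult)
      finally show "ennreal ((?E x \<omega> - ?E' x \<omega> - ?P x \<omega>)\<^sup>2) \<le> \<dots>" .
    qed
    also have "\<dots> = 2 * squared_error t n \<tau> \<phi> \<omega>
      + 2 * squared_error s n' \<tau>' \<phi>' \<omega>"
      using meas_sq[OF w] by (subst nn_integral_add) (auto simp: nn_integral_cmult)
    finally show "(\<integral>\<^sup>+x. ennreal ((?E x \<omega> - ?E' x \<omega> - ?P x \<omega>)\<^sup>2) \<partial>lborel) \<le> \<dots>" .
  qed
  also have "\<dots> = 2 * (\<integral>\<^sup>+\<omega>. squared_error t n \<tau> \<phi> \<omega> \<partial>M)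
      + 2 * (\<integral>\<^sup>+\<omega>. squared_error s n' \<tau>' \<phi>' \<omega> \<partial>M)"
    using borel_measurable_elementary_error[OF el] borel_measurable_elementary_error[OF el']
    by (subst nn_integral_add) (auto simp: nn_integral_cmult)
  finally show ?thesis .
qed

text \<open>The approximants \<open>J\<close> are integrals of step processes that start at or after
  \<open>s\<close> and are bounded by \<open>C\<close>, so each of them obeys the bound for step
  integrals. They converge to the increment in L2, and Fatou along an almost surely convergent
  subsequence passes the bound to the limit.\<close>

theorem nn_integral_exp_ito_increment:
  assumes st: "0 \<le> s" "s \<le> t" and f: "f \<in> borel_measurable (F s)"
  shows "(\<integral>\<^sup>+\<omega>. f \<omega> * ennreal (exp (u * (I t \<omega> - I s \<omega>))) \<partial>M)
    \<le> ennreal (exp (u\<^sup>2 * C\<^sup>2 * (t - s) / 2)) * (\<integral>\<^sup>+\<omega>. f \<omega> \<partial>M)"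
proof -
  have t: "0 \<le> t" using st by simp
  obtain n \<tau> \<phi> where el: "\<And>j. elementary_data F t (n j) (\<tau> j) (\<phi> j)"
    and lim: "(\<lambda>j. \<integral>\<^sup>+\<omega>. squared_error t (n j) (\<tau> j) (\<phi> j) \<omega> \<partial>M) \<longlonglongrightarrow> 0"
      "(\<lambda>j. \<integral>\<^sup>+\<omega>. ennreal ((elementary_integral B (n j) (\<tau> j) (\<phi> j) \<omega> - I t \<omega>)\<^sup>2) \<partial>M) \<longlonglongrightarrow> 0"
    using ito t unfolding has_ito_integral_def by blast
  obtain n' \<tau>' \<phi>' where el': "\<And>j. elementary_data F s (n' j) (\<tau>' j) (\<phi>' j)"
    and lim': "(\<lambda>j. \<integral>\<^sup>+\<omega>. squared_error s (n' j) (\<tau>' j) (\<phi>' j) \<omega> \<partial>M) \<longlonglongrightarrow> 0"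
      "(\<lambda>j. \<integral>\<^sup>+\<omega>. ennreal ((elementary_integral B (n' j) (\<tau>' j) (\<phi>' j) \<omega> - I s \<omega>)\<^sup>2) \<partial>M) \<longlonglongrightarrow> 0"
    using ito st(1) unfolding has_ito_integral_def by blast
  define \<rho> where "\<rho> j k = max s (\<tau> j k)" for j k
  define \<psi> where "\<psi> j k \<omega> = max (-C) (min C (\<phi> j k \<omega>))" for j k \<omega>
  define E where "E j = elementary_integral B (n j) (\<tau> j) (\<phi> j)" for j
  define E' where "E' j = elementary_integral B (n' j) (\<tau>' j) (\<phi>' j)" for j
  define J where "J j = elementary_integral B (n j) (\<rho> j) (\<psi> j)" for j
  have meas_el: "elementary_integral B n \<tau> \<phi> \<in> borel_measurable M"
    if "\<And>k. k \<le> n \<Longrightarrow> 0 \<le> \<tau> k" "\<And>k. k < n \<Longrightarrow> \<phi> k \<in> borel_measurable M" for n \<tau> \<phi>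
    unfolding elementary_integral_def[abs_def]
    using that by (intro borel_measurable_sum borel_measurable_times borel_measurable_diff measurable_B) auto
  have [measurable]: "I t \<in> borel_measurable M" "I s \<in> borel_measurable M"
    using st by (auto intro: measurable_I)
  have \<phi>: "\<phi> j k \<in> borel_measurable (F (\<tau> j k))" if "k < n j" for j k
    using el[of j] that by (auto simp: elementary_data_def)
  have \<phi>': "\<phi>' j k \<in> borel_measurable (F (\<tau>' j k))" if "k < n' j" for j k
    using el'[of j] that by (auto simp: elementary_data_def)
  have \<rho>: "s \<le> \<rho> j k" "0 \<le> \<rho> j k" for j k
    using st by (auto simp: \<rho>_def)
  have \<psi>: "\<psi> j k \<in> borel_measurable (F (\<rho> j k))" if "k < n j" for j k
  proof -
    have [measurable]: "\<phi> j k \<in> borel_measurable (F (\<rho> j k))"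
      by (rule measurable_F_mono[OF _ \<phi>[OF that]]) (simp add: \<rho>_def)
    show ?thesis unfolding \<psi>_def by measurable
  qed
  have [measurable]: "E j \<in> borel_measurable M" "E' j \<in> borel_measurable M" "J j \<in> borel_measurable M" for j
    unfolding E_def E'_def J_def
    using elementary_data_mono[OF el[of j]] elementary_data_mono[OF el'[of j]] \<rho>
    by (auto intro!: meas_el measurable_F_M[OF \<phi>] measurable_F_M[OF \<phi>'] measurable_F_M[OF \<psi>])
  \<comment> \<open>\<open>J\<close> misses the increment of \<open>I\<close> by three errors: the
    approximation at \<open>t\<close>, the one at \<open>s\<close>, and the clipping with
    restriction. Squaring a sum of three costs the factor 3.\<close>
  have sq3: "ennreal ((p - q)\<^sup>2) \<le> 3 * (ennreal (x\<^sup>2) + ennreal (y\<^sup>2) + ennreal (z\<^sup>2))"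
    if "p - q = x - y - z" for p q x y z :: real
  proof -
    have "0 \<le> (x + y)\<^sup>2 + (x + z)\<^sup>2 + (y - z)\<^sup>2" by simp
    then have "(x - y - z)\<^sup>2 \<le> 3 * (x\<^sup>2 + y\<^sup>2 + z\<^sup>2)"
      by (simp add: power2_eq_square algebra_simps)
    then have "ennreal ((p - q)\<^sup>2) \<le> ennreal (3 * (x\<^sup>2 + y\<^sup>2 + z\<^sup>2))"
      unfolding that by (rule ennreal_leI)
    then show ?thesis
      by (simp add: ennreal_mult)
  qed
  let ?e = "\<lambda>j. \<integral>\<^sup>+\<omega>. ennreal ((E j \<omega> - I t \<omega>)\<^sup>2) \<partial>M"
  let ?e' = "\<lambda>j. \<integral>\<^sup>+\<omega>. ennreal ((E' j \<omega> - I s \<omega>)\<^sup>2) \<partial>M"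
  let ?d = "\<lambda>j. \<integral>\<^sup>+\<omega>. ennreal ((E j \<omega> - E' j \<omega> - J j \<omega>)\<^sup>2) \<partial>M"
  have bound: "(\<integral>\<^sup>+\<omega>. ennreal ((J j \<omega> - (I t \<omega> - I s \<omega>))\<^sup>2) \<partial>M) \<le> 3 * (?e j + ?e' j + ?d j)" for j
  proof -
    have "(\<integral>\<^sup>+\<omega>. ennreal ((J j \<omega> - (I t \<omega> - I s \<omega>))\<^sup>2) \<partial>M)
        \<le> (\<integral>\<^sup>+\<omega>. 3 * (ennreal ((E j \<omega> - I t \<omega>)\<^sup>2) + ennreal ((E' j \<omega> - I s \<omega>)\<^sup>2)
              + ennreal ((E j \<omega> - E' j \<omega> - J j \<omega>)\<^sup>2)) \<partial>M)"
      by (intro nn_integral_mono sq3) simp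
    also have "\<dots> = 3 * (?e j + ?e' j + ?d j)"
      by (simp add: nn_integral_cmult nn_integral_add)
    finally show ?thesis .
  qed
  have "?d \<longlonglongrightarrow> 0"
  proof (rule tendsto_sandwich[OF _ _ tendsto_const])
    show "eventually (\<lambda>j. 0 \<le> ?d j) sequentially" by simp
    show "eventually (\<lambda>j. ?d j \<le>
        2 * (\<integral>\<^sup>+\<omega>. squared_error t (n j) (\<tau> j) (\<phi> j) \<omega> \<partial>M)
      + 2 * (\<integral>\<^sup>+\<omega>. squared_error s (n' j) (\<tau>' j) (\<phi>' j) \<omega> \<partial>M)) sequentially"
      unfolding E_def E'_def J_def \<rho>_def \<psi>_def
      by (intro always_eventually allI clipped_elementary_integral_error el el' st)
    show "(\<lambda>j. 2 * (\<integral>\<^sup>+\<omega>. squared_error t (n j) (\<tau> j) (\<phi> j) \<omega> \<partial>M)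
      + 2 * (\<integral>\<^sup>+\<omega>. squared_error s (n' j) (\<tau>' j) (\<phi>' j) \<omega> \<partial>M)) \<longlonglongrightarrow> 0"
      using tendsto_add[OF ennreal_tendsto_cmult[OF _ lim(1), of 2] ennreal_tendsto_cmult[OF _ lim'(1), of 2]]
      by simp
  qed
  then have "(\<lambda>j. 3 * (?e j + ?e' j + ?d j)) \<longlonglongrightarrow> 3 * (0 + 0 + 0)"
    using lim(2) lim'(2) unfolding E_def E'_def
    by (intro ennreal_tendsto_cmult tendsto_add) auto
  then have "(\<lambda>j. \<integral>\<^sup>+\<omega>. ennreal ((J j \<omega> - (I t \<omega> - I s \<omega>))\<^sup>2) \<partial>M) \<longlonglongrightarrow> 0"
    by (intro tendsto_sandwich[OF _ always_eventually[OF allI, OF bound] tendsto_const]) auto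
  then obtain r where r: "AE \<omega> in M. (\<lambda>j. J (r j) \<omega>) \<longlonglongrightarrow> I t \<omega> - I s \<omega>"
    by (rule tendsto_L2_AE_subseq[rotated 2]) measurable
  have fM [measurable]: "f \<in> borel_measurable M"
    using f by (rule measurable_F_M)
  have J_bound: "(\<integral>\<^sup>+\<omega>. f \<omega> * ennreal (exp (u * J j \<omega>)) \<partial>M)
      \<le> ennreal (exp (u\<^sup>2 * C\<^sup>2 * (t - s) / 2)) * (\<integral>\<^sup>+\<omega>. f \<omega> \<partial>M)" for j
  proof -
    note m = elementary_data_mono[OF el[of j]]
    have psi_bound: "\<bar>\<psi> j k \<omega>\<bar> \<le> C" for k \<omega>
      using C_pos by (auto simp: \<psi>_def)
    have rho_mono: "\<rho> j k \<le> \<rho> j (Suc k)" if "k < n j" for k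
      using m(3)[OF that] by (auto simp: \<rho>_def)
    have "(\<integral>\<^sup>+\<omega>. f \<omega> * ennreal (exp (u * J j \<omega>)) \<partial>M)
        \<le> ennreal (exp (u\<^sup>2 * C\<^sup>2 * (\<rho> j (n j) - \<rho> j 0) / 2)) * (\<integral>\<^sup>+\<omega>. f \<omega> \<partial>M)"
      unfolding J_def elementary_integral_def
      using \<rho> \<psi> C_pos rho_mono measurable_F_mono[OF _ f, of "\<rho> j 0"] psi_bound
      by (intro nn_integral_exp_step_integral) auto
    also have "\<dots> \<le> ennreal (exp (u\<^sup>2 * C\<^sup>2 * (t - s) / 2)) * (\<integral>\<^sup>+\<omega>. f \<omega> \<partial>M)"
    proof (intro mult_right_mono ennreal_leI)
      have "\<rho> j (n j) - \<rho> j 0 \<le> t - s"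
        using m(2) st by (auto simp: \<rho>_def)
      then show "exp (u\<^sup>2 * C\<^sup>2 * (\<rho> j (n j) - \<rho> j 0) / 2) \<le> exp (u\<^sup>2 * C\<^sup>2 * (t - s) / 2)"
        by (simp add: mult_left_mono)
    qed simp
    finally show ?thesis .
  qed
  have "(\<integral>\<^sup>+\<omega>. f \<omega> * ennreal (exp (u * (I t \<omega> - I s \<omega>))) \<partial>M)
      = (\<integral>\<^sup>+\<omega>. liminf (\<lambda>j. f \<omega> * ennreal (exp (u * J (r j) \<omega>))) \<partial>M)"
  proof (rule nn_integral_cong_AE)
    show "AE \<omega> in M. f \<omega> * ennreal (exp (u * (I t \<omega> - I s \<omega>))) = liminf (\<lambda>j. f \<omega> * ennreal (exp (u * J (r j) \<omega>)))"
      using r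
    proof eventually_elim
      fix \<omega> assume "(\<lambda>j. J (r j) \<omega>) \<longlonglongrightarrow> I t \<omega> - I s \<omega>"
      then have "(\<lambda>j. ennreal (exp (u * J (r j) \<omega>))) \<longlonglongrightarrow> ennreal (exp (u * (I t \<omega> - I s \<omega>)))"
        by (intro tendsto_ennrealI tendsto_exp tendsto_mult tendsto_const)
      then have "(\<lambda>j. f \<omega> * ennreal (exp (u * J (r j) \<omega>))) \<longlonglongrightarrow> f \<omega> * ennreal (exp (u * (I t \<omega> - I s \<omega>)))"
        by (intro tendsto_mult_ennreal tendsto_const) auto
      then show "f \<omega> * ennreal (exp (u * (I t \<omega> - I s \<omega>))) = liminf (\<lambda>j. f \<omega> * ennreal (exp (u * J (r j) \<omega>)))"
        by (simp add: lim_imp_Liminf)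
    qed
  qed
  also have "\<dots> \<le> liminf (\<lambda>j. \<integral>\<^sup>+\<omega>. f \<omega> * ennreal (exp (u * J (r j) \<omega>)) \<partial>M)"
    by (intro nn_integral_liminf) measurable
  also have "\<dots> \<le> ennreal (exp (u\<^sup>2 * C\<^sup>2 * (t - s) / 2)) * (\<integral>\<^sup>+\<omega>. f \<omega> \<partial>M)"
    using J_bound by (intro Liminf_le always_eventually allI) auto
  finally show ?thesis .
qed

end

section \<open>Maximal inequalities\<close>

text \<open>\<open>A k\<close> contains the outcomes that stay below the level up to index
  \<open>k\<close>. Stopping at the first crossing is encoded in the induction: \<open>a\<close>
  times the probability of having crossed, plus the mass of \<open>N k\<close> on
  \<open>A k\<close>, never exceeds the initial mean. Testing on sets of \<open>G k\<close> replaces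
  conditional expectations.\<close>

lemma (in prob_space) nonneg_supermartingale_maximal_inequality:
  fixes N :: "nat \<Rightarrow> 'a \<Rightarrow> ennreal" and G :: "nat \<Rightarrow> 'a measure"
  assumes space_G: "\<And>k. space (G k) = space M" and G_M: "\<And>k. sets (G k) \<subseteq> events"
    and G_mono: "\<And>k. sets (G k) \<subseteq> sets (G (Suc k))"
    and N: "\<And>k. N k \<in> borel_measurable (G k)"
    and super: "\<And>k A. k < n \<Longrightarrow> A \<in> sets (G k) \<Longrightarrow>
      (\<integral>\<^sup>+\<omega>. N (Suc k) \<omega> * indicator A \<omega> \<partial>M) \<le> (\<integral>\<^sup>+\<omega>. N k \<omega> * indicator A \<omega> \<partial>M)"
  shows "a * emeasure M {\<omega>\<in>space M. \<exists>k\<le>n. a \<le> N k \<omega>} \<le> (\<integral>\<^sup>+\<omega>. N 0 \<omega> \<partial>M)"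
proof -
  define A where "A k = {\<omega>\<in>space M. \<forall>j\<le>k. N j \<omega> < a}" for k
  have NM [measurable]: "N k \<in> borel_measurable M" for k
    by (rule measurable_from_subalg[OF _ N]) (simp add: subalgebra_def space_G G_M)
  have G_le: "sets (G j) \<subseteq> sets (G k)" if "j \<le> k" for j k
    using that G_mono by (rule lift_Suc_mono_le[rotated])
  have A_G: "A k \<in> sets (G k)" for k
  proof -
    have NG: "N j \<in> borel_measurable (G k)" if "j \<in> {..k}" for j
    proof (rule measurable_from_subalg[OF _ N])
      show "subalgebra (G k) (G j)"
        using that G_le[of j k] by (simp add: subalgebra_def space_G)
    qed
    have "{\<omega>\<in>space (G k). \<forall>j\<in>{..k}. N j \<omega> < a} \<in> sets (G k)"
    proof (rule sets.sets_Collect_finite_All')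
      fix j assume "j \<in> {..k}"
      from NG[OF this] show "{\<omega>\<in>space (G k). N j \<omega> < a} \<in> sets (G k)"
        by measurable
    qed simp_all
    then show ?thesis
      unfolding A_def space_G Ball_def atMost_iff .
  qed
  have A_M [measurable]: "A k \<in> events" for k
    using A_G G_M by blast
  have A_Suc: "A (Suc k) \<subseteq> A k" for k
    by (auto simp: A_def)
  have "k \<le> n \<Longrightarrow> a * emeasure M (space M - A k) + (\<integral>\<^sup>+\<omega>. N k \<omega> * indicator (A k) \<omega> \<partial>M) \<le> (\<integral>\<^sup>+\<omega>. N 0 \<omega> \<partial>M)" for k
  proof (induction k)
    case 0
    have "a * emeasure M (space M - A 0) = (\<integral>\<^sup>+\<omega>. a * indicator (space M - A 0) \<omega> \<partial>M)"
      by (rule nn_integral_cmult_indicator[symmetric]) measurable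
    also have "\<dots> + (\<integral>\<^sup>+\<omega>. N 0 \<omega> * indicator (A 0) \<omega> \<partial>M)
        = (\<integral>\<^sup>+\<omega>. a * indicator (space M - A 0) \<omega> + N 0 \<omega> * indicator (A 0) \<omega> \<partial>M)"
      by (rule nn_integral_add[symmetric]) measurable
    also have "\<dots> \<le> (\<integral>\<^sup>+\<omega>. N 0 \<omega> \<partial>M)"
      by (intro nn_integral_mono) (auto simp: A_def indicator_def not_less)
    finally show ?case .
  next
    case (Suc k)
    have split: "space M - A (Suc k) = (space M - A k) \<union> (A k - A (Suc k))"
      using A_Suc[of k] sets.sets_into_space[OF A_M[of k]] by auto
    have "emeasure M (space M - A (Suc k)) = emeasure M (space M - A k) + emeasure M (A k - A (Suc k))"
      unfolding split by (rule plus_emeasure[symmetric]) auto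
    then have "a * emeasure M (space M - A (Suc k)) + (\<integral>\<^sup>+\<omega>. N (Suc k) \<omega> * indicator (A (Suc k)) \<omega> \<partial>M)
        = a * emeasure M (space M - A k) + (a * emeasure M (A k - A (Suc k))
            + (\<integral>\<^sup>+\<omega>. N (Suc k) \<omega> * indicator (A (Suc k)) \<omega> \<partial>M))"
      by (simp add: distrib_left add.assoc)
    also have "a * emeasure M (A k - A (Suc k)) = (\<integral>\<^sup>+\<omega>. a * indicator (A k - A (Suc k)) \<omega> \<partial>M)"
      by (rule nn_integral_cmult_indicator[symmetric]) measurable
    also have "\<dots> + (\<integral>\<^sup>+\<omega>. N (Suc k) \<omega> * indicator (A (Suc k)) \<omega> \<partial>M)
        = (\<integral>\<^sup>+\<omega>. a * indicator (A k - A (Suc k)) \<omega> + N (Suc k) \<omega> * indicator (A (Suc k)) \<omega> \<partial>M)"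
      by (rule nn_integral_add[symmetric]) measurable
    also have "\<dots> \<le> (\<integral>\<^sup>+\<omega>. N (Suc k) \<omega> * indicator (A k) \<omega> \<partial>M)"
      by (intro nn_integral_mono) (auto simp: A_def indicator_def not_less le_Suc_eq)
    also have "\<dots> \<le> (\<integral>\<^sup>+\<omega>. N k \<omega> * indicator (A k) \<omega> \<partial>M)"
      using Suc.prems by (intro super A_G) auto
    finally show ?case
      using Suc by (meson Suc_leD add_left_mono order_trans)
  qed
  from this[OF order_refl] have "a * emeasure M (space M - A n) \<le> (\<integral>\<^sup>+\<omega>. N 0 \<omega> \<partial>M)"
    by (rule order_trans[rotated]) simp
  moreover have "space M - A n = {\<omega>\<in>space M. \<exists>k\<le>n. a \<le> N k \<omega>}"
    by (auto simp: A_def not_less)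
  ultimately show ?thesis by simp
qed

text \<open>For nonnegative y, adding exp y >= 1 + y + y^2/2 and exp (-y) >= 1 - y cancels the
  linear terms. This turns exponential moments into second moments.\<close>

lemma square_le_exp_plus_exp_minus:
  fixes x :: real
  shows "x\<^sup>2 \<le> 2 * (exp x + exp (- x))"
proof -
  have *: "y\<^sup>2 \<le> 2 * (exp y + exp (- y))" if "0 \<le> y" for y :: real
    using exp_lower_Taylor_quadratic[OF that] exp_ge_add_one_self[of "- y"] by argo
  show ?thesis
    using *[of x] *[of "- x"] by (cases "0 \<le> x") (auto simp: add.commute)
qed

context ito_integral
begin

text \<open>\<open>U\<close> is frozen at time \<open>s\<close>, so convexity of exp between 0 and
  the full increment suffices: the share 1 - U meets the exponential of 0, which the factor on the
  right, being at least 1, absorbs. The weighted sums thus need not be recognised as Ito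
  integrals.\<close>

lemma nn_integral_exp_weighted_ito_increment:
  assumes st: "0 \<le> s" "s \<le> t" and f: "f \<in> borel_measurable (F s)"
    and U: "U \<in> borel_measurable (F s)" "\<And>\<omega>. \<omega> \<in> space M \<Longrightarrow> 0 \<le> U \<omega> \<and> U \<omega> \<le> (1::real)"
  shows "(\<integral>\<^sup>+\<omega>. f \<omega> * ennreal (exp (u * (U \<omega> * (I t \<omega> - I s \<omega>)))) \<partial>M)
    \<le> ennreal (exp (u\<^sup>2 * C\<^sup>2 * (t - s) / 2)) * (\<integral>\<^sup>+\<omega>. f \<omega> \<partial>M)"
proof -
  define E where "E = ennreal (exp (u\<^sup>2 * C\<^sup>2 * (t - s) / 2))"
  have E: "1 \<le> E"
    unfolding E_def using st by (auto simp flip: ennreal_1 intro!: ennreal_leI)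
  have fU: "(\<lambda>\<omega>. f \<omega> * ennreal (U \<omega>)) \<in> borel_measurable (F s)"
    using f U(1) by measurable
  note [measurable] = measurable_F_M[OF f] measurable_F_M[OF U(1)]
  have [measurable]: "I t \<in> borel_measurable M" "I s \<in> borel_measurable M"
    using st by (auto intro: measurable_I)
  let ?D = "\<lambda>\<omega>. I t \<omega> - I s \<omega>"
  have "(\<integral>\<^sup>+\<omega>. f \<omega> * ennreal (exp (u * (U \<omega> * ?D \<omega>))) \<partial>M)
      \<le> (\<integral>\<^sup>+\<omega>. f \<omega> * ennreal (U \<omega>) * ennreal (exp (u * ?D \<omega>)) + f \<omega> * ennreal (1 - U \<omega>) \<partial>M)"
  proof (rule nn_integral_mono)
    fix \<omega> assume w: "\<omega> \<in> space M"
    have "exp (U \<omega> * (u * ?D \<omega>) + (1 - U \<omega>) * 0) \<le> U \<omega> * exp (u * ?D \<omega>) + (1 - U \<omega>) * exp 0"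
      using convex_onD[OF exp_convex, of "U \<omega>" 0 "u * ?D \<omega>"] U(2)[OF w] by (simp add: add.commute)
    then have "ennreal (exp (u * (U \<omega> * ?D \<omega>))) \<le> ennreal (U \<omega> * exp (u * ?D \<omega>) + (1 - U \<omega>))"
      by (intro ennreal_leI) (simp add: mult.left_commute)
    also have "\<dots> = ennreal (U \<omega>) * ennreal (exp (u * ?D \<omega>)) + ennreal (1 - U \<omega>)"
      using U(2)[OF w] by (simp add: ennreal_mult)
    finally show "f \<omega> * ennreal (exp (u * (U \<omega> * ?D \<omega>)))
        \<le> f \<omega> * ennreal (U \<omega>) * ennreal (exp (u * ?D \<omega>)) + f \<omega> * ennreal (1 - U \<omega>)"
      using mult_left_mono[of _ _ "f \<omega>"] by (simp only: distrib_left[symmetric] mult.assoc) simp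
  qed
  also have "\<dots> = (\<integral>\<^sup>+\<omega>. f \<omega> * ennreal (U \<omega>) * ennreal (exp (u * ?D \<omega>)) \<partial>M) + (\<integral>\<^sup>+\<omega>. f \<omega> * ennreal (1 - U \<omega>) \<partial>M)"
    by (intro nn_integral_add) measurable
  also have "\<dots> \<le> E * (\<integral>\<^sup>+\<omega>. f \<omega> * ennreal (U \<omega>) \<partial>M) + E * (\<integral>\<^sup>+\<omega>. f \<omega> * ennreal (1 - U \<omega>) \<partial>M)"
    unfolding E_def
    by (intro add_mono nn_integral_exp_ito_increment[OF st fU])
       (use mult_right_mono[OF E, of "\<integral>\<^sup>+\<omega>. f \<omega> * ennreal (1 - U \<omega>) \<partial>M"] in \<open>simp add: E_def\<close>)
  also have "\<dots> = E * (\<integral>\<^sup>+\<omega>. f \<omega> * ennreal (U \<omega>) + f \<omega> * ennreal (1 - U \<omega>) \<partial>M)"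
    by (subst nn_integral_add) (measurable, simp add: distrib_left)
  also have "(\<integral>\<^sup>+\<omega>. f \<omega> * ennreal (U \<omega>) + f \<omega> * ennreal (1 - U \<omega>) \<partial>M) = (\<integral>\<^sup>+\<omega>. f \<omega> \<partial>M)"
    using U(2) by (intro nn_integral_cong) (simp flip: distrib_left ennreal_plus)
  finally show ?thesis
    unfolding E_def .
qed

text \<open>The constant 8 collects 2 from \<open>square_le_exp_plus_exp_minus\<close>, 2 for the
  two signs of the exponent and exp (1/2) <= 2.\<close>

lemma nn_integral_square_ito_increment:
  assumes st: "0 \<le> s" "s \<le> t" and f: "f \<in> borel_measurable (F s)"
  shows "(\<integral>\<^sup>+\<omega>. f \<omega> * ennreal ((I t \<omega> - I s \<omega>)\<^sup>2) \<partial>M) \<le> ennreal (8 * C\<^sup>2 * (t - s)) * (\<integral>\<^sup>+\<omega>. f \<omega> \<partial>M)"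
proof (cases "s = t")
  case False
  \<comment> \<open>The scale at which the variance proxy of \<open>u\<close> times the increment is
    1.\<close>
  define u where "u = 1 / (C * sqrt (t - s))"
  have u: "u\<^sup>2 * C\<^sup>2 * (t - s) = 1" "u\<^sup>2 * (C\<^sup>2 * (t - s)) = 1"
    using False st C_pos by (auto simp: u_def power_divide power_mult_distrib)
  note [measurable] = measurable_F_M[OF f]
  have [measurable]: "I t \<in> borel_measurable M" "I s \<in> borel_measurable M"
    using st by (auto intro: measurable_I)
  let ?D = "\<lambda>\<omega>. I t \<omega> - I s \<omega>"
  have c: "0 \<le> 2 * C\<^sup>2 * (t - s)" using st by simp
  have "(\<integral>\<^sup>+\<omega>. f \<omega> * ennreal ((?D \<omega>)\<^sup>2) \<partial>M)
      \<le> (\<integral>\<^sup>+\<omega>. ennreal (2 * C\<^sup>2 * (t - s)) * (f \<omega> * ennreal (exp (u * ?D \<omega>)) + f \<omega> * ennreal (exp (- u * ?D \<omega>))) \<partial>M)"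
  proof (rule nn_integral_mono)
    fix \<omega>
    have "(?D \<omega>)\<^sup>2 = C\<^sup>2 * (t - s) * (u * ?D \<omega>)\<^sup>2"
      using u(2) by (simp add: power_mult_distrib mult.commute mult.left_commute)
    also have "\<dots> \<le> C\<^sup>2 * (t - s) * (2 * (exp (u * ?D \<omega>) + exp (- (u * ?D \<omega>))))"
      using st by (intro mult_left_mono square_le_exp_plus_exp_minus) auto
    also have "\<dots> = 2 * C\<^sup>2 * (t - s) * (exp (u * ?D \<omega>) + exp (- u * ?D \<omega>))"
      by simp
    finally have "(?D \<omega>)\<^sup>2 \<le> 2 * C\<^sup>2 * (t - s) * (exp (u * ?D \<omega>) + exp (- u * ?D \<omega>))" .
    then have "ennreal ((?D \<omega>)\<^sup>2) \<le> ennreal (2 * C\<^sup>2 * (t - s) * (exp (u * ?D \<omega>) + exp (- u * ?D \<omega>)))"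
      by (rule ennreal_leI)
    also have "\<dots> = ennreal (2 * C\<^sup>2 * (t - s)) * (ennreal (exp (u * ?D \<omega>)) + ennreal (exp (- u * ?D \<omega>)))"
      using c by (simp only: ennreal_mult ennreal_plus exp_ge_zero add_nonneg_nonneg)
    finally have "f \<omega> * ennreal ((?D \<omega>)\<^sup>2)
        \<le> f \<omega> * (ennreal (2 * C\<^sup>2 * (t - s)) * (ennreal (exp (u * ?D \<omega>)) + ennreal (exp (- u * ?D \<omega>))))"
      by (rule mult_left_mono) simp
    then show "f \<omega> * ennreal ((?D \<omega>)\<^sup>2)
        \<le> ennreal (2 * C\<^sup>2 * (t - s)) * (f \<omega> * ennreal (exp (u * ?D \<omega>)) + f \<omega> * ennreal (exp (- u * ?D \<omega>)))"
      by (simp only: distrib_left mult_ac)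
  qed
  also have "\<dots> = ennreal (2 * C\<^sup>2 * (t - s)) * ((\<integral>\<^sup>+\<omega>. f \<omega> * ennreal (exp (u * ?D \<omega>)) \<partial>M)
      + (\<integral>\<^sup>+\<omega>. f \<omega> * ennreal (exp (- u * ?D \<omega>)) \<partial>M))"
    by (simp add: nn_integral_cmult nn_integral_add)
  also have "\<dots> \<le> ennreal (2 * C\<^sup>2 * (t - s)) * (ennreal (exp (1 / 2)) * (\<integral>\<^sup>+\<omega>. f \<omega> \<partial>M)
      + ennreal (exp (1 / 2)) * (\<integral>\<^sup>+\<omega>. f \<omega> \<partial>M))"
    using nn_integral_exp_ito_increment[OF st f, of u] nn_integral_exp_ito_increment[OF st f, of "- u"] u(1)
    by (intro mult_left_mono add_mono) auto
  also have "\<dots> = ennreal (4 * C\<^sup>2 * (t - s) * exp (1 / 2)) * (\<integral>\<^sup>+\<omega>. f \<omega> \<partial>M)"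
  proof -
    have "ennreal (4 * C\<^sup>2 * (t - s) * exp (1 / 2)) = ennreal (2 * C\<^sup>2 * (t - s)) * (ennreal (exp (1 / 2)) * 2)"
      using c by (simp flip: ennreal_mult ennreal_numeral add: mult_ac)
    then show ?thesis
      by (simp add: mult_2[symmetric] mult_ac)
  qed
  also have "\<dots> \<le> ennreal (8 * C\<^sup>2 * (t - s)) * (\<integral>\<^sup>+\<omega>. f \<omega> \<partial>M)"
    using mult_left_mono[OF exp_half_le2, of "4 * C\<^sup>2 * (t - s)"] st
    by (intro mult_right_mono ennreal_leI) auto
  finally show ?thesis .
qed simp

lemma sets_F_mono: "s \<le> t \<Longrightarrow> sets (F s) \<subseteq> sets (F t)"
  using filtered by (simp add: filtered_prob_space_def filtration_def)

lemma sets_F_M: "sets (F s) \<subseteq> events"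
  using filtered by (simp add: filtered_prob_space_def subalgebra_def)

text \<open>The exponential of the sum, divided by its variance factor, is a supermartingale with
  initial mean 1. It is built from the adapted version \<open>J\<close>; off a null set
  \<open>J\<close> and \<open>I\<close> agree at all the times \<open>t k\<close>, so the result
  holds for \<open>I\<close>.\<close>

theorem ito_sum_maximal_inequality:
  fixes t :: "nat \<Rightarrow> real"
  assumes t: "0 \<le> t 0" "\<And>k. t k \<le> t (Suc k)"
    and U: "\<And>k. U k \<in> borel_measurable (F (t k))"
      "\<And>k \<omega>. \<omega> \<in> space M \<Longrightarrow> 0 \<le> U k \<omega> \<and> U k \<omega> \<le> (1::real)"
  shows "emeasure M {\<omega>\<in>space M. \<exists>k\<le>n. u\<^sup>2 * C\<^sup>2 * (t n - t 0) / 2 + b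
            \<le> u * (\<Sum>j<k. U j \<omega> * (I (t (Suc j)) \<omega> - I (t j) \<omega>))}
    \<le> ennreal (exp (- b))" (is "emeasure M ?A \<le> _")
proof -
  have t_nonneg: "0 \<le> t k" for k
    using lift_Suc_mono_le[of t 0 k] t by force
  have t_mono: "t j \<le> t k" if "j \<le> k" for j k
    using lift_Suc_mono_le[of t, OF t(2) that] .
  obtain J where J: "\<And>t. 0 \<le> t \<Longrightarrow> J t \<in> borel_measurable (F t)" "\<And>t. 0 \<le> t \<Longrightarrow> AE \<omega> in M. J t \<omega> = I t \<omega>"
    using ito_integral_adapted_version[OF ito] by blast
  have AE_J: "AE \<omega> in M. \<forall>k. J (t k) \<omega> = I (t k) \<omega>"
    using J(2) t_nonneg by (simp add: AE_all_countable)
  define S where "S k \<omega> = (\<Sum>j<k. U j \<omega> * (J (t (Suc j)) \<omega> - J (t j) \<omega>))" for k \<omega>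
  define N where "N k \<omega> = ennreal (exp (u * S k \<omega> - u\<^sup>2 * C\<^sup>2 * (t k - t 0) / 2))" for k \<omega>
  have S [measurable]: "S k \<in> borel_measurable (F (t k))" for k
    unfolding S_def
  proof (intro borel_measurable_sum borel_measurable_times borel_measurable_diff)
    fix j assume "j \<in> {..<k}"
    then have "t j \<le> t k" "t (Suc j) \<le> t k" by (auto intro!: t_mono)
    then show "U j \<in> borel_measurable (F (t k))" "J (t (Suc j)) \<in> borel_measurable (F (t k))"
        "J (t j) \<in> borel_measurable (F (t k))"
      using measurable_F_mono U(1) J(1) t_nonneg by blast+
  qed
  have N: "N k \<in> borel_measurable (F (t k))" for k
    unfolding N_def by measurable
  have super: "(\<integral>\<^sup>+\<omega>. N (Suc k) \<omega> * indicator A \<omega> \<partial>M) \<le> (\<integral>\<^sup>+\<omega>. N k \<omega> * indicator A \<omega> \<partial>M)"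
    if A [measurable]: "A \<in> sets (F (t k))" for k A
  proof -
    define e where "e = u\<^sup>2 * C\<^sup>2 * (t (Suc k) - t k) / 2"
    have f: "(\<lambda>\<omega>. N k \<omega> * indicator A \<omega>) \<in> borel_measurable (F (t k))"
      using N[of k] by measurable
    note [measurable] = measurable_F_M[OF f] measurable_F_M[OF U(1)[of k]]
      measurable_I[OF t_nonneg]
    let ?e = "\<lambda>\<omega>. ennreal (exp (u * (U k \<omega> * (I (t (Suc k)) \<omega> - I (t k) \<omega>))))"
    have "(\<integral>\<^sup>+\<omega>. N (Suc k) \<omega> * indicator A \<omega> \<partial>M) = (\<integral>\<^sup>+\<omega>. ennreal (exp (- e)) * (N k \<omega> * indicator A \<omega>
        * ?e \<omega>) \<partial>M)"
    proof (rule nn_integral_cong_AE)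
      show "AE \<omega> in M. N (Suc k) \<omega> * indicator A \<omega> = ennreal (exp (- e)) * (N k \<omega> * indicator A \<omega>
        * ?e \<omega>)"
        using AE_J
      proof eventually_elim
        fix \<omega> assume J_eq: "\<forall>k. J (t k) \<omega> = I (t k) \<omega>"
        have "u * S (Suc k) \<omega> - u\<^sup>2 * C\<^sup>2 * (t (Suc k) - t 0) / 2
            = - e + (u * S k \<omega> - u\<^sup>2 * C\<^sup>2 * (t k - t 0) / 2 + u * (U k \<omega> * (I (t (Suc k)) \<omega> - I (t k) \<omega>)))"
          using J_eq by (simp add: S_def e_def algebra_simps add_divide_distrib diff_divide_distrib)
        then have "N (Suc k) \<omega> = ennreal (exp (- e)) * (N k \<omega> * ?e \<omega>)"
          unfolding N_def by (simp only: exp_add ennreal_mult exp_ge_zero mult_nonneg_nonneg)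
        then show "N (Suc k) \<omega> * indicator A \<omega> = ennreal (exp (- e)) * (N k \<omega> * indicator A \<omega>
            * ?e \<omega>)"
          by (simp add: mult_ac)
      qed
    qed
    also have "\<dots> = ennreal (exp (- e)) * (\<integral>\<^sup>+\<omega>. N k \<omega> * indicator A \<omega>
        * ?e \<omega> \<partial>M)"
      by (rule nn_integral_cmult) measurable
    also have "\<dots> \<le> ennreal (exp (- e)) * (ennreal (exp e) * (\<integral>\<^sup>+\<omega>. N k \<omega> * indicator A \<omega> \<partial>M))"
      unfolding e_def
      by (intro mult_left_mono nn_integral_exp_weighted_ito_increment t_nonneg t(2) f U) auto
    also have "\<dots> = (\<integral>\<^sup>+\<omega>. N k \<omega> * indicator A \<omega> \<partial>M)"
      by (simp add: mult.assoc[symmetric] flip: ennreal_mult exp_add)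
    finally show ?thesis .
  qed
  have N0: "(\<integral>\<^sup>+\<omega>. N 0 \<omega> \<partial>M) = 1"
    by (simp add: N_def S_def emeasure_space_1)
  let ?A' = "{\<omega>\<in>space M. \<exists>k\<le>n. ennreal (exp b) \<le> N k \<omega>}"
  have "ennreal (exp b) * emeasure M ?A' \<le> (\<integral>\<^sup>+\<omega>. N 0 \<omega> \<partial>M)"
    using t(2) by (intro nonneg_supermartingale_maximal_inequality[of "\<lambda>k. F (t k)"] N super)
      (auto intro: sets_F_mono[THEN subsetD] sets_F_M[THEN subsetD])
  then have max_ineq: "emeasure M ?A' \<le> ennreal (exp (- b))"
    unfolding N0
    by (subst (asm) ennreal_mult_le_mult_iff[symmetric, of "ennreal (exp (- b))"])
       (auto simp: mult.assoc[symmetric] simp flip: ennreal_mult exp_add)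
  have "emeasure M ?A
      \<le> emeasure M ?A'"
  proof (rule emeasure_mono_AE)
    show "AE \<omega> in M. \<omega> \<in> ?A
        \<longrightarrow> \<omega> \<in> ?A'"
      using AE_J
    proof eventually_elim
      case (elim \<omega>)
      \<comment> \<open>The event uses the compensator at the final time \<open>t n\<close>, which
        dominates the one at \<open>t k\<close>.\<close>
      have "ennreal (exp b) \<le> N k \<omega>"
        if "k \<le> n" "u\<^sup>2 * C\<^sup>2 * (t n - t 0) / 2 + b \<le> u * (\<Sum>j<k. U j \<omega> * (I (t (Suc j)) \<omega> - I (t j) \<omega>))" for k
      proof -
        have "u\<^sup>2 * C\<^sup>2 * (t k - t 0) \<le> u\<^sup>2 * C\<^sup>2 * (t n - t 0)"
          using t_mono[OF that(1)] by (intro mult_left_mono) auto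
        moreover have "u * S k \<omega> = u * (\<Sum>j<k. U j \<omega> * (I (t (Suc j)) \<omega> - I (t j) \<omega>))"
          using elim by (simp add: S_def)
        ultimately have "b \<le> u * S k \<omega> - u\<^sup>2 * C\<^sup>2 * (t k - t 0) / 2"
          using that(2) by linarith
        then show ?thesis
          unfolding N_def by (intro ennreal_leI) simp
      qed
      then show ?case by blast
    qed
    have "N k \<in> borel_measurable M" for k
      using measurable_F_M[OF N] .
    then show "?A' \<in> events"
      by measurable
  qed
  then show ?thesis
    using max_ineq by (rule order_trans)
qed

corollary ito_sum_deviation:
  fixes t :: "nat \<Rightarrow> real"
  assumes t: "0 \<le> t 0" "\<And>k. t k \<le> t (Suc k)"
    and U: "\<And>k. U k \<in> borel_measurable (F (t k))"
      "\<And>k \<omega>. \<omega> \<in> space M \<Longrightarrow> 0 \<le> U k \<omega> \<and> U k \<omega> \<le> (1::real)"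
    and T: "t n - t 0 \<le> T" "0 < T" and b: "0 < b"
  shows "measure M {\<omega>\<in>space M. \<exists>k\<le>n. C * sqrt (2 * b * T)
            \<le> \<bar>\<Sum>j<k. U j \<omega> * (I (t (Suc j)) \<omega> - I (t j) \<omega>)\<bar>} \<le> 2 * exp (- b)"
proof -
  \<comment> \<open>The optimal exponent of the Gaussian tail bound: the compensator u^2 C^2 T / 2
    becomes \<open>b\<close>, and the threshold multiplied by \<open>u\<close> becomes 2 b, that is,
    compensator plus \<open>b\<close>.\<close>
  define u where "u = sqrt (2 * b / T) / C"
  have "u * (C * sqrt (2 * b * T)) = sqrt ((2 * b / T) * (2 * b * T))"
    using C_pos by (simp add: u_def flip: real_sqrt_mult)
  also have "\<dots> = 2 * b"
    using T b by (intro real_sqrt_unique) (auto simp: power2_eq_square)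
  finally have u: "0 < u" "u\<^sup>2 * C\<^sup>2 * T = 2 * b" "u * (C * sqrt (2 * b * T)) = 2 * b"
    using T b C_pos by (auto simp: u_def power_divide)
  let ?S = "\<lambda>k \<omega>. \<Sum>j<k. U j \<omega> * (I (t (Suc j)) \<omega> - I (t j) \<omega>)"
  let ?A = "\<lambda>v. {\<omega>\<in>space M. \<exists>k\<le>n. v\<^sup>2 * C\<^sup>2 * (t n - t 0) / 2 + b \<le> v * ?S k \<omega>}"
  have t_nonneg: "0 \<le> t k" for k
    using lift_Suc_mono_le[of t 0 k] t by force
  have [measurable]: "U k \<in> borel_measurable M" "I (t k) \<in> borel_measurable M" for k
    using U(1) t_nonneg by (auto intro: measurable_I measurable_F_M)
  have A: "measure M (?A v) \<le> exp (- b)" for v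
    using ito_sum_maximal_inequality[OF t U, of n v b] by (simp add: emeasure_eq_measure)
  have "measure M {\<omega>\<in>space M. \<exists>k\<le>n. C * sqrt (2 * b * T) \<le> \<bar>?S k \<omega>\<bar>} \<le> measure M (?A u \<union> ?A (- u))"
  proof (rule finite_measure_mono)
    have "u\<^sup>2 * C\<^sup>2 * (t n - t 0) \<le> u\<^sup>2 * C\<^sup>2 * T"
      using T by (intro mult_left_mono) auto
    then have le: "u\<^sup>2 * C\<^sup>2 * (t n - t 0) / 2 + b \<le> 2 * b"
      using u(2) by simp
    have "u\<^sup>2 * C\<^sup>2 * (t n - t 0) / 2 + b \<le> u * S \<or> u\<^sup>2 * C\<^sup>2 * (t n - t 0) / 2 + b \<le> (- u) * S"
      if "C * sqrt (2 * b * T) \<le> \<bar>S\<bar>" for S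
      using mult_left_mono[OF that, of u] u le by (cases "0 \<le> S") auto
    then show "{\<omega>\<in>space M. \<exists>k\<le>n. C * sqrt (2 * b * T) \<le> \<bar>?S k \<omega>\<bar>} \<subseteq> ?A u \<union> ?A (- u)"
      by fastforce
  qed measurable
  also have "\<dots> \<le> measure M (?A u) + measure M (?A (- u))"
    by (rule measure_Un_le) measurable
  also have "\<dots> \<le> 2 * exp (- b)"
    using A[of u] A[of "- u"] by simp
  finally show ?thesis .
qed

text \<open>By the second moment alone, each factor has conditional mean at most 1 + 8 C^2 w (t' -
  t) on a cell from t to t', so the product has mean at most the exponential of the sum, and
  Markov's inequality finishes. The exponential of the quadratic sum itself can have infinite mean
  when \<open>w\<close> is large, hence the product. Its factors are at least 1, so the final index
  also controls earlier ones.\<close>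

theorem ito_quadratic_variation_deviation:
  fixes t :: "nat \<Rightarrow> real"
  assumes t: "0 \<le> t 0" "\<And>k. t k \<le> t (Suc k)" and w: "\<And>k. 0 \<le> w k"
  shows "measure M {\<omega>\<in>space M. exp (8 * C\<^sup>2 * (\<Sum>j<n. w j * (t (Suc j) - t j)) + b)
            \<le> (\<Prod>j<n. 1 + w j * (I (t (Suc j)) \<omega> - I (t j) \<omega>)\<^sup>2)} \<le> exp (- b)"
proof -
  have t_nonneg: "0 \<le> t k" for k
    using lift_Suc_mono_le[of t 0 k] t by force
  have t_mono: "t j \<le> t k" if "j \<le> k" for j k
    using lift_Suc_mono_le[of t, OF t(2) that] .
  obtain J where J: "\<And>t. 0 \<le> t \<Longrightarrow> J t \<in> borel_measurable (F t)" "\<And>t. 0 \<le> t \<Longrightarrow> AE \<omega> in M. J t \<omega> = I t \<omega>"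
    using ito_integral_adapted_version[OF ito] by blast
  have AE_J: "AE \<omega> in M. \<forall>k. J (t k) \<omega> = I (t k) \<omega>"
    using J(2) t_nonneg by (simp add: AE_all_countable)
  define P where "P k \<omega> = (\<Prod>j<k. 1 + w j * (J (t (Suc j)) \<omega> - J (t j) \<omega>)\<^sup>2)" for k \<omega>
  define V where "V k = 8 * C\<^sup>2 * (\<Sum>j<k. w j * (t (Suc j) - t j))" for k
  have P_nonneg: "0 \<le> P k \<omega>" for k \<omega>
    unfolding P_def using w by (intro prod_nonneg) (auto intro!: add_nonneg_nonneg)
  have P [measurable]: "P k \<in> borel_measurable (F (t k))" for k
    unfolding P_def
  proof (intro borel_measurable_prod borel_measurable_add borel_measurable_times borel_measurable_power
      borel_measurable_diff borel_measurable_const)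
    fix j assume "j \<in> {..<k}"
    then have "t j \<le> t k" "t (Suc j) \<le> t k" by (auto intro!: t_mono)
    then show "J (t (Suc j)) \<in> borel_measurable (F (t k))" "J (t j) \<in> borel_measurable (F (t k))"
      using measurable_F_mono J(1) t_nonneg by blast+
  qed
  have "(\<integral>\<^sup>+\<omega>. ennreal (P k \<omega>) \<partial>M) \<le> ennreal (exp (V k))" for k
  proof (induction k)
    case 0
    then show ?case by (simp add: P_def V_def emeasure_space_1)
  next
    case (Suc k)
    define d where "d = 8 * C\<^sup>2 * (t (Suc k) - t k)"
    have d: "0 \<le> d" using t(2) by (simp add: d_def)
    have f: "(\<lambda>\<omega>. ennreal (P k \<omega>)) \<in> borel_measurable (F (t k))"
      by measurable
    note [measurable] = measurable_F_M[OF f] measurable_I[OF t_nonneg]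
    let ?D = "\<lambda>\<omega>. (I (t (Suc k)) \<omega> - I (t k) \<omega>)\<^sup>2"
    have "(\<integral>\<^sup>+\<omega>. ennreal (P (Suc k) \<omega>) \<partial>M)
        = (\<integral>\<^sup>+\<omega>. ennreal (P k \<omega>) + ennreal (w k) * (ennreal (P k \<omega>) * ennreal (?D \<omega>)) \<partial>M)"
    proof (rule nn_integral_cong_AE)
      show "AE \<omega> in M. ennreal (P (Suc k) \<omega>) = ennreal (P k \<omega>)
          + ennreal (w k) * (ennreal (P k \<omega>) * ennreal (?D \<omega>))"
        using AE_J
      proof eventually_elim
        case (elim \<omega>)
        then have "P (Suc k) \<omega> = P k \<omega> + w k * (P k \<omega> * ?D \<omega>)"
          by (simp add: P_def algebra_simps)
        then show ?case
          using P_nonneg[of k \<omega>] w[of k] by (simp add: ennreal_mult)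
      qed
    qed
    also have "\<dots> = (\<integral>\<^sup>+\<omega>. ennreal (P k \<omega>) \<partial>M)
        + ennreal (w k) * (\<integral>\<^sup>+\<omega>. ennreal (P k \<omega>) * ennreal (?D \<omega>) \<partial>M)"
      by (subst nn_integral_add) (measurable, subst nn_integral_cmult, measurable)
    also have "\<dots> \<le> (\<integral>\<^sup>+\<omega>. ennreal (P k \<omega>) \<partial>M) + ennreal (w k) * (ennreal d * (\<integral>\<^sup>+\<omega>. ennreal (P k \<omega>) \<partial>M))"
      unfolding d_def
      by (intro add_left_mono mult_left_mono nn_integral_square_ito_increment t_nonneg t(2) f) auto
    also have "\<dots> = ennreal (1 + w k * d) * (\<integral>\<^sup>+\<omega>. ennreal (P k \<omega>) \<partial>M)"
      using w[of k] d by (simp add: ennreal_mult distrib_right mult.assoc)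
    also have "\<dots> \<le> ennreal (exp (w k * d)) * ennreal (exp (V k))"
      using Suc.IH by (intro mult_mono ennreal_leI exp_ge_add_one_self) auto
    also have "\<dots> = ennreal (exp (V (Suc k)))"
      by (simp add: V_def d_def algebra_simps flip: ennreal_mult exp_add)
    finally show ?case .
  qed
  note expectation = this[of n]
  have PM [measurable]: "P n \<in> borel_measurable M"
    using measurable_F_M[OF P] .
  let ?A' = "{\<omega>\<in>space M. 1 \<le> ennreal (exp (- (V n + b))) * ennreal (P n \<omega>)}"
  let ?A = "{\<omega>\<in>space M. exp (V n + b) \<le> (\<Prod>j<n. 1 + w j * (I (t (Suc j)) \<omega> - I (t j) \<omega>)\<^sup>2)}"
  have "emeasure M ?A
      \<le> emeasure M ?A'"
  proof (rule emeasure_mono_AE)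
    show "AE \<omega> in M. \<omega> \<in> ?A
        \<longrightarrow> \<omega> \<in> ?A'"
      using AE_J
    proof eventually_elim
      case (elim \<omega>)
      show ?case
      proof (intro impI)
        assume "\<omega> \<in> ?A"
        then have w: "\<omega> \<in> space M" and le: "exp (V n + b) \<le> P n \<omega>"
          using elim by (auto simp: P_def)
        have "1 \<le> exp (- (V n + b)) * P n \<omega>"
          using mult_left_mono[OF le, of "exp (- (V n + b))"] by (simp flip: exp_add)
        then have "ennreal 1 \<le> ennreal (exp (- (V n + b)) * P n \<omega>)"
          by (rule ennreal_leI)
        then show "\<omega> \<in> ?A'"
          using w P_nonneg by (simp add: ennreal_mult)
      qed
    qed
  qed measurable
  also have "\<dots> \<le> ennreal (exp (- (V n + b))) * (\<integral>\<^sup>+\<omega>. ennreal (P n \<omega>) * indicator (space M) \<omega> \<partial>M)"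
    by (rule nn_integral_Markov_inequality) measurable
  also have "(\<integral>\<^sup>+\<omega>. ennreal (P n \<omega>) * indicator (space M) \<omega> \<partial>M) = (\<integral>\<^sup>+\<omega>. ennreal (P n \<omega>) \<partial>M)"
    by (intro nn_integral_cong) simp
  also have "ennreal (exp (- (V n + b))) * \<dots> \<le> ennreal (exp (- (V n + b))) * ennreal (exp (V n))"
    using expectation by (intro mult_left_mono) auto
  also have "\<dots> = ennreal (exp (- b))"
    by (simp flip: ennreal_mult exp_add)
  finally show ?thesis
    by (simp add: emeasure_eq_measure V_def)
qed

end

section \<open>Pathwise regret bound\<close>

lemma Max_range_diff_le:
  fixes f g :: "'a::finite \<Rightarrow> real"
  assumes "\<And>a. \<bar>f a - g a\<bar> \<le> e"
  shows "\<bar>Max (range f) - Max (range g)\<bar> \<le> e"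
proof -
  have *: "Max (range p) \<le> Max (range q) + e" if "\<And>a. \<bar>p a - q a\<bar> \<le> e" for p q :: "'a \<Rightarrow> real"
  proof -
    have "p a \<le> Max (range q) + e" for a
    proof -
      have "q a \<le> Max (range q)" by (rule Max_ge) auto
      then show ?thesis using that[of a] by linarith
    qed
    then show ?thesis by auto
  qed
  have "Max (range f) \<le> Max (range g) + e" "Max (range g) \<le> Max (range f) + e"
    using assms by (auto intro!: * simp del: Max_le_iff simp: abs_minus_commute)
  then show ?thesis by linarith
qed

lemma Max_range_vec_diff_le:
  fixes y z :: "real ^ 'a::finite"
  shows "\<bar>Max (range (($) y)) - Max (range (($) z))\<bar> \<le> norm (y - z)"
  using component_le_norm_cart[of "y - z"] by (intro Max_range_diff_le) simp

lemma score_potential_near_Max: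
  assumes "penalty_function h" and H: "\<And>x. x \<in> simplex_of_measures \<Longrightarrow> \<bar>h x\<bar> \<le> H" and e: "0 < e"
  shows "\<bar>score_potential h e y - Max (range (($) y))\<bar> \<le> H / e"
proof -
  have "Max (range (($) (e *\<^sub>R y))) = e * Max (range (($) y))"
  proof -
    have "range (($) (e *\<^sub>R y)) = (*) e ` range (($) y)"
      by (auto simp: image_image)
    moreover have "mono ((*) e)"
      using e by (intro monoI mult_left_mono) auto
    ultimately show ?thesis
      by (simp only: mono_Max_commute[of "(*) e" "range (($) y)"] finite_imageI finite UNIV_not_empty
          image_is_empty not_False_eq_True)
  qed
  then have "\<bar>convex_conjugate h (e *\<^sub>R y) - e * Max (range (($) y))\<bar> \<le> H"
    using convex_conjugate_near_Max[OF assms(1) H, of "e *\<^sub>R y"] by simp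
  then have "\<bar>convex_conjugate h (e *\<^sub>R y) - e * Max (range (($) y))\<bar> / e \<le> H / e"
    using e by (intro divide_right_mono) auto
  moreover have "score_potential h e y - Max (range (($) y))
      = (convex_conjugate h (e *\<^sub>R y) - e * Max (range (($) y))) / e"
    using e by (simp add: score_potential_def diff_divide_distrib)
  ultimately show ?thesis
    using e by (simp add: abs_divide)
qed

text \<open>Recovers a sum from the product in \<open>ito_quadratic_variation_deviation\<close>, at
  the price of a factor 2, because exp (z/2) <= 1 + z on [0, 1]. Fine grids bring the squares into
  this range.\<close>

lemma exp_sum_half_le_prod:
  fixes z :: "nat \<Rightarrow> real"
  assumes "\<And>j. j < n \<Longrightarrow> 0 \<le> z j \<and> z j \<le> 1"
  shows "exp ((\<Sum>j<n. z j) / 2) \<le> (\<Prod>j<n. 1 + z j)"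
proof -
  have "exp (z j / 2) \<le> 1 + z j" if "j < n" for j
    using exp_bound_half[of "z j / 2"] exp_bound[of "z j / 2"] assms[OF that]
      mult_left_mono[of "z j" 1 "z j"]
    by (auto simp: power2_eq_square)
  then have "(\<Prod>j<n. exp (z j / 2)) \<le> (\<Prod>j<n. 1 + z j)"
    by (intro prod_mono) auto
  then show ?thesis
    by (simp add: exp_sum sum_divide_distrib)
qed

text \<open>With mesh 1 / (n + 1) no mesh is degenerate, and every integer \<open>T\<close> is a
  grid point, of index \<open>T * Suc n\<close>.\<close>

abbreviation grid :: "nat \<Rightarrow> nat \<Rightarrow> real" where
  "grid n k \<equiv> real k / real (Suc n)"

lemma grid_le:
  assumes "k \<le> T * Suc n"
  shows "grid n k \<le> real T"
proof -
  have "real k \<le> real T * real (Suc n)"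
    using assms by (metis of_nat_le_iff of_nat_mult)
  then show ?thesis
    by (simp add: pos_divide_le_eq del: of_nat_Suc)
qed

text \<open>The interface between probability and paths. The quadratic sums stay in product form, as
  the deviation bound provides them; \<open>\<mu>\<close> scales the weights so that taking
  logarithms and dividing by \<open>\<mu>\<close> leaves \<open>G\<close>.\<close>

definition grid_controlled ::
    "('i \<Rightarrow> real \<Rightarrow> real) \<Rightarrow> ('i \<Rightarrow> real \<Rightarrow> real) \<Rightarrow> (real \<Rightarrow> real) \<Rightarrow> nat \<Rightarrow> real \<Rightarrow> real \<Rightarrow> real \<Rightarrow> nat \<Rightarrow> bool"
    where
  "grid_controlled u \<iota> w T S \<mu> G n \<longleftrightarrow>
     (\<forall>\<alpha>. \<forall>k\<le>T * Suc n. \<bar>\<Sum>j<k. u \<alpha> (grid n j)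
        * (\<iota> \<alpha> (grid n (Suc j)) - \<iota> \<alpha> (grid n j))\<bar> \<le> S) \<and>
     (\<forall>\<alpha>. \<forall>k\<le>T * Suc n. \<bar>\<iota> \<alpha> (grid n k) - \<iota> \<alpha> 0\<bar> \<le> S) \<and>
     (\<forall>\<alpha>. (\<Prod>j<T * Suc n. 1 + \<mu> * w (grid n j)
        * (\<iota> \<alpha> (grid n (Suc j)) - \<iota> \<alpha> (grid n j))\<^sup>2) \<le> exp (\<mu> * G))"

text \<open>One outcome is fixed, and everything here is deterministic. The path
  \<open>\<iota>\<close> of the noise vanishes at time 0 by the equation for
  \<open>y\<close>.\<close>

locale score_path =
  fixes h :: "real ^ 'a::finite \<Rightarrow> real" and \<eta> :: "real \<Rightarrow> real"
    and v x y :: "real \<Rightarrow> real ^ 'a" and \<iota> :: "real \<Rightarrow> real ^ 'a" and H K :: real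
  assumes pen: "penalty_function h"
    and H: "\<And>x. x \<in> simplex_of_measures \<Longrightarrow> \<bar>h x\<bar> \<le> H" "0 \<le> H"
    and K: "0 < K"
      "\<And>y d. convex_conjugate h y + choice_map h y \<bullet> d \<le> convex_conjugate h (y + d)"
      "\<And>y d. convex_conjugate h (y + d)
         \<le> convex_conjugate h y + choice_map h y \<bullet> d + K * (norm d)\<^sup>2"
    and \<eta>_pos: "\<And>t. 0 \<le> t \<Longrightarrow> 0 < \<eta> t"
    and \<eta>_mono: "\<And>s t. 0 \<le> s \<Longrightarrow> s \<le> t \<Longrightarrow> \<eta> t \<le> \<eta> s"
    and \<eta>_cont: "continuous_on {0..} \<eta>"
    and v_int: "\<And>T. 0 \<le> T \<Longrightarrow> v absolutely_integrable_on {0..T}"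
    and \<iota>_cont: "continuous_on {0..} \<iota>"
    and y_eq: "\<And>t. 0 \<le> t \<Longrightarrow> y t = y 0 + integral {0..t} v + \<iota> t"
    and x_eq: "\<And>t. 0 \<le> t \<Longrightarrow> x t = choice_map h (\<eta> t *\<^sub>R y t)"
begin

abbreviation "V t \<equiv> integral {0..t} v"
abbreviation "\<Phi> t \<equiv> score_potential h (\<eta> t) (y t)"

definition "path_regret t = Max (range (($) (V t))) - integral {0..t} (\<lambda>s. v s \<bullet> x s)"

lemma v_integrable_on:
  assumes "0 \<le> a"
  shows "v absolutely_integrable_on {a..b}"
proof (cases "a \<le> b")
  case True
  then show ?thesis
    using absolutely_integrable_on_subinterval[OF v_int[of b], of a b] assms by auto
qed simp

lemma V_cont: "continuous_on {0..T} V"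
proof (cases "0 \<le> T")
  case True
  then show ?thesis
    using v_int by (intro indefinite_integral_continuous_1) (auto simp: absolutely_integrable_on_def)
qed simp

lemma y_cont: "continuous_on {0..T} y"
proof -
  have "continuous_on {0..T} (\<lambda>t. y 0 + V t + \<iota> t)"
    by (intro continuous_intros V_cont continuous_on_subset[OF \<iota>_cont]) auto
  also have "?this \<longleftrightarrow> ?thesis"
    by (intro continuous_on_cong refl) (simp flip: y_eq)
  finally show ?thesis .
qed

lemma x_cont: "continuous_on {0..T} x"
proof -
  have "continuous_on {0..T} (\<lambda>t. choice_map h (\<eta> t *\<^sub>R y t))"
    by (intro continuous_on_compose2[OF continuous_choice_map[OF pen]] continuous_intros y_cont
        continuous_on_subset[OF \<eta>_cont]) auto
  also have "?this \<longleftrightarrow> ?thesis"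
    using x_eq by (intro continuous_on_cong) auto
  finally show ?thesis .
qed

lemma inner_v_integrable:
  assumes "0 \<le> a"
  shows "(\<lambda>s. v s \<bullet> x s) integrable_on {a..b}"
proof -
  have xab: "continuous_on {a..b} x"
    by (rule continuous_on_subset[OF x_cont[of b]]) (use assms in auto)
  have "(\<lambda>s. x s \<bullet> v s) absolutely_integrable_on {a..b}"
  proof (rule absolutely_integrable_bounded_measurable_product[where h="(\<bullet>)"])
    show "bilinear ((\<bullet>) :: real ^ 'a \<Rightarrow> real ^ 'a \<Rightarrow> real)"
      using bilinear_conv_bounded_bilinear bounded_bilinear_inner by blast
    show "x \<in> borel_measurable (lebesgue_on {a..b})"
      using xab by (rule continuous_imp_measurable_on_sets_lebesgue) auto
    show "bounded (x ` {a..b})"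
      using xab by (intro compact_imp_bounded compact_continuous_image) auto
  qed (use assms v_integrable_on in auto)
  then show ?thesis
    by (simp add: absolutely_integrable_on_def inner_commute)
qed

text \<open>Carries bounds from grid points to arbitrary times.\<close>

lemma path_regret_cont: "continuous_on {0..T} path_regret"
proof -
  have "1-lipschitz_on UNIV (\<lambda>z::real ^ 'a. Max (range (($) z)))"
    using Max_range_vec_diff_le by (intro lipschitz_onI) (auto simp: dist_norm)
  then have "continuous_on UNIV (\<lambda>z::real ^ 'a. Max (range (($) z)))"
    by (rule lipschitz_on_continuous_on)
  then have "continuous_on {0..T} (\<lambda>t. Max (range (($) (V t))))"
    by (rule continuous_on_compose2[OF _ V_cont]) auto
  then show ?thesis
    unfolding path_regret_def using inner_v_integrable
    by (intro continuous_intros indefinite_integral_continuous_1) auto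
qed

text \<open>In each cell the score changes first, at the old rate, and then the rate, at the new
  score. In this order the gradient is \<open>x\<close> at the left endpoint, which is known before
  the noise of the cell; the changes of rate telescope.\<close>

lemma discrete_potential_identity:
  fixes t :: "nat \<Rightarrow> real"
  assumes t: "t 0 = 0" "\<And>k. t k \<le> t (Suc k)"
  shows "\<bar>(\<Sum>j<k. x (t j) \<bullet> (y (t (Suc j)) - y (t j))) - (\<Phi> (t k) - \<Phi> 0)\<bar>
    \<le> H * (1 / \<eta> (t k) - 1 / \<eta> 0) + K * (\<Sum>j<k. \<eta> (t j) * (norm (y (t (Suc j)) - y (t j)))\<^sup>2)"
proof (induction k)
  case 0
  then show ?case by (simp add: t)
next
  case (Suc k)
  have tk: "0 \<le> t k"
    using lift_Suc_mono_le[of t 0 k] t by force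
  let ?d = "y (t (Suc k)) - y (t k)"
  have 1: "\<bar>\<Phi> (t (Suc k)) - score_potential h (\<eta> (t k)) (y (t (Suc k)))\<bar>
      \<le> H * (1 / \<eta> (t (Suc k)) - 1 / \<eta> (t k))"
    using tk t \<eta>_pos[of "t (Suc k)"] \<eta>_mono[of "t k" "t (Suc k)"] order_trans[OF tk t(2)]
    by (intro score_potential_rate_mono pen H) auto
  have 2: "x (t k) \<bullet> ?d \<le> score_potential h (\<eta> (t k)) (y (t (Suc k))) - \<Phi> (t k)"
    "score_potential h (\<eta> (t k)) (y (t (Suc k))) - \<Phi> (t k) \<le> x (t k) \<bullet> ?d + K * \<eta> (t k) * (norm ?d)\<^sup>2"
    unfolding x_eq[OF tk]
    by (rule score_potential_increment[OF \<eta>_pos[OF tk] K(2,3)])+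
  have 3: "0 \<le> K * \<eta> (t k) * (norm ?d)\<^sup>2"
    using K(1) \<eta>_pos[OF tk] by simp
  have sums: "(\<Sum>j<Suc k. x (t j) \<bullet> (y (t (Suc j)) - y (t j)))
      = (\<Sum>j<k. x (t j) \<bullet> (y (t (Suc j)) - y (t j))) + x (t k) \<bullet> ?d"
    "K * (\<Sum>j<Suc k. \<eta> (t j) * (norm (y (t (Suc j)) - y (t j)))\<^sup>2)
      = K * (\<Sum>j<k. \<eta> (t j) * (norm (y (t (Suc j)) - y (t j)))\<^sup>2) + K * \<eta> (t k) * (norm ?d)\<^sup>2"
    by (auto simp: distrib_left mult.assoc)
  show ?case
    unfolding sums using Suc.IH 1 2 3 by (simp only: right_diff_distrib)
qed

section \<open>Drift errors on fine grids\<close>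

lemma norm_V_diff:
  assumes "0 \<le> a" "a \<le> b"
  shows "V b - V a = integral {a..b} v" "norm (V b - V a) \<le> integral {a..b} (\<lambda>s. norm (v s))"
proof -
  have "v integrable_on {0..b}"
    using v_int[of b] assms by (auto simp: absolutely_integrable_on_def)
  from Henstock_Kurzweil_Integration.integral_combine[OF assms this]
  show *: "V b - V a = integral {a..b} v"
    by (metis add_diff_cancel_left')
  show "norm (V b - V a) \<le> integral {a..b} (\<lambda>s. norm (v s))"
    unfolding * using v_integrable_on[OF assms(1), of b]
    by (intro integral_norm_bound_integral) (auto simp: absolutely_integrable_on_def)
qed

lemma integral_norm_v_combine:
  assumes "0 \<le> a" "a \<le> b"
  shows "integral {0..a} (\<lambda>s. norm (v s)) + integral {a..b} (\<lambda>s. norm (v s)) = integral {0..b} (\<lambda>s. norm (v s))"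
  using v_int[of b] assms
  by (intro Henstock_Kurzweil_Integration.integral_combine) (auto simp: absolutely_integrable_on_def)

lemma eventually_uniform_increment:
  fixes f :: "real \<Rightarrow> real ^ 'a"
  assumes f: "continuous_on {0..real T} f" and e: "0 < e"
  shows "eventually (\<lambda>n. \<forall>j<T * Suc n. \<forall>s\<in>{grid n j..grid n (Suc j)}.
    norm (f s - f (grid n j)) \<le> e) sequentially"
proof -
  have "uniformly_continuous_on {0..real T} f"
    using f by (rule compact_uniformly_continuous) simp
  then obtain d where d: "0 < d"
    "\<And>s s'. s \<in> {0..real T} \<Longrightarrow> s' \<in> {0..real T} \<Longrightarrow> dist s' s < d \<Longrightarrow> dist (f s') (f s) < e"
    unfolding uniformly_continuous_on_def using e by metis
  have "eventually (\<lambda>n. 1 / real (Suc n) < d) sequentially"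
    using order_tendstoD(2)[OF LIMSEQ_Suc[OF lim_const_over_n[of 1]] d(1)] by simp
  then show ?thesis
  proof eventually_elim
    case (elim n)
    show ?case
    proof (intro allI impI ballI)
      fix j s assume s: "s \<in> {grid n j..grid n (Suc j)}" and j: "j < T * Suc n"
      then have T: "grid n (Suc j) \<le> real T"
        by (intro grid_le) simp
      have "grid n (Suc j) = grid n j + 1 / real (Suc n)"
        by (simp add: add_divide_distrib)
      then have "dist s (grid n j) < d"
        using s elim by (auto simp: dist_real_def)
      moreover have "s \<in> {0..real T}" "grid n j \<in> {0..real T}"
        using s T by (auto intro: order_trans[of 0 "grid n j"])
      ultimately show "norm (f s - f (grid n j)) \<le> e"
        using d(2) by (auto simp: dist_norm intro: less_imp_le)
    qed
  qed
qed

lemma grid_norm_bound: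
  assumes e: "0 < e"
  obtains e' where "0 < e'"
    "\<And>n k. k \<le> T * Suc n \<Longrightarrow> e' * integral {0..grid n k} (\<lambda>s. norm (v s)) \<le> e"
proof -
  define L where "L = integral {0..real T} (\<lambda>s. norm (v s))"
  have L: "0 \<le> L" unfolding L_def by (rule integral_nonneg)
    (use v_int[of "real T"] in \<open>auto simp: absolutely_integrable_on_def\<close>)
  show ?thesis
  \<comment> \<open>The 1 keeps the denominator positive when the payoffs vanish.\<close>
  proof (rule that[of "e / (L + 1)"])
    show "0 < e / (L + 1)" using e L by simp
    fix n k assume k: "k \<le> T * Suc n"
    have "integral {0..grid n k} (\<lambda>s. norm (v s)) \<le> L"
      unfolding L_def using grid_le[OF k] v_int[of "grid n k"] v_int[of "real T"]
      by (intro integral_subset_le) (auto simp: absolutely_integrable_on_def simp del: of_nat_Suc)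
    then have "e / (L + 1) * integral {0..grid n k} (\<lambda>s. norm (v s)) \<le> e / (L + 1) * L"
      using e L by (intro mult_left_mono) auto
    also have "\<dots> \<le> e"
      using e L by (simp add: field_simps)
    finally show "e / (L + 1) * integral {0..grid n k} (\<lambda>s. norm (v s)) \<le> e" .
  qed
qed

text \<open>On a cell the error is at most the oscillation of \<open>x\<close> times the integral of
  the norm of \<open>v\<close>. The cells add up to the total integral of the norm, which makes the
  estimate uniform in \<open>k\<close> without a pointwise bound on \<open>v\<close>.\<close>

lemma eventually_riemann_sum:
  assumes e: "0 < e"
  shows "eventually (\<lambda>n. \<forall>k\<le>T * Suc n.
    \<bar>(\<Sum>j<k. x (grid n j) \<bullet> (V (grid n (Suc j)) - V (grid n j)))
      - integral {0..grid n k} (\<lambda>s. v s \<bullet> x s)\<bar> \<le> e) sequentially"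
proof -
  obtain e' where e': "0 < e'"
    "\<And>n k. k \<le> T * Suc n \<Longrightarrow> e' * integral {0..grid n k} (\<lambda>s. norm (v s)) \<le> e"
    by (rule grid_norm_bound[OF e]) (rule that)
  have "eventually (\<lambda>n. \<forall>j<T * Suc n. \<forall>s\<in>{grid n j..grid n (Suc j)}.
    norm (x s - x (grid n j)) \<le> e') sequentially"
    by (rule eventually_uniform_increment[OF x_cont e'(1)])
  then show ?thesis
  proof eventually_elim
    case (elim n)
    define t where "t j = grid n j" for j
    have t0: "0 \<le> t j" for j by (simp add: t_def)
    have tS: "t j \<le> t (Suc j)" for j unfolding t_def by (intro divide_right_mono) auto
    have inc: "norm (x s - x (t j)) \<le> e'" if "j < T * Suc n" "s \<in> {t j..t (Suc j)}" for j s
      using elim that unfolding t_def by blast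
    have *: "k \<le> T * Suc n \<Longrightarrow> \<bar>(\<Sum>j<k. x (t j) \<bullet> (V (t (Suc j)) - V (t j))) - integral {0..t k} (\<lambda>s. v s \<bullet> x s)\<bar>
        \<le> e' * integral {0..t k} (\<lambda>s. norm (v s))" for k
    proof (induction k)
      case 0
      then show ?case by (simp add: t_def)
    next
      case (Suc k)
      have v: "v integrable_on {t k..t (Suc k)}" "(\<lambda>s. norm (v s)) integrable_on {t k..t (Suc k)}"
        using v_integrable_on[OF t0[of k], of "t (Suc k)"] by (auto simp: absolutely_integrable_on_def)
      have vx: "(\<lambda>s. v s \<bullet> x s) integrable_on {t k..t (Suc k)}"
        by (rule inner_v_integrable[OF t0])
      have c: "(\<lambda>s. v s \<bullet> x (t k)) integrable_on {t k..t (Suc k)}"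
        using integrable_linear[OF v(1) bounded_linear_inner_left[of "x (t k)"]] by (simp add: o_def)
      have "x (t k) \<bullet> (V (t (Suc k)) - V (t k)) = integral {t k..t (Suc k)} (\<lambda>s. v s \<bullet> x (t k))"
        unfolding norm_V_diff(1)[OF t0 tS]
        using integral_linear[OF v(1) bounded_linear_inner_left[of "x (t k)"]] by (simp add: o_def inner_commute)
      then have "x (t k) \<bullet> (V (t (Suc k)) - V (t k)) - integral {t k..t (Suc k)} (\<lambda>s. v s \<bullet> x s)
          = integral {t k..t (Suc k)} (\<lambda>s. v s \<bullet> x (t k) - v s \<bullet> x s)"
        using Henstock_Kurzweil_Integration.integral_diff[OF c vx] by simp
      also have "norm \<dots> \<le> integral {t k..t (Suc k)} (\<lambda>s. e' * norm (v s))"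
      proof (rule integral_norm_bound_integral)
        fix s assume s: "s \<in> {t k..t (Suc k)}"
        have "norm (v s \<bullet> (x s - x (t k))) \<le> norm (v s) * norm (x s - x (t k))"
          by (rule Cauchy_Schwarz_ineq2[folded real_norm_def])
        also have "\<dots> \<le> norm (v s) * e'"
          using inc[OF _ s] Suc.prems by (intro mult_left_mono) auto
        finally show "norm (v s \<bullet> x (t k) - v s \<bullet> x s) \<le> e' * norm (v s)"
          by (simp add: inner_diff_right abs_minus_commute mult.commute)
      qed (use c vx v(2) in \<open>auto intro: integrable_diff integrable_on_mult_right\<close>)
      also have "\<dots> = e' * integral {t k..t (Suc k)} (\<lambda>s. norm (v s))"
        by simp
      finally have step: "\<bar>x (t k) \<bullet> (V (t (Suc k)) - V (t k)) - integral {t k..t (Suc k)} (\<lambda>s. v s \<bullet> x s)\<bar>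
          \<le> e' * integral {t k..t (Suc k)} (\<lambda>s. norm (v s))" by simp
      have i1: "integral {0..t k} (\<lambda>s. v s \<bullet> x s) + integral {t k..t (Suc k)} (\<lambda>s. v s \<bullet> x s)
          = integral {0..t (Suc k)} (\<lambda>s. v s \<bullet> x s)"
        using t0 tS by (intro Henstock_Kurzweil_Integration.integral_combine inner_v_integrable) auto
      have i2: "e' * integral {0..t k} (\<lambda>s. norm (v s)) + e' * integral {t k..t (Suc k)} (\<lambda>s. norm (v s))
          = e' * integral {0..t (Suc k)} (\<lambda>s. norm (v s))"
        using integral_norm_v_combine[OF t0[of k] tS[of k]] by (metis distrib_left)
      show ?case
        using Suc.IH Suc.prems step i1 i2 by simp
    qed
    show ?case
    proof (intro allI impI)
      fix k assume k: "k \<le> T * Suc n"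
      show "\<bar>(\<Sum>j<k. x (grid n j) \<bullet> (V (grid n (Suc j)) - V (grid n j)))
          - integral {0..grid n k} (\<lambda>s. v s \<bullet> x s)\<bar> \<le> e"
        using *[OF k] e'(2)[OF k] unfolding t_def by linarith
    qed
  qed
qed

text \<open>\<open>V\<close> is continuous and of bounded variation, so it has no quadratic
  variation: one factor of each square is uniformly small, the other factors sum to at most the
  variation.\<close>

lemma eventually_V_square_sum:
  assumes e: "0 < e"
  shows "eventually (\<lambda>n. \<forall>k\<le>T * Suc n.
    (\<Sum>j<k. (norm (V (grid n (Suc j)) - V (grid n j)))\<^sup>2) \<le> e) sequentially"
proof -
  obtain e' where e': "0 < e'"
    "\<And>n k. k \<le> T * Suc n \<Longrightarrow> e' * integral {0..grid n k} (\<lambda>s. norm (v s)) \<le> e"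
    by (rule grid_norm_bound[OF e]) (rule that)
  have "eventually (\<lambda>n. \<forall>j<T * Suc n. \<forall>s\<in>{grid n j..grid n (Suc j)}.
    norm (V s - V (grid n j)) \<le> e') sequentially"
    by (rule eventually_uniform_increment[OF V_cont e'(1)])
  then show ?thesis
  proof eventually_elim
    case (elim n)
    define t where "t j = grid n j" for j
    have t0: "0 \<le> t j" for j by (simp add: t_def)
    have tS: "t j \<le> t (Suc j)" for j unfolding t_def by (intro divide_right_mono) auto
    have inc: "norm (V (t (Suc j)) - V (t j)) \<le> e'" if "j < T * Suc n" for j
      using elim that tS[of j] unfolding t_def by auto
    have *: "k \<le> T * Suc n \<Longrightarrow> (\<Sum>j<k. (norm (V (t (Suc j)) - V (t j)))\<^sup>2) \<le> e' * integral {0..t k} (\<lambda>s. norm (v s))" for k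
    proof (induction k)
      case 0
      then show ?case by (simp add: t_def)
    next
      case (Suc k)
      have "(norm (V (t (Suc k)) - V (t k)))\<^sup>2 \<le> e' * integral {t k..t (Suc k)} (\<lambda>s. norm (v s))"
        unfolding power2_eq_square using inc[of k] Suc.prems norm_V_diff(2)[OF t0[of k] tS[of k]] e'
        by (intro mult_mono) auto
      then show ?case
        using Suc.IH Suc.prems integral_norm_v_combine[OF t0[of k] tS[of k], symmetric]
        by (simp add: distrib_left)
    qed
    show ?case
    proof (intro allI impI)
      fix k assume k: "k \<le> T * Suc n"
      show "(\<Sum>j<k. (norm (V (grid n (Suc j)) - V (grid n j)))\<^sup>2) \<le> e"
        using *[OF k] e'(2)[OF k] unfolding t_def by linarith
    qed
  qed
qed

text \<open>The noise part is written by coordinates because the deviation bounds are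
  coordinatewise.\<close>

lemma sum_inner_increments:
  fixes t :: "nat \<Rightarrow> real"
  assumes "\<And>j. 0 \<le> t j"
  shows "(\<Sum>j<k. x (t j) \<bullet> (y (t (Suc j)) - y (t j)))
    = (\<Sum>j<k. x (t j) \<bullet> (V (t (Suc j)) - V (t j)))
      + (\<Sum>\<alpha>\<in>UNIV. \<Sum>j<k. x (t j) $ \<alpha> * (\<iota> (t (Suc j)) $ \<alpha> - \<iota> (t j) $ \<alpha>))"
proof -
  have "y (t (Suc j)) - y (t j) = (V (t (Suc j)) - V (t j)) + (\<iota> (t (Suc j)) - \<iota> (t j))" for j
    using y_eq[OF assms, of "Suc j"] y_eq[OF assms, of j] by simp
  then have "(\<Sum>j<k. x (t j) \<bullet> (y (t (Suc j)) - y (t j)))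
    = (\<Sum>j<k. x (t j) \<bullet> (V (t (Suc j)) - V (t j))) + (\<Sum>j<k. x (t j) \<bullet> (\<iota> (t (Suc j)) - \<iota> (t j)))"
    by (simp add: inner_add_right sum.distrib)
  also have "(\<Sum>j<k. x (t j) \<bullet> (\<iota> (t (Suc j)) - \<iota> (t j)))
      = (\<Sum>\<alpha>\<in>UNIV. \<Sum>j<k. x (t j) $ \<alpha> * (\<iota> (t (Suc j)) $ \<alpha> - \<iota> (t j) $ \<alpha>))"
    by (simp add: inner_vec_def sum.swap[of _ UNIV])
  finally show ?thesis .
qed

lemma square_norm_eq_sum: "(norm (z :: real ^ 'a))\<^sup>2 = (\<Sum>\<alpha>\<in>UNIV. (z $ \<alpha>)\<^sup>2)"
  unfolding power2_norm_eq_inner by (simp add: inner_vec_def power2_eq_square)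

text \<open>Separating drift and noise in the square costs a factor 2, the passage from product to
  sum another 2; hence 4 per coordinate. The condition \<open>small\<close> puts the scaled squares
  into the range of \<open>exp_sum_half_le_prod\<close>.\<close>

lemma quadratic_increments_le:
  fixes t :: "nat \<Rightarrow> real"
  assumes t: "\<And>j. 0 \<le> t j" and k: "k \<le> n" and \<mu>: "0 < \<mu>"
    and V: "(\<Sum>j<k. (norm (V (t (Suc j)) - V (t j)))\<^sup>2) \<le> e"
    and small: "\<And>j. j < n \<Longrightarrow> \<mu> * \<eta> 0 * (norm (\<iota> (t (Suc j)) - \<iota> (t j)))\<^sup>2 \<le> 1"
    and prod: "\<And>\<alpha>. (\<Prod>j<n. 1 + \<mu> * \<eta> (t j) * (\<iota> (t (Suc j)) $ \<alpha> - \<iota> (t j) $ \<alpha>)\<^sup>2) \<le> exp (\<mu> * G)"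
  shows "(\<Sum>j<k. \<eta> (t j) * (norm (y (t (Suc j)) - y (t j)))\<^sup>2) \<le> 2 * \<eta> 0 * e + 4 * real CARD('a) * G"
proof -
  let ?dV = "\<lambda>j. V (t (Suc j)) - V (t j)" and ?d = "\<lambda>j. \<iota> (t (Suc j)) - \<iota> (t j)"
  have eta: "0 < \<eta> (t j)" "\<eta> (t j) \<le> \<eta> 0" for j
    using \<eta>_pos \<eta>_mono t by auto
  have le1: "(norm (y (t (Suc j)) - y (t j)))\<^sup>2 \<le> 2 * (norm (?dV j))\<^sup>2 + 2 * (\<Sum>\<alpha>\<in>UNIV. (?d j $ \<alpha>)\<^sup>2)" for j
  proof -
    have "y (t (Suc j)) - y (t j) = ?dV j + ?d j"
      using y_eq[OF t, of "Suc j"] y_eq[OF t, of j] by simp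
    then have "(norm (y (t (Suc j)) - y (t j)))\<^sup>2 \<le> (norm (?dV j) + norm (?d j))\<^sup>2"
      by (simp add: norm_triangle_ineq power_mono)
    also have "\<dots> \<le> 2 * (norm (?dV j))\<^sup>2 + 2 * (norm (?d j))\<^sup>2"
      using sum_squares_bound[of "norm (?dV j)" "norm (?d j)"] by (simp add: power2_sum)
    finally show ?thesis
      by (simp only: square_norm_eq_sum[of "?d j"])
  qed
  have noise: "(\<Sum>j<k. \<eta> (t j) * (?d j $ \<alpha>)\<^sup>2) \<le> 2 * G" for \<alpha>
  proof -
    let ?z = "\<lambda>j. \<mu> * \<eta> (t j) * (?d j $ \<alpha>)\<^sup>2"
    have z: "0 \<le> ?z j \<and> ?z j \<le> 1" if "j < n" for j
    proof -
      have "(?d j $ \<alpha>)\<^sup>2 \<le> (norm (?d j))\<^sup>2"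
        using component_le_norm_cart[of "?d j" \<alpha>] abs_le_square_iff[of "?d j $ \<alpha>" "norm (?d j)"] by simp
      then have "?z j \<le> \<mu> * \<eta> 0 * (norm (?d j))\<^sup>2"
        using \<mu> eta[of j] by (intro mult_mono mult_nonneg_nonneg) auto
      moreover have "0 \<le> ?z j"
        using \<mu> eta[of j] by simp
      ultimately show ?thesis
        using small[OF that] by linarith
    qed
    have "exp ((\<Sum>j<n. ?z j) / 2) \<le> (\<Prod>j<n. 1 + ?z j)"
      by (rule exp_sum_half_le_prod) (rule z)
    also have "\<dots> \<le> exp (\<mu> * G)"
      using prod[of \<alpha>] by simp
    finally have "(\<Sum>j<n. ?z j) \<le> \<mu> * (2 * G)"
      by simp
    moreover have "(\<Sum>j<k. ?z j) \<le> (\<Sum>j<n. ?z j)"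
      using k z by (intro sum_mono2) auto
    moreover have "(\<Sum>j<k. ?z j) = \<mu> * (\<Sum>j<k. \<eta> (t j) * (?d j $ \<alpha>)\<^sup>2)"
      by (simp add: sum_distrib_left mult.assoc)
    ultimately have "\<mu> * (\<Sum>j<k. \<eta> (t j) * (?d j $ \<alpha>)\<^sup>2) \<le> \<mu> * (2 * G)"
      by linarith
    then show ?thesis
      using \<mu> by simp
  qed
  have "(\<Sum>j<k. \<eta> (t j) * (norm (y (t (Suc j)) - y (t j)))\<^sup>2)
      \<le> (\<Sum>j<k. \<eta> (t j) * (2 * (norm (?dV j))\<^sup>2 + 2 * (\<Sum>\<alpha>\<in>UNIV. (?d j $ \<alpha>)\<^sup>2)))"
    using eta le1 by (intro sum_mono mult_left_mono) (auto intro: less_imp_le)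
  also have "\<dots> = 2 * (\<Sum>j<k. \<eta> (t j) * (norm (?dV j))\<^sup>2)
      + 2 * (\<Sum>\<alpha>\<in>UNIV. \<Sum>j<k. \<eta> (t j) * (?d j $ \<alpha>)\<^sup>2)"
    by (simp add: sum.distrib sum_distrib_left distrib_left mult.left_commute sum.swap[of _ UNIV "{..<k}"])
  also have "(\<Sum>j<k. \<eta> (t j) * (norm (?dV j))\<^sup>2) \<le> \<eta> 0 * e"
  proof -
    have "(\<Sum>j<k. \<eta> (t j) * (norm (?dV j))\<^sup>2) \<le> (\<Sum>j<k. \<eta> 0 * (norm (?dV j))\<^sup>2)"
      using eta by (intro sum_mono mult_right_mono) auto
    also have "\<dots> \<le> \<eta> 0 * e"
      using V \<eta>_pos[of 0] by (simp flip: sum_distrib_left)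
    finally show ?thesis .
  qed
  also have "(\<Sum>\<alpha>\<in>UNIV. \<Sum>j<k. \<eta> (t j) * (?d j $ \<alpha>)\<^sup>2) \<le> (\<Sum>\<alpha>\<in>(UNIV :: 'a set). 2 * G)"
    by (intro sum_mono noise)
  finally show ?thesis
    by simp
qed

text \<open>The regret is compared in turn with the maximal score, the potential and the sums of
  \<open>x\<close> against increments of \<open>y\<close>. \<open>H / \<eta> T\<close> is paid
  twice, for the distance of the potential to the maximum and for the changing rate;
  \<open>S\<close> is paid twice per coordinate, as a shift of the scores and as a martingale
  sum.\<close>

lemma path_regret_grid_bound:
  fixes t :: "nat \<Rightarrow> real"
  assumes t: "t 0 = 0" "\<And>k. t k \<le> t (Suc k)" and k: "t k \<le> T"
    and riemann: "\<bar>(\<Sum>j<k. x (t j) \<bullet> (V (t (Suc j)) - V (t j))) - integral {0..t k} (\<lambda>s. v s \<bullet> x s)\<bar> \<le> e"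
    and martingale: "\<And>\<alpha>. \<bar>\<Sum>j<k. x (t j) $ \<alpha> * (\<iota> (t (Suc j)) $ \<alpha> - \<iota> (t j) $ \<alpha>)\<bar> \<le> S"
    and noise: "\<And>\<alpha>. \<bar>\<iota> (t k) $ \<alpha>\<bar> \<le> S"
    and quadratic: "(\<Sum>j<k. \<eta> (t j) * (norm (y (t (Suc j)) - y (t j)))\<^sup>2) \<le> q"
  shows "\<bar>path_regret (t k)\<bar>
    \<le> 2 * H / \<eta> T + norm (y 0) + \<bar>\<Phi> 0\<bar> + 2 * real CARD('a) * S + K * q + e"
proof -
  have t_nonneg: "0 \<le> t j" for j
    using lift_Suc_mono_le[of t 0 j] t by force
  define Y where "Y = (\<Sum>j<k. x (t j) \<bullet> (y (t (Suc j)) - y (t j)))"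
  define A where "A = (\<Sum>j<k. x (t j) \<bullet> (V (t (Suc j)) - V (t j)))"
  define N where "N = (\<Sum>\<alpha>\<in>UNIV. \<Sum>j<k. x (t j) $ \<alpha> * (\<iota> (t (Suc j)) $ \<alpha> - \<iota> (t j) $ \<alpha>))"
  have Y: "Y = A + N"
    unfolding Y_def A_def N_def by (rule sum_inner_increments[OF t_nonneg])
  have N: "\<bar>N\<bar> \<le> real CARD('a) * S"
    unfolding N_def using sum_abs sum_bounded_above[of UNIV _ S] martingale
    by (metis (no_types, lifting) order_trans)
  have T: "0 < \<eta> T" "\<eta> T \<le> \<eta> (t k)" "0 < \<eta> (t k)" "0 < \<eta> 0"
    using \<eta>_pos \<eta>_mono[OF t_nonneg k] t_nonneg k order_trans[OF t_nonneg k] by auto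
  have HT: "H / \<eta> (t k) \<le> H / \<eta> T"
    using T H(2) by (intro divide_left_mono) auto
  have "H * (1 / \<eta> (t k) - 1 / \<eta> 0) \<le> H / \<eta> (t k)"
    using H(2) T by (simp add: right_diff_distrib)
  then have "\<bar>Y - (\<Phi> (t k) - \<Phi> 0)\<bar> \<le> H / \<eta> T + K * q"
    using discrete_potential_identity[OF t, of k] HT mult_left_mono[OF quadratic, of K] K(1)
    unfolding Y_def by linarith
  moreover have "\<bar>\<Phi> (t k) - Max (range (($) (y (t k))))\<bar> \<le> H / \<eta> T"
    using score_potential_near_Max[OF pen H(1) T(3), of "y (t k)"] HT by simp
  moreover have "\<bar>Max (range (($) (y (t k)))) - Max (range (($) (V (t k))))\<bar> \<le> norm (y 0) + real CARD('a) * S"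
  proof -
    have "\<bar>Max (range (($) (y (t k)))) - Max (range (($) (V (t k))))\<bar> \<le> norm (y (t k) - V (t k))"
      by (rule Max_range_vec_diff_le)
    also have "y (t k) - V (t k) = y 0 + \<iota> (t k)"
      using y_eq[OF t_nonneg, of k] by simp
    also have "norm \<dots> \<le> norm (y 0) + norm (\<iota> (t k))"
      by (rule norm_triangle_ineq)
    also have "norm (\<iota> (t k)) \<le> (\<Sum>\<alpha>\<in>UNIV. \<bar>\<iota> (t k) $ \<alpha>\<bar>)"
      by (rule norm_le_l1_cart)
    also have "\<dots> \<le> real CARD('a) * S"
      using noise by (intro sum_bounded_above) auto
    finally show ?thesis by simp
  qed
  ultimately show ?thesis
    using riemann N Y unfolding A_def[symmetric] path_regret_def by linarith
qed

text \<open>The bound does not involve the mesh, so infinitely many controlled grids suffice: among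
  them are arbitrarily fine ones, along which the remaining errors vanish.\<close>

theorem path_regret_bound:
  assumes S: "0 \<le> S" and \<mu>: "0 < \<mu>"
    and freq: "\<exists>\<^sub>F n in sequentially.
      grid_controlled (\<lambda>\<alpha> s. x s $ \<alpha>) (\<lambda>\<alpha> s. \<iota> s $ \<alpha>) \<eta> T S \<mu> G n"
    and t: "t \<in> {0..real T}"
  shows "\<bar>path_regret t\<bar>
    \<le> 2 * H / \<eta> (real T) + norm (y 0) + \<bar>\<Phi> 0\<bar> + 2 * real CARD('a) * S + 4 * K * real CARD('a) * G"
    (is "_ \<le> ?B")
proof (rule field_le_epsilon)
  fix e :: real assume e: "0 < e"
  \<comment> \<open>Three errors are collected: the Riemann sum and the approximation of
    \<open>t\<close> by grid points, each of size \<open>e1\<close>, and the drift squares, which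
    enter with the factor \<open>2 * K * \<eta> 0\<close>.\<close>
  define e1 where "e1 = e / (2 + 2 * K * \<eta> 0)"
  have K\<eta>: "0 < K * \<eta> 0" using K(1) \<eta>_pos[of 0] by simp
  have e1: "0 < e1" "e1 * (2 + 2 * K * \<eta> 0) = e"
    using e K\<eta> by (auto simp: e1_def)
  \<comment> \<open>Noise increments of norm at most \<open>e2\<close> keep the scaled squares in
    the product at most 1.\<close>
  define e2 where "e2 = 1 / sqrt (\<mu> * \<eta> 0)"
  have e2: "0 < e2" "\<mu> * \<eta> 0 * e2\<^sup>2 = 1"
    using \<mu> \<eta>_pos[of 0] by (auto simp: e2_def power_divide)
  have "continuous_on {0..real T} \<iota>"
    by (rule continuous_on_subset[OF \<iota>_cont]) auto
  note ev_\<iota> = eventually_uniform_increment[OF this e2(1)]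
  define k where "k n = nat \<lfloor>t * real (Suc n)\<rfloor>" for n
  have k_real: "real (k n) = real_of_int \<lfloor>t * real (Suc n)\<rfloor>" for n
    using t by (simp add: k_def)
  have k_le: "k n \<le> T * Suc n" for n
  proof -
    have "t * real (Suc n) \<le> real T * real (Suc n)"
      using t by (intro mult_right_mono) auto
    then have "real (k n) \<le> real (T * Suc n)"
      unfolding k_real of_nat_mult by linarith
    then show ?thesis by (simp only: of_nat_le_iff)
  qed
  have k_lim: "(\<lambda>n. grid n (k n)) \<longlonglongrightarrow> t"
    unfolding k_real by (rule floor_grid_tendsto)
  have "(\<lambda>n. path_regret (grid n (k n))) \<longlonglongrightarrow> path_regret t"
    using grid_le[OF k_le]
    by (intro continuous_on_tendsto_compose[OF path_regret_cont[of "real T"] k_lim t]) (auto simp del: of_nat_Suc)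
  from tendstoD[OF this e1(1)]
  have ev_R: "eventually (\<lambda>n. \<bar>path_regret (grid n (k n)) - path_regret t\<bar> < e1) sequentially"
    unfolding dist_real_def .
  have \<iota>0: "\<iota> 0 = 0"
    using y_eq[of 0] by simp
  \<comment> \<open>The control holds for infinitely many indices, the other four properties for all
    large ones, so some index has them all.\<close>
  obtain n where gc: "grid_controlled (\<lambda>\<alpha> s. x s $ \<alpha>) (\<lambda>\<alpha> s. \<iota> s $ \<alpha>) \<eta> T S \<mu> G n"
    and riemann: "\<And>k. k \<le> T * Suc n \<Longrightarrow> \<bar>(\<Sum>j<k. x (grid n j)
          \<bullet> (V (grid n (Suc j)) - V (grid n j)))
        - integral {0..grid n k} (\<lambda>s. v s \<bullet> x s)\<bar> \<le> e1"
    and V_sq: "\<And>k. k \<le> T * Suc n \<Longrightarrow>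
        (\<Sum>j<k. (norm (V (grid n (Suc j)) - V (grid n j)))\<^sup>2) \<le> e1"
    and inc: "\<And>j s. j < T * Suc n \<Longrightarrow> s \<in> {grid n j..grid n (Suc j)} \<Longrightarrow>
        norm (\<iota> s - \<iota> (grid n j)) \<le> e2"
    and R: "\<bar>path_regret (grid n (k n)) - path_regret t\<bar> < e1"
    using frequently_ex[OF frequently_eventually_frequently[OF freq
      eventually_conj[OF eventually_riemann_sum[OF e1(1), of T]
      eventually_conj[OF eventually_V_square_sum[OF e1(1), of T] eventually_conj[OF ev_\<iota> ev_R]]]]]
    by (elim exE conjE) (intro that; blast)
  note gc = gc[unfolded grid_controlled_def \<iota>0 zero_index diff_zero]
  note mart = conjunct1[OF gc, rule_format]
    and noise = conjunct1[OF conjunct2[OF gc], rule_format]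
    and prod = conjunct2[OF conjunct2[OF gc], rule_format]
  define s where "s j = grid n j" for j
  have s: "s 0 = 0" "\<And>j. s j \<le> s (Suc j)" "\<And>j. 0 \<le> s j"
    unfolding s_def by (auto intro: divide_right_mono simp del: of_nat_Suc)
  have small: "\<mu> * \<eta> 0 * (norm (\<iota> (s (Suc j)) - \<iota> (s j)))\<^sup>2 \<le> 1" if "j < T * Suc n" for j
  proof -
    have "norm (\<iota> (s (Suc j)) - \<iota> (s j)) \<le> e2"
      using inc[OF that, of "s (Suc j)"] s(2)[of j] unfolding s_def by simp
    then have "(norm (\<iota> (s (Suc j)) - \<iota> (s j)))\<^sup>2 \<le> e2\<^sup>2"
      by (intro power_mono) auto
    then have "\<mu> * \<eta> 0 * (norm (\<iota> (s (Suc j)) - \<iota> (s j)))\<^sup>2 \<le> \<mu> * \<eta> 0 * e2\<^sup>2"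
      using \<mu> \<eta>_pos[of 0] by (intro mult_left_mono) auto
    then show ?thesis
      using e2(2) by simp
  qed
  have "(\<Sum>j<k n. \<eta> (s j) * (norm (y (s (Suc j)) - y (s j)))\<^sup>2) \<le> 2 * \<eta> 0 * e1 + 4 * real CARD('a) * G"
    using V_sq[OF k_le] prod k_le \<mu> small s(3) unfolding s_def
    by (intro quadratic_increments_le[of _ "k n" "T * Suc n" \<mu>])
  then have "\<bar>path_regret (s (k n))\<bar> \<le> 2 * H / \<eta> (real T) + norm (y 0) + \<bar>\<Phi> 0\<bar>
      + 2 * real CARD('a) * S + K * (2 * \<eta> 0 * e1 + 4 * real CARD('a) * G) + e1"
    using grid_le[OF k_le] riemann[OF k_le] mart[OF k_le] noise[OF k_le] s(1,2) unfolding s_def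
    by (intro path_regret_grid_bound)
  then have "\<bar>path_regret t\<bar> \<le> ?B + e1 * (2 + 2 * K * \<eta> 0)"
    using R unfolding s_def[symmetric] by (simp add: algebra_simps)
  then show "\<bar>path_regret t\<bar> \<le> ?B + e"
    unfolding e1(2) .
qed

end

section \<open>Almost sure growth of the noise and the regret\<close>

lemma borel_measurable_vec_component:
  "f \<in> borel_measurable M \<Longrightarrow> (\<lambda>\<omega>. (f \<omega> :: real ^ 'a::finite) $ \<alpha>) \<in> borel_measurable M"
  by (rule measurable_compose[of f M borel "\<lambda>z. z $ \<alpha>"])
     (auto intro!: borel_measurable_continuous_onI continuous_intros)

lemma brownian_motion_wiener_component:
  fixes W :: "real \<Rightarrow> 'w \<Rightarrow> real ^ 'a::finite"
  assumes F: "filtered_prob_space M F" and W: "wiener_process M F W"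
  shows "brownian_motion M F (\<lambda>t \<omega>. W t \<omega> $ \<alpha>)"
proof -
  interpret prob_space M
    using F by (simp add: filtered_prob_space_def)
  show ?thesis
  proof
    show "filtered_prob_space M F" by (rule F)
    show "adapted F (\<lambda>t \<omega>. W t \<omega> $ \<alpha>)"
      using W by (auto simp: wiener_process_def adapted_def intro: borel_measurable_vec_component)
    fix s t :: real assume st: "0 \<le> s" "s < t"
    show "distributed M lborel (\<lambda>\<omega>. W t \<omega> $ \<alpha> - W s \<omega> $ \<alpha>) (\<lambda>x. ennreal (normal_density 0 (sqrt (t - s)) x))"
      using W st by (auto simp: wiener_process_def)
    have "indep_set (sets (F s)) {(\<lambda>\<omega>. W t \<omega> - W s \<omega>) -` A \<inter> space M |A. A \<in> sets borel}"
      using W st by (auto simp: wiener_process_def)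
    moreover have "{(\<lambda>\<omega>. W t \<omega> $ \<alpha> - W s \<omega> $ \<alpha>) -` A \<inter> space M |A. A \<in> sets borel}
        \<subseteq> {(\<lambda>\<omega>. W t \<omega> - W s \<omega>) -` A \<inter> space M |A. A \<in> sets borel}"
    proof clarify
      fix A :: "real set" assume A: "A \<in> sets borel"
      have "(\<lambda>z::real ^ 'a. z $ \<alpha>) \<in> borel_measurable borel"
        by (intro borel_measurable_vec_component) simp
      from measurable_sets[OF this A] have "(\<lambda>z::real ^ 'a. z $ \<alpha>) -` A \<in> sets borel"
        by simp
      then show "\<exists>A'. (\<lambda>\<omega>. W t \<omega> $ \<alpha> - W s \<omega> $ \<alpha>) -` A \<inter> space M
          = (\<lambda>\<omega>. W t \<omega> - W s \<omega>) -` A' \<inter> space M \<and> A' \<in> sets borel"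
        by (intro exI[of _ "(\<lambda>z::real ^ 'a. z $ \<alpha>) -` A"]) auto
    qed
    ultimately show "indep_set (sets (F s)) {(\<lambda>\<omega>. W t \<omega> $ \<alpha> - W s \<omega> $ \<alpha>) -` A \<inter> space M |A. A \<in> sets borel}"
      by (rule indep_set_mono[OF _ order_refl])
  qed
qed

lemma noise_ito_integral:
  fixes W \<sigma> :: "real \<Rightarrow> 'w \<Rightarrow> real ^ 'a::finite"
  assumes F: "filtered_prob_space M F" and W: "wiener_process M F W" and \<sigma>: "noise_coefficients M F \<sigma>"
    and I: "\<And>\<alpha>. has_ito_integral M F (\<lambda>t \<omega>. W t \<omega> $ \<alpha>) (\<lambda>t \<omega>. \<sigma> t \<omega> $ \<alpha>) (I \<alpha>)"
  obtains C where "\<And>\<alpha>. ito_integral M F (\<lambda>t \<omega>. W t \<omega> $ \<alpha>) (\<lambda>t \<omega>. \<sigma> t \<omega> $ \<alpha>) (I \<alpha>) C"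
proof -
  obtain C where C: "\<And>t \<omega>. 0 \<le> t \<Longrightarrow> \<omega> \<in> space M \<Longrightarrow> norm (\<sigma> t \<omega>) \<le> C"
    using \<sigma> by (auto simp: noise_coefficients_def)
  \<comment> \<open>The 1 makes the constant strictly positive, as \<open>ito_integral\<close>
    demands.\<close>
  have "ito_integral M F (\<lambda>t \<omega>. W t \<omega> $ \<alpha>) (\<lambda>t \<omega>. \<sigma> t \<omega> $ \<alpha>) (I \<alpha>) (max 1 C)" for \<alpha>
  proof -
    interpret brownian_motion M F "\<lambda>t \<omega>. W t \<omega> $ \<alpha>"
      by (rule brownian_motion_wiener_component[OF F W])
    show ?thesis
    proof
      show "\<bar>\<sigma> t \<omega> $ \<alpha>\<bar> \<le> max 1 C" if "0 \<le> t" "\<omega> \<in> space M" for t \<omega>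
        using C[OF that] component_le_norm_cart[of "\<sigma> t \<omega>" \<alpha>] by linarith
      show "(\<lambda>\<omega>. \<sigma> t \<omega> $ \<alpha>) \<in> borel_measurable M" if "0 \<le> t" for t
      proof -
        have "\<sigma> t \<in> borel_measurable (F t)"
          using \<sigma> that by (auto simp: noise_coefficients_def adapted_def)
        from measurable_F_M[OF this] show ?thesis
          by (rule borel_measurable_vec_component)
      qed
      show "continuous_on {0..} (\<lambda>t. \<sigma> t \<omega> $ \<alpha>)" if "\<omega> \<in> space M" for \<omega>
        using \<sigma> that by (auto simp: noise_coefficients_def intro!: continuous_intros)
    qed (use I in auto)
  qed
  then show ?thesis by (rule that)
qed

text \<open>The index \<open>m\<close> is a time scale and \<open>n\<close> the fineness of a grid.  The events of different grids need
  not be nested, so at each scale a path is controlled only along infinitely many grids.\<close>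

theorem (in prob_space) AE_eventually_frequently_not:
  fixes E :: "nat \<Rightarrow> nat \<Rightarrow> 'a set"
  assumes E [measurable]: "\<And>m n. E m n \<in> events" and p: "\<And>m n. prob (E m n) \<le> p m" and sum: "summable p"
  shows "AE \<omega> in M. \<forall>\<^sub>F m in sequentially. \<exists>\<^sub>F n in sequentially. \<omega> \<notin> E m n"
proof -
  \<comment> \<open>The limit inferior over the grids. It is an increasing union of intersections,
    each inside a single \<open>E m k\<close>, so its probability is at most \<open>p m\<close>, and
    Borel-Cantelli is applied in \<open>m\<close> alone.\<close>
  define A where "A m = (\<Union>k. \<Inter>n\<in>{k..}. E m n)" for m
  have [measurable]: "A m \<in> events" for m
    unfolding A_def by measurable
  have "prob (A m) \<le> p m" for m
  proof (rule LIMSEQ_le_const2)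
    show "(\<lambda>k. prob (\<Inter>n\<in>{k..}. E m n)) \<longlonglongrightarrow> prob (A m)"
      unfolding A_def by (rule finite_Lim_measure_incseq) (auto simp: incseq_def)
    have "prob (\<Inter>n\<in>{k..}. E m n) \<le> p m" for k
    proof -
      have "prob (\<Inter>n\<in>{k..}. E m n) \<le> prob (E m k)"
        by (rule finite_measure_mono) auto
      then show ?thesis using p[of m k] by simp
    qed
    then show "\<exists>N. \<forall>k\<ge>N. prob (\<Inter>n\<in>{k..}. E m n) \<le> p m" by blast
  qed
  then have "summable (\<lambda>m. prob (A m))"
    using sum by (intro summable_comparison_test[OF _ sum]) auto
  then have "AE \<omega> in M. \<forall>\<^sub>F m in sequentially. \<omega> \<in> space M - A m"
    by (intro borel_cantelli_AE1) (auto simp: less_top[symmetric])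
  then show ?thesis
  proof eventually_elim
    case (elim \<omega>)
    then show ?case
    proof eventually_elim
      case (elim m)
      then have "\<forall>k. \<exists>n\<ge>k. \<omega> \<notin> E m n"
        by (auto simp: A_def)
      then show ?case
        by (simp add: frequently_sequentially)
    qed
  qed
qed

text \<open>Three kinds of bad events are excluded: large weighted sums, large noise, which is the
  case of weight 1 where the sum telescopes, and large quadratic sums. In the last the weights are
  scaled by \<open>b m\<close>, so that the slack \<open>b m\<close> in the exponent amounts to the
  constant 1 after division.\<close>

lemma ito_integral_grid_deviation:
  fixes B :: "'i::finite \<Rightarrow> real \<Rightarrow> 'w \<Rightarrow> real" and U :: "'i \<Rightarrow> real \<Rightarrow> 'w \<Rightarrow> real"
  assumes I: "\<And>\<alpha>. ito_integral M F (B \<alpha>) (H \<alpha>) (I \<alpha>) C"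
    and U: "\<And>\<alpha> t. 0 \<le> t \<Longrightarrow> U \<alpha> t \<in> borel_measurable (F t)"
      "\<And>\<alpha> t \<omega>. 0 \<le> t \<Longrightarrow> \<omega> \<in> space M \<Longrightarrow> 0 \<le> U \<alpha> t \<omega> \<and> U \<alpha> t \<omega> \<le> 1"
    and w: "\<And>t. 0 \<le> t \<Longrightarrow> 0 \<le> w t"
    and T: "\<And>m. 0 < T m" and b: "\<And>m. 0 < b m" "summable (\<lambda>m. exp (- b m))"
    and D: "\<And>m n. (\<Sum>j<T m * Suc n. w (grid n j) * (1 / real (Suc n))) \<le> D m"
  shows "AE \<omega> in M. \<forall>\<^sub>F m in sequentially. \<exists>\<^sub>F n in sequentially.
    grid_controlled (\<lambda>\<alpha> t. U \<alpha> t \<omega>) (\<lambda>\<alpha> t. I \<alpha> t \<omega>) w (T m) (C * sqrt (2 * b m * real (T m))) (b m)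
      (8 * C\<^sup>2 * D m + 1) n"
proof -
  interpret prob_space M
    using I[of undefined] by (simp add: ito_integral_def brownian_motion_def)
  define g where "g n j = grid n j" for n j
  have g: "0 \<le> g n j" "g n j \<le> g n (Suc j)" "g n 0 = 0" "g n (T * Suc n) = real T"
      "g n (Suc j) - g n j = 1 / real (Suc n)" for n j T
  proof -
    show "g n (T * Suc n) = real T"
      unfolding g_def of_nat_mult by simp
  qed (auto simp: g_def divide_right_mono simp flip: diff_divide_distrib)
  define S where "S m = C * sqrt (2 * b m * real (T m))" for m
  define E1 where "E1 m n \<alpha> = {\<omega>\<in>space M. \<exists>k\<le>T m * Suc n. S m
      \<le> \<bar>\<Sum>j<k. U \<alpha> (g n j) \<omega> * (I \<alpha> (g n (Suc j)) \<omega> - I \<alpha> (g n j) \<omega>)\<bar>}" for m n \<alpha>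
  define E2 where "E2 m n \<alpha> = {\<omega>\<in>space M. \<exists>k\<le>T m * Suc n. S m
      \<le> \<bar>\<Sum>j<k. 1 * (I \<alpha> (g n (Suc j)) \<omega> - I \<alpha> (g n j) \<omega>)\<bar>}" for m n \<alpha>
  define E3 where "E3 m n \<alpha> = {\<omega>\<in>space M.
      exp (8 * C\<^sup>2 * (\<Sum>j<T m * Suc n. (b m * w (g n j)) * (g n (Suc j) - g n j)) + b m)
      \<le> (\<Prod>j<T m * Suc n. 1 + (b m * w (g n j)) * (I \<alpha> (g n (Suc j)) \<omega> - I \<alpha> (g n j) \<omega>)\<^sup>2)}" for m n \<alpha>
  define E where "E m n = (\<Union>\<alpha>. E1 m n \<alpha> \<union> E2 m n \<alpha> \<union> E3 m n \<alpha>)" for m n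
  have bounds: "prob (E1 m n \<alpha>) \<le> 2 * exp (- b m)" "prob (E2 m n \<alpha>) \<le> 2 * exp (- b m)"
      "prob (E3 m n \<alpha>) \<le> exp (- b m)" for m n \<alpha>
  proof -
    interpret ito_integral M F "B \<alpha>" "H \<alpha>" "I \<alpha>" C by (rule I)
    show "prob (E1 m n \<alpha>) \<le> 2 * exp (- b m)"
      unfolding E1_def S_def using g T[of m] b U by (intro ito_sum_deviation) auto
    show "prob (E2 m n \<alpha>) \<le> 2 * exp (- b m)"
      unfolding E2_def S_def using g T[of m] b by (intro ito_sum_deviation) auto
    show "prob (E3 m n \<alpha>) \<le> exp (- b m)"
      unfolding E3_def using g b(1) w
      by (intro ito_quadratic_variation_deviation mult_nonneg_nonneg) (auto intro: less_imp_le)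
  qed
  have IM: "I \<alpha> (g n j) \<in> borel_measurable M" and UM: "U \<alpha> (g n j) \<in> borel_measurable M" for \<alpha> n j
  proof -
    interpret ito_integral M F "B \<alpha>" "H \<alpha>" "I \<alpha>" C by (rule I)
    show "I \<alpha> (g n j) \<in> borel_measurable M" "U \<alpha> (g n j) \<in> borel_measurable M"
      using g by (auto intro: measurable_I measurable_F_M[OF U(1)])
  qed
  note [measurable] = IM UM
  have [measurable]: "E1 m n \<alpha> \<in> events" "E2 m n \<alpha> \<in> events" "E3 m n \<alpha> \<in> events" for m n \<alpha>
    unfolding E1_def E2_def E3_def by measurable
  have [measurable]: "E m n \<in> events" for m n
    unfolding E_def by measurable
  \<comment> \<open>Per coordinate there are two two-sided bounds and one one-sided bound: 2 + 2 +
    1.\<close>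
  have prob_E: "prob (E m n) \<le> real CARD('i) * 5 * exp (- b m)" for m n
  proof -
    have "prob (E m n) \<le> (\<Sum>\<alpha>\<in>UNIV. prob (E1 m n \<alpha> \<union> E2 m n \<alpha> \<union> E3 m n \<alpha>))"
      unfolding E_def by (rule finite_measure_subadditive_finite) auto
    also have "\<dots> \<le> (\<Sum>\<alpha>\<in>(UNIV :: 'i set). 5 * exp (- b m))"
    proof (rule sum_mono)
      fix \<alpha>
      have "prob (E1 m n \<alpha> \<union> E2 m n \<alpha> \<union> E3 m n \<alpha>) \<le> prob (E1 m n \<alpha>) + prob (E2 m n \<alpha>) + prob (E3 m n \<alpha>)"
        by (intro order_trans[OF measure_Un_le] add_mono measure_Un_le order_refl) auto
      then show "prob (E1 m n \<alpha> \<union> E2 m n \<alpha> \<union> E3 m n \<alpha>) \<le> 5 * exp (- b m)"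
        using bounds[of m n \<alpha>] by linarith
    qed
    finally show ?thesis by simp
  qed
  have "AE \<omega> in M. \<forall>\<^sub>F m in sequentially. \<exists>\<^sub>F n in sequentially. \<omega> \<notin> E m n"
    by (rule AE_eventually_frequently_not[OF _ prob_E]) (use b(2) in \<open>auto intro: summable_mult\<close>)
  then show ?thesis
    using AE_space
  proof eventually_elim
    case (elim \<omega>)
    have good: "(\<forall>\<alpha>. \<forall>k\<le>T m * Suc n. \<bar>\<Sum>j<k. U \<alpha> (g n j) \<omega> * (I \<alpha> (g n (Suc j)) \<omega> - I \<alpha> (g n j) \<omega>)\<bar> \<le> S m) \<and>
      (\<forall>\<alpha>. \<forall>k\<le>T m * Suc n. \<bar>I \<alpha> (g n k) \<omega> - I \<alpha> 0 \<omega>\<bar> \<le> S m) \<and>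
      (\<forall>\<alpha>. (\<Prod>j<T m * Suc n. 1 + b m * w (g n j) * (I \<alpha> (g n (Suc j)) \<omega> - I \<alpha> (g n j) \<omega>)\<^sup>2)
          \<le> exp (b m * (8 * C\<^sup>2 * D m + 1)))" if "\<omega> \<notin> E m n" for m n
    proof (intro conjI allI impI)
      fix \<alpha> k assume k: "k \<le> T m * Suc n"
      have "\<omega> \<notin> E1 m n \<alpha>" "\<omega> \<notin> E2 m n \<alpha>"
        using that by (auto simp: E_def)
      then have "\<bar>\<Sum>j<k. U \<alpha> (g n j) \<omega> * (I \<alpha> (g n (Suc j)) \<omega> - I \<alpha> (g n j) \<omega>)\<bar> < S m"
          "\<bar>\<Sum>j<k. 1 * (I \<alpha> (g n (Suc j)) \<omega> - I \<alpha> (g n j) \<omega>)\<bar> < S m"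
        using k elim(2) unfolding E1_def E2_def by force+
      then show "\<bar>\<Sum>j<k. U \<alpha> (g n j) \<omega> * (I \<alpha> (g n (Suc j)) \<omega> - I \<alpha> (g n j) \<omega>)\<bar> \<le> S m"
        and "\<bar>I \<alpha> (g n k) \<omega> - I \<alpha> 0 \<omega>\<bar> \<le> S m"
        using sum_lessThan_telescope[of "\<lambda>j. I \<alpha> (g n j) \<omega>" k] g(3) by simp_all
    next
      fix \<alpha>
      have "\<omega> \<notin> E3 m n \<alpha>"
        using that by (auto simp: E_def)
      then have "(\<Prod>j<T m * Suc n. 1 + b m * w (g n j) * (I \<alpha> (g n (Suc j)) \<omega> - I \<alpha> (g n j) \<omega>)\<^sup>2)
          \<le> exp (8 * C\<^sup>2 * (\<Sum>j<T m * Suc n. (b m * w (g n j)) * (g n (Suc j) - g n j)) + b m)"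
        using elim(2) by (simp add: E3_def)
      also have "(\<Sum>j<T m * Suc n. (b m * w (g n j)) * (g n (Suc j) - g n j))
          = b m * (\<Sum>j<T m * Suc n. w (g n j) * (1 / real (Suc n)))"
        by (simp only: g(5) sum_distrib_left mult.assoc)
      also have "8 * C\<^sup>2 * (b m * (\<Sum>j<T m * Suc n. w (g n j) * (1 / real (Suc n)))) + b m
          = b m * (8 * C\<^sup>2 * (\<Sum>j<T m * Suc n. w (g n j) * (1 / real (Suc n))) + 1)"
        by (simp only: distrib_left mult_1_right mult_ac)
      also have "exp \<dots> \<le> exp (b m * (8 * C\<^sup>2 * D m + 1))"
        using D[where m=m and n=n] b(1)[of m] unfolding g_def by (simp add: mult_left_mono)
      finally show "(\<Prod>j<T m * Suc n. 1 + b m * w (g n j) * (I \<alpha> (g n (Suc j)) \<omega> - I \<alpha> (g n j) \<omega>)\<^sup>2)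
          \<le> exp (b m * (8 * C\<^sup>2 * D m + 1))" .
    qed
    show ?case
      using elim(1)
    proof eventually_elim
      case (elim m)
      then show ?case
        by (rule frequently_elim1) (use good in \<open>simp only: g_def S_def grid_controlled_def\<close>)
    qed
  qed
qed

section \<open>Growth of the learning parameter and passage from dyadic to continuous time\<close>

lemma learning_parameter_power_bound:
  fixes \<gamma> :: real
  assumes mono: "\<And>s t. 0 \<le> s \<Longrightarrow> s \<le> t \<Longrightarrow> \<eta> t \<le> \<eta> s" and pos: "\<And>t. 0 \<le> t \<Longrightarrow> 0 < \<eta> t"
    and "0 < \<gamma>" and asymp: "\<eta> \<sim>[at_top] (\<lambda>t. t powr (-\<gamma>))"
  obtains B where "0 < B" "\<And>t. 0 \<le> t \<Longrightarrow> \<eta> t \<le> B * (1 + t) powr (-\<gamma>)"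
proof -
  have "\<eta> \<in> O(\<lambda>t. t powr (-\<gamma>))"
    using asymp by (rule asymp_equiv_imp_bigo)
  also have "(\<lambda>t. t powr (-\<gamma>)) \<in> O(\<lambda>t::real. (1 + t) powr (-\<gamma>))"
    by real_asymp
  finally obtain c where c: "0 < c" "\<forall>\<^sub>F t in at_top. norm (\<eta> t) \<le> c * norm ((1 + t) powr (-\<gamma>))"
    by (rule landau_o.bigE)
  then obtain t0 where t0: "\<And>t. t0 \<le> t \<Longrightarrow> \<bar>\<eta> t\<bar> \<le> c * (1 + t) powr (-\<gamma>)"
    by (auto simp: eventually_at_top_linorder)
  \<comment> \<open>The asymptotics only concern large times; before \<open>t0\<close> monotonicity
    bounds the rate by \<open>\<eta> 0\<close>. The shift to 1 + t matters at time 0, where the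
    unshifted power would be 0.\<close>
  define B where "B = max c (\<eta> 0 * (1 + max 0 t0) powr \<gamma>)"
  show ?thesis
  proof (rule that)
    show "0 < B" using c(1) by (simp add: B_def)
    fix t :: real assume t: "0 \<le> t"
    show "\<eta> t \<le> B * (1 + t) powr (-\<gamma>)"
    proof (cases "t0 \<le> t")
      case True
      have "c * (1 + t) powr (-\<gamma>) \<le> B * (1 + t) powr (-\<gamma>)"
        by (intro mult_right_mono) (auto simp: B_def)
      then show ?thesis
        using t0[OF True] by linarith
    next
      case False
      have "\<eta> t \<le> \<eta> 0 * ((1 + t) powr \<gamma> * (1 + t) powr (-\<gamma>))"
        using mono[of 0 t] t by (simp add: powr_minus)
      also have "\<dots> \<le> \<eta> 0 * ((1 + max 0 t0) powr \<gamma> * (1 + t) powr (-\<gamma>))"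
        using t False pos[of 0] \<open>0 < \<gamma>\<close> by (intro mult_left_mono mult_right_mono powr_mono2) auto
      also have "\<dots> \<le> B * (1 + t) powr (-\<gamma>)"
        unfolding mult.assoc[symmetric] by (intro mult_right_mono) (auto simp: B_def)
      finally show ?thesis .
    qed
  qed
qed

text \<open>A left Riemann sum of a decreasing power overestimates its integral. Cells have length
  at most 1, so 1 + t at most doubles within a cell, and the factor 2 compensates for this at every
  mesh. The antiderivative then telescopes.\<close>

lemma power_riemann_sum_le:
  fixes \<gamma> :: real
  assumes \<gamma>: "0 < \<gamma>" "\<gamma> < 1" and \<eta>: "\<And>t. 0 \<le> t \<Longrightarrow> \<eta> t \<le> B * (1 + t) powr (-\<gamma>)" and B: "0 < B"
  shows "(\<Sum>j<T * Suc n. \<eta> (grid n j) * (1 / real (Suc n)))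
    \<le> 2 * B / (1 - \<gamma>) * (1 + real T) powr (1 - \<gamma>)"
proof -
  define g where "g j = grid n j" for j
  define p where "p t = (1 + t) powr (1 - \<gamma>) / (1 - \<gamma>)" for t :: real
  have g: "0 \<le> g j" "g j < g (Suc j)" "g (Suc j) - g j = 1 / real (Suc n)" "g (Suc j) - g j \<le> 1" for j
    by (auto simp: g_def divide_strict_right_mono simp flip: diff_divide_distrib)
  have step: "\<eta> (g j) * (1 / real (Suc n)) \<le> 2 * B * p (g (Suc j)) - 2 * B * p (g j)" for j
  proof -
    have "(p has_real_derivative (1 + t) powr (-\<gamma>)) (at t)" if "g j \<le> t" for t
      unfolding p_def using that g(1)[of j] \<gamma> by (auto intro!: derivative_eq_intros)
    from MVT2[OF g(2)[of j] this] obtain z where z: "g j < z" "z < g (Suc j)"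
      and eq: "p (g (Suc j)) - p (g j) = (g (Suc j) - g j) * (1 + z) powr (-\<gamma>)"
      by blast
    have "(1 + g j) powr (-\<gamma>) \<le> 2 * (1 + z) powr (-\<gamma>)"
    proof -
      have "1 + z \<le> 2 * (1 + g j)"
      proof -
        have "z \<le> g j + 1" using z(2) g(4)[of j] by simp
        then show ?thesis using g(1)[of j] by simp
      qed
      then have "(1 + z) powr \<gamma> \<le> (2 * (1 + g j)) powr \<gamma>"
        using z g(1)[of j] \<gamma> by (intro powr_mono2) auto
      also have "\<dots> = 2 powr \<gamma> * (1 + g j) powr \<gamma>"
        by (rule powr_mult)
      also have "\<dots> \<le> 2 powr 1 * (1 + g j) powr \<gamma>"
        using \<gamma> by (intro mult_right_mono powr_mono) auto
      finally have le: "(1 + z) powr \<gamma> \<le> 2 * (1 + g j) powr \<gamma>" by simp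
      show ?thesis
        using le z g(1)[of j] by (simp add: powr_minus field_simps)
    qed
    then have "B * (1 + g j) powr (-\<gamma>) \<le> B * (2 * (1 + z) powr (-\<gamma>))"
      using B by (intro mult_left_mono) auto
    then have "\<eta> (g j) \<le> 2 * B * (1 + z) powr (-\<gamma>)"
      using \<eta>[OF g(1)[of j]] by linarith
    then have "\<eta> (g j) * (g (Suc j) - g j) \<le> 2 * B * (1 + z) powr (-\<gamma>) * (g (Suc j) - g j)"
      using g(2)[of j] by (intro mult_right_mono) auto
    also have "\<dots> = 2 * B * p (g (Suc j)) - 2 * B * p (g j)"
      using eq by (simp add: right_diff_distrib[symmetric] mult_ac)
    finally show ?thesis
      unfolding g(3) .
  qed
  have "(\<Sum>j<T * Suc n. \<eta> (g j) * (1 / real (Suc n))) \<le> (\<Sum>j<T * Suc n. 2 * B * p (g (Suc j)) - 2 * B * p (g j))"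
    by (intro sum_mono step)
  also have "\<dots> = 2 * B * p (g (T * Suc n)) - 2 * B * p (g 0)"
    by (rule sum_lessThan_telescope)
  also have "\<dots> \<le> 2 * B * p (g (T * Suc n))"
    using B \<gamma> by (simp add: p_def)
  also have "g (T * Suc n) = real T"
    unfolding g_def of_nat_mult by simp
  finally show ?thesis
    by (simp add: g_def p_def)
qed

text \<open>Every large time lies below a dyadic horizon at most twice as large, and each term of
  the bound grows with the horizon. The 3 in the logarithm is the 2 from the hypothesis plus 1 for
  rounding the binary logarithm up.\<close>

lemma eventually_bound_from_dyadic:
  fixes R :: "real \<Rightarrow> real" and c0 c1 c2 c3 \<gamma> :: real
  assumes c: "0 \<le> c1" "0 \<le> c2" "0 \<le> c3" and \<gamma>: "\<gamma> < 1"
    and mono: "\<And>s t. 0 \<le> s \<Longrightarrow> s \<le> t \<Longrightarrow> \<eta> t \<le> \<eta> s" and pos: "\<And>t. 0 \<le> t \<Longrightarrow> 0 < \<eta> t"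
    and bound: "\<forall>\<^sub>F m in sequentially. \<forall>t\<in>{0..2 ^ m}. \<bar>R t\<bar> \<le> c0 + c1 / \<eta> (2 ^ m)
        + c2 * sqrt (4 * ln (real m + 2) * 2 ^ m) + c3 * (1 + 2 ^ m) powr (1 - \<gamma>)"
  shows "\<forall>\<^sub>F t in at_top. \<bar>R t\<bar> \<le> c0 + c1 / \<eta> (2 * t)
        + c2 * sqrt (8 * t * ln (log 2 t + 3)) + c3 * (1 + 2 * t) powr (1 - \<gamma>)"
proof -
  let ?B = "\<lambda>m. c0 + c1 / \<eta> (2 ^ m)
        + c2 * sqrt (4 * ln (real m + 2) * 2 ^ m) + c3 * (1 + 2 ^ m) powr (1 - \<gamma>)"
  obtain m0 where m0: "\<forall>m\<ge>m0. \<forall>t\<in>{0..2 ^ m}. \<bar>R t\<bar> \<le> ?B m"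
    using bound unfolding eventually_sequentially by blast
  have "\<forall>\<^sub>F t::real in at_top. 2 ^ m0 \<le> t \<and> 1 \<le> t"
    by (intro eventually_conj eventually_ge_at_top)
  then show ?thesis
  proof eventually_elim
    case (elim t)
    define m where "m = nat \<lceil>log 2 t\<rceil>"
    have log_nonneg: "0 \<le> log 2 t" using elim by simp
    have m: "log 2 t \<le> real m" "real m \<le> log 2 t + 1"
      using log_nonneg by (auto simp: m_def)
    have le: "t \<le> 2 ^ m" "2 ^ m \<le> 2 * t"
    proof -
      have "t = 2 powr log 2 t" using elim by simp
      also have "\<dots> \<le> 2 powr real m" using m by (intro powr_mono) auto
      finally show "t \<le> 2 ^ m" by (simp add: powr_realpow)
      have "2 powr real m \<le> 2 powr (log 2 t + 1)" using m by (intro powr_mono) auto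
      also have "\<dots> = 2 * t" using elim by (simp add: powr_add)
      finally show "2 ^ m \<le> 2 * t" by (simp add: powr_realpow)
    qed
    have "2 ^ m0 \<le> (2::real) ^ m" using elim le by linarith
    then have "m0 \<le> m" by simp
    then have "\<bar>R t\<bar> \<le> ?B m"
      using le elim by (intro m0[rule_format]) auto
    also have "\<dots> \<le> c0 + c1 / \<eta> (2 * t)
        + c2 * sqrt (8 * t * ln (log 2 t + 3)) + c3 * (1 + 2 * t) powr (1 - \<gamma>)"
    proof (intro add_mono order_refl mult_left_mono c)
      have "0 < \<eta> (2 * t)" "\<eta> (2 * t) \<le> \<eta> (2 ^ m)"
        using mono[OF _ le(2)] pos[of "2 * t"] elim by auto
      then show "c1 / \<eta> (2 ^ m) \<le> c1 / \<eta> (2 * t)"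
        using c(1) by (intro divide_left_mono) auto
      have "4 * ln (real m + 2) * 2 ^ m \<le> 4 * ln (log 2 t + 3) * (2 * t)"
        using m le log_nonneg by (intro mult_mono) (auto simp: ln_ge_zero)
      then show "sqrt (4 * ln (real m + 2) * 2 ^ m) \<le> sqrt (8 * t * ln (log 2 t + 3))"
        by (simp add: mult_ac)
      show "(1 + 2 ^ m) powr (1 - \<gamma>) \<le> (1 + 2 * t) powr (1 - \<gamma>)"
        using le \<gamma> by (intro powr_mono2) (auto intro: add_nonneg_nonneg)
    qed
    finally show ?case .
  qed
qed

text \<open>With \<open>g\<close> left abstract, each regime reduces to four comparisons between
  explicit functions.\<close>

lemma bigo_from_dyadic_bound:
  fixes R g :: "real \<Rightarrow> real" and c0 c1 c2 c3 \<gamma> :: real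
  assumes bound: "\<forall>\<^sub>F t in at_top. \<bar>R t\<bar> \<le> c0 + c1 / \<eta> (2 * t)
        + c2 * sqrt (8 * t * ln (log 2 t + 3)) + c3 * (1 + 2 * t) powr (1 - \<gamma>)"
    and asymp: "\<eta> \<sim>[at_top] (\<lambda>t. t powr (-\<gamma>))"
    and g: "(\<lambda>t. 1) \<in> O[at_top](g)" "(\<lambda>t. t powr \<gamma>) \<in> O[at_top](g)"
      "(\<lambda>t. sqrt (8 * t * ln (log 2 t + 3))) \<in> O[at_top](g)" "(\<lambda>t. (1 + 2 * t) powr (1 - \<gamma>)) \<in> O[at_top](g)"
  shows "R \<in> O[at_top](g)"
proof -
  have lim: "filterlim (\<lambda>t::real. 2 * t) at_top at_top"
    by real_asymp
  have "(\<lambda>t. inverse (\<eta> (2 * t))) \<sim>[at_top] (\<lambda>t. inverse ((2 * t) powr (-\<gamma>)))"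
    by (intro asymp_equiv_inverse asymp_equiv_compose'[OF asymp lim])
  then have "(\<lambda>t. inverse (\<eta> (2 * t))) \<in> O(\<lambda>t. inverse ((2 * t) powr (-\<gamma>)))"
    by (rule asymp_equiv_imp_bigo)
  also have "(\<lambda>t. inverse ((2 * t) powr (-\<gamma>))) \<in> O(\<lambda>t::real. t powr \<gamma>)"
    by real_asymp
  also note g(2)
  finally have inv: "(\<lambda>t. inverse (\<eta> (2 * t))) \<in> O(g)" .
  have scale: "(\<lambda>t. c * f t) \<in> O(g)" if "f \<in> O(g)" for c :: real and f
    using that by (cases "c = 0") auto
  have "(\<lambda>t. c0 * 1 + c1 * inverse (\<eta> (2 * t)) + c2 * sqrt (8 * t * ln (log 2 t + 3))
      + c3 * (1 + 2 * t) powr (1 - \<gamma>)) \<in> O(g)"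
    by (intro sum_in_bigo scale g inv)
  moreover have "R \<in> O(\<lambda>t. c0 * 1 + c1 * inverse (\<eta> (2 * t)) + c2 * sqrt (8 * t * ln (log 2 t + 3))
      + c3 * (1 + 2 * t) powr (1 - \<gamma>))"
    using bound by (intro landau_o.big_mono) (auto simp: divide_inverse elim!: eventually_mono)
  ultimately show ?thesis
    by (rule landau_o.big_trans[rotated])
qed

theorem corollary3p2:
  fixes M :: "'w measure"
    and F :: "real \<Rightarrow> 'w measure"
    and h :: "real ^ 'a::finite \<Rightarrow> real"
    and \<eta> :: "real \<Rightarrow> real"
    and \<gamma> :: real
    and v \<sigma> W X Y :: "real \<Rightarrow> 'w \<Rightarrow> real ^ 'a"
  assumes "filtered_prob_space M F"
    and "penalty_function h"
    and "learning_parameter \<eta>"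
    and "0 < \<gamma>" and "\<gamma> < 1"
    and "\<eta> \<sim>[at_top] (\<lambda>t. t powr (-\<gamma>))"
    and "wiener_process M F W"
    and "payoff_stream M v"
    and "noise_coefficients M F \<sigma>"
    and "perturbed_score_process M F v \<sigma> W Y"
    and "\<And>t \<omega>. 0 \<le> t \<Longrightarrow> \<omega> \<in> space M \<Longrightarrow> X t \<omega> = choice_map h (\<eta> t *\<^sub>R Y t \<omega>)"
  shows "(\<gamma> < 1/2 \<longrightarrow>
            (AE \<omega> in M. (\<lambda>t. regret v X t \<omega>) \<in> O[at_top](\<lambda>t. t powr (1 - \<gamma>)))) \<and>
         (\<gamma> = 1/2 \<longrightarrow>
            (AE \<omega> in M. (\<lambda>t. regret v X t \<omega>) \<in> O[at_top](\<lambda>t. sqrt (t * ln (ln t))))) \<and>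
         (1/2 < \<gamma> \<longrightarrow>
            (AE \<omega> in M. (\<lambda>t. regret v X t \<omega>) \<in> O[at_top](\<lambda>t. t powr \<gamma>)))"
proof -
  note F = assms(1) and pen = assms(2) and \<gamma> = assms(4,5) and asymp = assms(6) and W = assms(7)
    and v = assms(8) and \<sigma> = assms(9) and Y = assms(10) and X = assms(11)
  interpret prob_space M
    using F by (simp add: filtered_prob_space_def)
  have \<eta>_pos: "\<And>t. 0 \<le> t \<Longrightarrow> 0 < \<eta> t" and \<eta>_mono: "\<And>s t. 0 \<le> s \<Longrightarrow> s \<le> t \<Longrightarrow> \<eta> t \<le> \<eta> s"
    using assms(3) by (auto simp: learning_parameter_def)
  obtain \<eta>' where "\<forall>t\<ge>0. (\<eta> has_real_derivative \<eta>' t) (at t within {0..})"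
    using assms(3) unfolding learning_parameter_def by blast
  then have \<eta>_cont: "continuous_on {0..} \<eta>"
    by (intro DERIV_continuous_on[of "{0..}" \<eta> \<eta>']) auto
  obtain H where H: "0 \<le> H" "\<And>x. x \<in> simplex_of_measures \<Longrightarrow> \<bar>h x\<bar> \<le> H"
    using penalty_function_bounded[OF pen] by blast
  obtain K where K: "0 < K"
      "\<And>y d. convex_conjugate h y + choice_map h y \<bullet> d \<le> convex_conjugate h (y + d)"
      "\<And>y d. convex_conjugate h (y + d) \<le> convex_conjugate h y + choice_map h y \<bullet> d + K * (norm d)\<^sup>2"
    by (rule convex_conjugate_smooth[OF pen]) (rule that)
  obtain B where B: "0 < B" "\<And>t. 0 \<le> t \<Longrightarrow> \<eta> t \<le> B * (1 + t) powr (-\<gamma>)"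
    using learning_parameter_power_bound[of \<eta> \<gamma>] \<eta>_mono \<eta>_pos \<gamma>(1) asymp by metis
  obtain I where I: "\<And>\<alpha>. has_ito_integral M F (\<lambda>t \<omega>. W t \<omega> $ \<alpha>) (\<lambda>t \<omega>. \<sigma> t \<omega> $ \<alpha>) (I \<alpha>)"
    and Y_eq: "AE \<omega> in M. \<forall>t\<ge>0. \<forall>\<alpha>. Y t \<omega> $ \<alpha> = Y 0 \<omega> $ \<alpha> + integral {0..t} (\<lambda>s. v s \<omega> $ \<alpha>) + I \<alpha> t \<omega>"
    and Y_adapted: "\<And>t. 0 \<le> t \<Longrightarrow> Y t \<in> borel_measurable (F t)"
    using Y unfolding perturbed_score_process_def adapted_def by blast
  obtain C where ito: "\<And>\<alpha>. ito_integral M F (\<lambda>t \<omega>. W t \<omega> $ \<alpha>) (\<lambda>t \<omega>. \<sigma> t \<omega> $ \<alpha>) (I \<alpha>) C"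
    using noise_ito_integral[OF F W \<sigma> I] by blast
  have C: "0 < C"
    using ito[of undefined] by (simp add: ito_integral_def ito_integral_axioms_def)
  have I_cont: "AE \<omega> in M. \<forall>\<alpha>. continuous_on {0..} (\<lambda>t. I \<alpha> t \<omega>)"
    using I by (simp add: has_ito_integral_def AE_all_countable)

  \<comment> \<open>The failure probabilities exp (- b m) are then inverse squares, hence summable,
    while \<open>b m\<close> on the horizon 2^m is of the order of the iterated logarithm.\<close>
  define b where "b m = 2 * ln (real m + 2)" for m
  define T where "T m = (2 ^ m :: nat)" for m
  define D where "D m = 2 * B / (1 - \<gamma>) * (1 + real (T m)) powr (1 - \<gamma>)" for m
  define S where "S m = C * sqrt (2 * b m * real (T m))" for m
  have b_pos: "0 < b m" for m by (simp add: b_def ln_gt_zero)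
  have X_meas: "(\<lambda>\<omega>. X t \<omega> $ \<alpha>) \<in> borel_measurable (F t)" if "0 \<le> t" for \<alpha> t
  proof (rule borel_measurable_vec_component)
    have [measurable]: "choice_map h \<in> borel_measurable borel"
      by (intro borel_measurable_continuous_onI continuous_choice_map pen)
    note [measurable] = Y_adapted[OF that]
    have "(\<lambda>\<omega>. choice_map h (\<eta> t *\<^sub>R Y t \<omega>)) \<in> borel_measurable (F t)"
      by measurable
    moreover have "space (F t) = space M"
      using F by (simp add: filtered_prob_space_def subalgebra_def)
    ultimately show "X t \<in> borel_measurable (F t)"
      using X[OF that] measurable_cong[of "F t" "X t" "\<lambda>\<omega>. choice_map h (\<eta> t *\<^sub>R Y t \<omega>)"] by simp
  qed
  have X_bound: "0 \<le> X t \<omega> $ \<alpha> \<and> X t \<omega> $ \<alpha> \<le> 1" if "0 \<le> t" "\<omega> \<in> space M" for \<alpha> t \<omega>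
    using choice_map_is_max(1)[OF pen] simplex_of_measures_le_1[OF choice_map_is_max(1)[OF pen]]
    by (simp add: X[OF that] simplex_of_measures_def)
  have exp_b: "exp (- b m) = 1 / (real m + 2)\<^sup>2" for m
    by (simp add: b_def exp_minus exp_double inverse_eq_divide)
  have summable_b: "summable (\<lambda>m. exp (- b m))"
  proof -
    have "summable (\<lambda>m. inverse ((real (m + 2))\<^sup>2))"
      by (intro summable_ignore_initial_segment inverse_power_summable) simp
    then show ?thesis
      by (simp add: exp_b inverse_eq_divide add.commute)
  qed
  have D: "(\<Sum>j<T m * Suc n. \<eta> (grid n j) * (1 / real (Suc n))) \<le> D m" for m n
    unfolding D_def by (rule power_riemann_sum_le[OF \<gamma> B(2,1)])
  have D_nonneg: "0 \<le> D m" for m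
    using B \<gamma> by (simp add: D_def)
  have S_nonneg: "0 \<le> S m" for m
    using C b_pos[of m] by (simp add: S_def)

  \<comment> \<open>The weights are the coordinates of \<open>X\<close>: adapted because
    \<open>Y\<close> is, and in [0, 1] because \<open>X\<close> lies in the simplex.\<close>
  have good: "AE \<omega> in M. \<forall>\<^sub>F m in sequentially. \<exists>\<^sub>F n in sequentially.
    grid_controlled (\<lambda>\<alpha> t. X t \<omega> $ \<alpha>) (\<lambda>\<alpha> t. I \<alpha> t \<omega>) \<eta> (T m) (S m) (b m) (8 * C\<^sup>2 * D m + 1) n"
    unfolding S_def
    by (rule ito_integral_grid_deviation[OF ito X_meas X_bound _ _ b_pos summable_b D])
       (auto simp: T_def intro: less_imp_le \<eta>_pos)

  \<comment> \<open>The comparison function is quantified inside, so one pathwise argument and one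
    null set serve all three regimes.\<close>
  have "AE \<omega> in M. \<forall>g. (\<lambda>t. 1) \<in> O[at_top](g) \<longrightarrow> (\<lambda>t. t powr \<gamma>) \<in> O[at_top](g) \<longrightarrow>
      (\<lambda>t. sqrt (8 * t * ln (log 2 t + 3))) \<in> O[at_top](g) \<longrightarrow>
      (\<lambda>t. (1 + 2 * t) powr (1 - \<gamma>)) \<in> O[at_top](g) \<longrightarrow> (\<lambda>t. regret v X t \<omega>) \<in> O[at_top](g)"
    using good I_cont Y_eq v[unfolded payoff_stream_def] AE_space
  proof eventually_elim
    case (elim \<omega>)
    note good = elim(1) and cont = elim(2) and Yw = elim(3) and vw = elim(4) and w = elim(5)
    define \<iota> where "\<iota> t = (\<chi> \<alpha>. I \<alpha> t \<omega>)" for t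
    have component: "integral {0..t} (\<lambda>s. v s \<omega> $ \<alpha>) = integral {0..t} (\<lambda>s. v s \<omega>) $ \<alpha>" if "0 \<le> t" for t \<alpha>
      using vw that by (intro integral_component_eq_cart) (auto simp: absolutely_integrable_on_def)
    have I0: "I \<alpha> 0 \<omega> = 0" for \<alpha>
      using Yw[rule_format, of 0 \<alpha>] by simp
    interpret score_path h \<eta> "\<lambda>t. v t \<omega>" "\<lambda>t. X t \<omega>" "\<lambda>t. Y t \<omega>" \<iota> H K
    proof
      show "continuous_on {0..} \<iota>"
        unfolding \<iota>_def using cont by (intro continuous_on_vec_lambda) auto
      show "Y t \<omega> = Y 0 \<omega> + integral {0..t} (\<lambda>t. v t \<omega>) + \<iota> t" if "0 \<le> t" for t
        using Yw[rule_format, OF that] by (simp add: vec_eq_iff \<iota>_def component[OF that])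
    qed (use pen H K \<eta>_pos \<eta>_mono \<eta>_cont vw X w in auto)
    have regret_eq: "path_regret t = regret v X t \<omega>" if "0 \<le> t" for t
      unfolding path_regret_def regret_def component[OF that] ..
    \<comment> \<open>The quadratic bound \<open>8 * C\<^sup>2 * D m + 1\<close> is split: its 1
      goes into \<open>c0\<close>, the rest into \<open>c3\<close>.\<close>
    define c0 where "c0 = norm (Y 0 \<omega>) + \<bar>score_potential h (\<eta> 0) (Y 0 \<omega>)\<bar> + 4 * K * real CARD('a)"
    define c2 where "c2 = 2 * real CARD('a) * C"
    define c3 where "c3 = 4 * K * real CARD('a) * (8 * C\<^sup>2) * (2 * B / (1 - \<gamma>))"
    let ?B = "\<lambda>m. c0 + 2 * H / \<eta> (2 ^ m)
        + c2 * sqrt (4 * ln (real m + 2) * 2 ^ m) + c3 * (1 + 2 ^ m) powr (1 - \<gamma>)"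
    have "\<forall>\<^sub>F m in sequentially. \<forall>t\<in>{0..2 ^ m}. \<bar>regret v X t \<omega>\<bar> \<le> ?B m"
      using good
    proof eventually_elim
      case (elim m)
      show ?case
      proof
        fix t :: real assume t: "t \<in> {0..2 ^ m}"
        have "\<bar>path_regret t\<bar> \<le> 2 * H / \<eta> (real (T m)) + norm (Y 0 \<omega>)
            + \<bar>score_potential h (\<eta> 0) (Y 0 \<omega>)\<bar> + 2 * real CARD('a) * S m
            + 4 * K * real CARD('a) * (8 * C\<^sup>2 * D m + 1)"
        proof (rule path_regret_bound[OF S_nonneg b_pos])
          show "t \<in> {0..real (T m)}" using t by (simp add: T_def)
          show "\<exists>\<^sub>F n in sequentially. grid_controlled (\<lambda>\<alpha> s. X s \<omega> $ \<alpha>) (\<lambda>\<alpha> s. \<iota> s $ \<alpha>) \<eta> (T m) (S m) (b m)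
              (8 * C\<^sup>2 * D m + 1) n"
            using elim by (simp add: \<iota>_def)
        qed
        \<comment> \<open>As \<open>2 * b m\<close> is 4 ln (m + 2), the term with
          \<open>S m\<close> becomes the square root in \<open>?B\<close>.\<close>
        also have "\<dots> = ?B m"
          by (simp add: c0_def c2_def c3_def S_def D_def b_def T_def algebra_simps)
        finally show "\<bar>regret v X t \<omega>\<bar> \<le> ?B m"
          using regret_eq[of t] t by simp
      qed
    qed
    then have ev: "\<forall>\<^sub>F t in at_top. \<bar>regret v X t \<omega>\<bar> \<le> c0 + 2 * H / \<eta> (2 * t)
        + c2 * sqrt (8 * t * ln (log 2 t + 3)) + c3 * (1 + 2 * t) powr (1 - \<gamma>)"
      by (rule eventually_bound_from_dyadic[rotated -1])
         (use H C K B \<gamma> \<eta>_mono \<eta>_pos in \<open>auto simp: c2_def c3_def\<close>)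
    show ?case
      using bigo_from_dyadic_bound[OF ev asymp] by blast
  qed
  note main = this
  show ?thesis
  proof (intro conjI impI)
    \<comment> \<open>The exponent 1 - \<gamma> of the integrated rate exceeds both 1/2 and
      \<gamma>.\<close>
    assume g: "\<gamma> < 1/2"
    show "AE \<omega> in M. (\<lambda>t. regret v X t \<omega>) \<in> O[at_top](\<lambda>t. t powr (1 - \<gamma>))"
      using main
    proof eventually_elim
      case (elim \<omega>)
      show ?case
        by (rule elim[rule_format]) (use \<gamma> g in real_asymp)+
    qed
  next
    \<comment> \<open>All terms have order sqrt t up to the iterated logarithm, which therefore
      decides.\<close>
    assume g: "\<gamma> = 1/2"
    show "AE \<omega> in M. (\<lambda>t. regret v X t \<omega>) \<in> O[at_top](\<lambda>t. sqrt (t * ln (ln t)))"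
      using main
    proof eventually_elim
      case (elim \<omega>)
      \<comment> \<open>The value of \<gamma> is inserted in the goals that mention it, so that only
        explicit functions are compared.\<close>
      show ?case
        by (rule elim[rule_format]; (unfold g)?; real_asymp)
    qed
  next
    \<comment> \<open>The exponent \<gamma> of 1 / \<eta> exceeds both 1/2 and 1 - \<gamma>.\<close>
    assume g: "1/2 < \<gamma>"
    show "AE \<omega> in M. (\<lambda>t. regret v X t \<omega>) \<in> O[at_top](\<lambda>t. t powr \<gamma>)"
      using main
    proof eventually_elim
      case (elim \<omega>)
      show ?case
        by (rule elim[rule_format]) (use \<gamma> g in real_asymp)+
    qed
  qed
qed

end
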